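(* Let $V$ be an operator space. Let $\mathbf{A}=(A_n)_{n=1}^\infty$ be the matrix set over $\mathcal{G}^\infty_{\mathrm{cb}}(B_V)$ given by $A_n=\{(\delta_V)_n(x) : x\in B_{M_n(V)}\}$ for each $n\in\mathbb N$. Then the closed matrix unit ball of $\mathcal{G}^\infty_{\mathrm{cb}}(B_V)$ is the closure of the absolutely matrix convex hull of $\mathbf{A}$. Moreover, if $\widetilde{\mathbf{A}}=(\widetilde A_n)_{n=1}^\infty$ is the matrix set over $\mathcal{G}^\infty_{\mathrm{cb}}(B_V)$ given by $\widetilde A_n=\{(\delta_V)_n(x)/\|x\| : x\in B_{M_n(V)}\setminus\{0\}\}$ for each $n$, then the closed matrix unit ball of $\mathcal{G}^\infty_{\mathrm{cb}}(B_V)$ is also the closure of the absolutely matrix convex hull of $\widetilde{\mathbf{A}}$.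
   Context: All spaces are complex and complete; $X'$ is the dual of $X$, $B_X$ (resp. $\overline B_X$) is the open (resp. closed) unit ball of $X$. For an operator space $V$, $M_n(V)$ is the space of $n\times n$ matrices over $V$ with its given norm; $V'$ has the operator space structure $M_n(V')=\mathcal{CB}(V,M_n)$, where $\mathcal{CB}$ denotes the completely bounded linear maps. A map $f:B_V\to W$ is holomorphic if it is (complex) Fréchet differentiable at every point. $\mathcal{H}^\infty_{\mathrm{cb}}(B_V)$ is the space of holomorphic $f:B_V\to\mathbb C$ with $\sup\{\|(f(x_{ij}))\|_{M_m} : m\in\mathbb N,\ (x_{ij})\in B_{M_m(V)}\}<\infty$; it is an operator space with matrix norms $\|(f_{k\ell})\|_{M_n(\mathcal{H}^\infty_{\mathrm{cb}}(B_V))}=\sup\{\|(f_{k\ell}(x_{ij}))\|_{M_{mn}} : m\in\mathbb N,\ (x_{ij})\in B_{M_m(V)}\}$. For $x\in B_V$, $\delta_V(x)\in\mathcal{H}^\infty_{\mathrm{cb}}(B_V)'$ is the evaluation $f\mapsto f(x)$, and $\mathcal{G}^\infty_{\mathrm{cb}}(B_V)=\overline{\operatorname{span}}\{\delta_V(x):x\in B_V\}\subseteq\mathcal{H}^\infty_{\mathrm{cb}}(B_V)'$ with the inherited operator space structure. $(\delta_V)_n$ is the entrywise amplification, $(\delta_V)_n((x_{ij}))=(\delta_V(x_{ij}))$ for $(x_{ij})\in B_{M_n(V)}$. A matrix set over $E$ is a sequence $\mathbf{K}=(K_n)_n$ with $K_n\subseteq M_n(E)$; inclusions, intersections and closures are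 taken level by level. It is absolutely matrix convex if (i) $x\in K_n$, $y\in K_m$ imply $x\oplus y\in K_{m+n}$, and (ii) $x\in K_n$, $\alpha\in M_{m,n}$, $\beta\in M_{n,m}$ with $\|\alpha\|,\|\beta\|\le1$ imply $\alpha x\beta\in K_m$. The absolutely matrix convex hull of $\mathbf{K}$ is the smallest absolutely matrix convex matrix set containing $\mathbf{K}$. The closed matrix unit ball of $E$ is $(\overline B_{M_n(E)})_n$.
   Formalization: Absolutely matrix convex sets are also required to have nonempty levels; this changes only the case V = {0}, where the second matrix set is empty, its hull as literally defined would be empty, and the "moreover" claim would fail. *)

theory Defs
  imports
    Complex_Main
    "HOL-Library.Function_Algebras"
    "HOL-Analysis.L2_Norm"
    "Jordan_Normal_Form.Matrix"
begin

section \<open>Matrices over a vector space\<close>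

definition mats :: "nat \<Rightarrow> 'a set \<Rightarrow> 'a mat set" where
  "mats n E = {X \<in> carrier_mat n n. elements_mat X \<subseteq> E}"

definition direct_sum :: "'a::zero mat \<Rightarrow> 'a mat \<Rightarrow> 'a mat" where
  "direct_sum X Y =
     four_block_mat X (0\<^sub>m (dim_row X) (dim_col Y)) (0\<^sub>m (dim_row Y) (dim_col X)) Y"

text \<open>The product \<open>\<alpha> X \<beta>\<close> of a vector-valued matrix \<open>X\<close> with scalar matrices.\<close>

definition bimult ::
  "(complex \<Rightarrow> 'a::comm_monoid_add \<Rightarrow> 'a) \<Rightarrow> complex mat \<Rightarrow> 'a mat \<Rightarrow> complex mat \<Rightarrow> 'a mat" where
  "bimult scale \<alpha> X \<beta> = mat (dim_row \<alpha>) (dim_col \<beta>)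
     (\<lambda>(i, j). \<Sum>k<dim_row X. \<Sum>l<dim_col X. scale (\<alpha> $$ (i, k) * \<beta> $$ (l, j)) (X $$ (k, l)))"

text \<open>The norm of a scalar matrix as an operator between the Hilbert spaces \<open>\<complex>\<^sup>n\<close>.\<close>

definition vnorm :: "complex vec \<Rightarrow> real" where
  "vnorm v = L2_set (\<lambda>i. cmod (v $ i)) {..<dim_vec v}"

definition opnorm :: "complex mat \<Rightarrow> real" where
  "opnorm A = (SUP v \<in> {v \<in> carrier_vec (dim_col A). vnorm v \<le> 1}. vnorm (A *\<^sub>v v))"

text \<open>
  For \<open>T\<close> with values in the \<open>n \<times> n\<close> scalar matrices, \<open>amplify n T X\<close> is the block matrix with
  blocks \<open>T (X\<^sub>i\<^sub>j)\<close>, an element of \<open>M\<^sub>m(M\<^sub>n) = M\<^sub>m\<^sub>n\<close> when \<open>X\<close> is \<open>m \<times> m\<close>. Arranging the same entries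
  as an element of \<open>M\<^sub>n(M\<^sub>m)\<close> amounts to a permutation of the basis and does not change the norm.
\<close>

definition amplify :: "nat \<Rightarrow> ('a \<Rightarrow> complex mat) \<Rightarrow> 'a mat \<Rightarrow> complex mat" where
  "amplify n T X = mat (dim_row X * n) (dim_col X * n)
     (\<lambda>(r, c). T (X $$ (r div n, c div n)) $$ (r mod n, c mod n))"

section \<open>Operator spaces\<close>

text \<open>
  Ruan's axioms. The whole type \<open>'v\<close> is the underlying Banach space; \<open>scaleC\<close> is its complex scalar
  multiplication, extending the real one, and \<open>mnorm\<close> restricted to the \<open>n \<times> n\<close> matrices is the norm
  of \<open>M\<^sub>n(V)\<close>.
\<close>

locale operator_space = vector_space scaleC
  for scaleC :: "complex \<Rightarrow> 'v::banach \<Rightarrow> 'v" +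
  fixes mnorm :: "'v mat \<Rightarrow> real"
  assumes scaleC_of_real: "scaleC (of_real r) v = r *\<^sub>R v"
    and mnorm_1: "mnorm (mat 1 1 (\<lambda>_. v)) = norm v"
    and mnorm_eq_0: "\<lbrakk>0 < n; X \<in> carrier_mat n n\<rbrakk> \<Longrightarrow> mnorm X = 0 \<longleftrightarrow> X = 0\<^sub>m n n"
    and mnorm_scale: "\<lbrakk>0 < n; X \<in> carrier_mat n n\<rbrakk> \<Longrightarrow> mnorm (map_mat (scaleC c) X) = cmod c * mnorm X"
    and mnorm_triangle: "\<lbrakk>0 < n; X \<in> carrier_mat n n; Y \<in> carrier_mat n n\<rbrakk>
      \<Longrightarrow> mnorm (X + Y) \<le> mnorm X + mnorm Y"
    and mnorm_direct_sum: "\<lbrakk>0 < m; 0 < n; X \<in> carrier_mat m m; Y \<in> carrier_mat n n\<rbrakk>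
      \<Longrightarrow> mnorm (direct_sum X Y) = max (mnorm X) (mnorm Y)"
    and mnorm_bimult: "\<lbrakk>0 < m; 0 < n; X \<in> carrier_mat n n; \<alpha> \<in> carrier_mat m n; \<beta> \<in> carrier_mat n m\<rbrakk>
      \<Longrightarrow> mnorm (bimult scaleC \<alpha> X \<beta>) \<le> opnorm \<alpha> * mnorm X * opnorm \<beta>"

definition open_mball :: "('v mat \<Rightarrow> real) \<Rightarrow> nat \<Rightarrow> 'v mat set" where
  "open_mball mnorm n = {X \<in> carrier_mat n n. mnorm X < 1}"

text \<open>
  The spaces derived from \<open>V\<close> are subspaces of function spaces, with pointwise operations. A function
  whose natural domain is a proper subset of its type is extended by \<open>0\<close>.
\<close>

definition fun_scale :: "complex \<Rightarrow> ('a \<Rightarrow> complex) \<Rightarrow> 'a \<Rightarrow> complex" where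
  "fun_scale c f = (\<lambda>x. c * f x)"

interpretation fun_space: vector_space fun_scale
  by unfold_locales (auto simp: fun_scale_def fun_eq_iff algebra_simps)

text \<open>
  The dual of a space \<open>E\<close> of functions with matrix norms \<open>N\<close>, and the norm on \<open>M\<^sub>n\<close> of it that comes
  from identifying \<open>(\<phi>\<^sub>i\<^sub>j)\<close> with the map \<open>f \<mapsto> (\<phi>\<^sub>i\<^sub>j f)\<close> in \<open>CB(E, M\<^sub>n)\<close>.
\<close>

definition dual :: "('a \<Rightarrow> complex) set \<Rightarrow> (('a \<Rightarrow> complex) mat \<Rightarrow> real)
    \<Rightarrow> (('a \<Rightarrow> complex) \<Rightarrow> complex) set" where
  "dual E N = {\<phi>.
     (\<forall>f\<in>E. \<forall>g\<in>E. \<phi> (f + g) = \<phi> f + \<phi> g) \<and>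
     (\<forall>c. \<forall>f\<in>E. \<phi> (fun_scale c f) = c * \<phi> f) \<and>
     (\<exists>C. \<forall>f\<in>E. cmod (\<phi> f) \<le> C * N (mat 1 1 (\<lambda>_. f))) \<and>
     (\<forall>f. f \<notin> E \<longrightarrow> \<phi> f = 0)}"

definition cb_norm :: "'a set \<Rightarrow> ('a mat \<Rightarrow> real) \<Rightarrow> nat \<Rightarrow> ('a \<Rightarrow> complex mat) \<Rightarrow> real" where
  "cb_norm E N n T = Sup {opnorm (amplify n T F) | m F. 0 < m \<and> F \<in> mats m E \<and> N F \<le> 1}"

definition dual_mnorm :: "('a \<Rightarrow> complex) set \<Rightarrow> (('a \<Rightarrow> complex) mat \<Rightarrow> real)
    \<Rightarrow> (('a \<Rightarrow> complex) \<Rightarrow> complex) mat \<Rightarrow> real" where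
  "dual_mnorm E N \<Phi> = cb_norm E N (dim_row \<Phi>) (\<lambda>f. map_mat (\<lambda>\<phi>. \<phi> f) \<Phi>)"

section \<open>The space of completely bounded holomorphic functions and its predual\<close>

text \<open>Complex Frechet differentiability at every point of the open unit ball.\<close>

definition holomorphic_on_ball :: "(complex \<Rightarrow> 'v::banach \<Rightarrow> 'v) \<Rightarrow> ('v \<Rightarrow> complex) \<Rightarrow> bool" where
  "holomorphic_on_ball scaleC f \<longleftrightarrow>
     (\<forall>x. norm x < 1 \<longrightarrow> (\<exists>D. (f has_derivative D) (at x) \<and> (\<forall>c h. D (scaleC c h) = c * D h)))"

definition Hinf_cb :: "(complex \<Rightarrow> 'v::banach \<Rightarrow> 'v) \<Rightarrow> ('v mat \<Rightarrow> real) \<Rightarrow> ('v \<Rightarrow> complex) set" where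
  "Hinf_cb scaleC mnorm = {f.
     holomorphic_on_ball scaleC f \<and>
     bdd_above {opnorm (map_mat f X) | m X. 0 < m \<and> X \<in> open_mball mnorm m} \<and>
     (\<forall>x. \<not> norm x < 1 \<longrightarrow> f x = 0)}"

definition Hinf_cb_mnorm :: "('v mat \<Rightarrow> real) \<Rightarrow> ('v \<Rightarrow> complex) mat \<Rightarrow> real" where
  "Hinf_cb_mnorm mnorm F =
     Sup {opnorm (amplify (dim_row F) (\<lambda>x. map_mat (\<lambda>f. f x) F) X) | m X. 0 < m \<and> X \<in> open_mball mnorm m}"

abbreviation Hinf_cb_dual :: "(complex \<Rightarrow> 'v::banach \<Rightarrow> 'v) \<Rightarrow> ('v mat \<Rightarrow> real)
    \<Rightarrow> (('v \<Rightarrow> complex) \<Rightarrow> complex) set" where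
  "Hinf_cb_dual scaleC mnorm \<equiv> dual (Hinf_cb scaleC mnorm) (Hinf_cb_mnorm mnorm)"

definition Ginf_cb_mnorm :: "(complex \<Rightarrow> 'v::banach \<Rightarrow> 'v) \<Rightarrow> ('v mat \<Rightarrow> real)
    \<Rightarrow> (('v \<Rightarrow> complex) \<Rightarrow> complex) mat \<Rightarrow> real" where
  "Ginf_cb_mnorm scaleC mnorm = dual_mnorm (Hinf_cb scaleC mnorm) (Hinf_cb_mnorm mnorm)"

definition \<delta> :: "(complex \<Rightarrow> 'v::banach \<Rightarrow> 'v) \<Rightarrow> ('v mat \<Rightarrow> real)
    \<Rightarrow> 'v \<Rightarrow> ('v \<Rightarrow> complex) \<Rightarrow> complex" where
  "\<delta> scaleC mnorm x = (\<lambda>f. if f \<in> Hinf_cb scaleC mnorm then f x else 0)"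

definition Ginf_cb :: "(complex \<Rightarrow> 'v::banach \<Rightarrow> 'v) \<Rightarrow> ('v mat \<Rightarrow> real)
    \<Rightarrow> (('v \<Rightarrow> complex) \<Rightarrow> complex) set" where
  "Ginf_cb scaleC mnorm = {\<phi> \<in> Hinf_cb_dual scaleC mnorm. \<forall>e>0.
     \<exists>\<psi> \<in> fun_space.span {\<delta> scaleC mnorm x | x. norm x < 1}.
       Ginf_cb_mnorm scaleC mnorm (mat 1 1 (\<lambda>_. \<phi> - \<psi>)) < e}"

section \<open>Matrix sets\<close>

text \<open>
  A matrix set over \<open>E\<close> is a sequence \<open>K\<close> with \<open>K n \<subseteq> mats n E\<close>; only the levels \<open>n \<ge> 1\<close> are
  meaningful. As usual for absolutely convex sets, absolutely matrix convex sets are taken to be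
  nonempty (equivalently, to contain \<open>0\<close>), so that the hull of the empty matrix set is \<open>{0}\<close>.
\<close>

definition abs_matrix_convex ::
  "(complex \<Rightarrow> 'a::comm_monoid_add \<Rightarrow> 'a) \<Rightarrow> 'a set \<Rightarrow> (nat \<Rightarrow> 'a mat set) \<Rightarrow> bool" where
  "abs_matrix_convex scale E K \<longleftrightarrow>
     (\<forall>n>0. K n \<subseteq> mats n E \<and> K n \<noteq> {}) \<and>
     (\<forall>m>0. \<forall>n>0. \<forall>X \<in> K n. \<forall>Y \<in> K m. direct_sum X Y \<in> K (m + n)) \<and>
     (\<forall>m>0. \<forall>n>0. \<forall>X \<in> K n. \<forall>\<alpha> \<in> carrier_mat m n. \<forall>\<beta> \<in> carrier_mat n m.
        opnorm \<alpha> \<le> 1 \<and> opnorm \<beta> \<le> 1 \<longrightarrow> bimult scale \<alpha> X \<beta> \<in> K m)"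

definition abs_matrix_convex_hull ::
  "(complex \<Rightarrow> 'a::comm_monoid_add \<Rightarrow> 'a) \<Rightarrow> 'a set \<Rightarrow> (nat \<Rightarrow> 'a mat set) \<Rightarrow> nat \<Rightarrow> 'a mat set" where
  "abs_matrix_convex_hull scale E K n =
     \<Inter> {L n | L. abs_matrix_convex scale E L \<and> (\<forall>k>0. K k \<subseteq> L k)}"

definition matrix_closure ::
  "'a::minus set \<Rightarrow> ('a mat \<Rightarrow> real) \<Rightarrow> (nat \<Rightarrow> 'a mat set) \<Rightarrow> nat \<Rightarrow> 'a mat set" where
  "matrix_closure E N K n = {X \<in> mats n E. \<forall>e>0. \<exists>Y \<in> K n. N (X - Y) < e}"

definition closed_mball :: "'a set \<Rightarrow> ('a mat \<Rightarrow> real) \<Rightarrow> nat \<Rightarrow> 'a mat set" where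
  "closed_mball E N n = {X \<in> mats n E. N X \<le> 1}"

definition A_set :: "(complex \<Rightarrow> 'v::banach \<Rightarrow> 'v) \<Rightarrow> ('v mat \<Rightarrow> real)
    \<Rightarrow> nat \<Rightarrow> (('v \<Rightarrow> complex) \<Rightarrow> complex) mat set" where
  "A_set scaleC mnorm n = {map_mat (\<delta> scaleC mnorm) X | X. X \<in> open_mball mnorm n}"

definition A_tilde :: "(complex \<Rightarrow> 'v::banach \<Rightarrow> 'v) \<Rightarrow> ('v mat \<Rightarrow> real)
    \<Rightarrow> nat \<Rightarrow> (('v \<Rightarrow> complex) \<Rightarrow> complex) mat set" where
  "A_tilde scaleC mnorm n =
     {map_mat (fun_scale (of_real (1 / mnorm X))) (map_mat (\<delta> scaleC mnorm) X) | X.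
        X \<in> open_mball mnorm n - {0\<^sub>m n n}}"

end

theory Submission
  imports
    Defs
    "HOL-Complex_Analysis.Complex_Analysis"
    "HOL-Library.Product_Plus"
begin

text \<open>
  Functions in \<open>H\<^sup>\<infinity>\<^sub>c\<^sub>b(B\<^sub>V)\<close> vanish at \<open>0\<close>, because constants are not completely bounded; the Schwarz
  lemma therefore bounds \<open>(\<delta>\<^sub>V)\<^sub>n(X) / \<parallel>X\<parallel>\<close> by \<open>1\<close>. Since the closed matrix unit ball is closed and
  absolutely matrix convex, it contains both closed hulls, and scaling by \<open>\<parallel>X\<parallel>\<close> shows that the hull of
  \<open>\<^bold>A\<close> lies in that of its normalised variant. What remains is a bipolar theorem for the hull of \<open>\<^bold>A\<close>.
  As \<open>\<delta>\<^sub>V(0) = 0\<close>, the points \<open>\<alpha> (\<delta>\<^sub>V)\<^sub>m(X) \<beta>\<close> are stable under direct sums, so the triples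
  \<open>(\<alpha> (\<delta>\<^sub>V)\<^sub>m(X) \<beta> + \<Phi>, A, B)\<close> with \<open>A \<ge> \<alpha>\<alpha>\<^sup>* + c\<parallel>\<Phi>\<parallel>\<close> and \<open>B \<ge> \<beta>\<^sup>*\<beta> + c\<parallel>\<Phi>\<parallel>\<close> form a convex cone with order unit
  \<open>(0, I, I)\<close>. If \<open>(\<Phi>\<^sub>0, I, I)\<close> is outside this cone, Hahn--Banach gives a functional \<open>(l, p, q)\<close> with \<open>p\<close>
  and \<open>q\<close> positive and \<open>|l(\<alpha> (\<delta>\<^sub>V)\<^sub>m(X) \<beta>)| \<le> p(\<alpha>\<alpha>\<^sup>*) + q(\<beta>\<^sup>*\<beta>)\<close>. Absorbing Cholesky factors of \<open>p\<close> and
  \<open>q\<close> into \<open>l\<close> turns \<open>l\<close> into evaluation at a matrix of functions of norm at most \<open>1\<close>, whence \<open>\<parallel>\<Phi>\<^sub>0\<parallel> \<ge> 1\<close>.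
  These functions are holomorphic because \<open>\<delta>\<^sub>V\<close> is, with derivatives in the dual space.
\<close>

section \<open>Bilinear forms and operator norms\<close>

no_notation Finite_Cartesian_Product.vec_nth (infixl \<open>$\<close> 90)
no_notation fps_nth (infixl \<open>$\<close> 75)
hide_const (open) Finite_Cartesian_Product.vec Finite_Cartesian_Product.mat

text \<open>The obstacle is that separation happens at one level \<open>n\<close>, while the
  functions it produces must be bounded at every level. Carrying the two scalar matrices along in
  the triples overcomes this: addition of triples corresponds to direct sums of points of any size,
  so a single real functional on one fixed vector space controls all sizes \<open>m\<close> at once
  and delivers the weights \<open>p\<close> and \<open>q\<close> together with \<open>l\<close>,
  with no minimax argument. The error term has two opposite effects. It lets an arbitrary matrix of
  functionals enter the cone at the price of a multiple of the order unit, which bounds the entries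
  of \<open>l\<close> by \<open>c\<close>. At a triple with both scalar parts \<open>I\<close> it
  forces the error to be at most \<open>1 / c\<close>, so a large \<open>c\<close> means a good
  approximation. The functional acts on the whole dual, so that it can be applied to the derivatives
  of \<delta>. Its identification with evaluation at functions rests on density of the span of the
  point evaluations, hence is made on \<open>Ginf_cb\<close>. The bound by a sum of two forms is an
  arithmetic mean; this is the origin of the factor 1/2 in the functions constructed from
  \<open>l\<close>.\<close>

abbreviation l2 :: "'i set \<Rightarrow> ('i \<Rightarrow> complex) \<Rightarrow> real" where
  "l2 I u \<equiv> L2_set (\<lambda>i. cmod (u i)) I"

text \<open>Bilinear rather than sesquilinear: a bound over all vectors is the same for both, and
  transposing or reindexing then introduces no conjugates.\<close>

abbreviation bform :: "'i set \<Rightarrow> 'j set \<Rightarrow> ('i \<Rightarrow> 'j \<Rightarrow> complex) \<Rightarrow> ('i \<Rightarrow> complex) \<Rightarrow> ('j \<Rightarrow> complex) \<Rightarrow> complex" where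
  "bform I J M u w \<equiv> \<Sum>i\<in>I. \<Sum>j\<in>J. u i * M i j * w j"

abbreviation grid :: "nat \<Rightarrow> nat \<Rightarrow> (nat \<times> nat) set" where
  "grid m n \<equiv> {..<m} \<times> {..<n}"

text \<open>For finite index sets and \<open>0 \<le> C\<close> this says that the operator norm is
  at most \<open>C\<close>. An inequality over arbitrary index sets avoids suprema and allows rows
  to be indexed by pairs.\<close>

definition mbounded :: "'i set \<Rightarrow> 'j set \<Rightarrow> ('i \<Rightarrow> 'j \<Rightarrow> complex) \<Rightarrow> real \<Rightarrow> bool" where
  "mbounded I J M C \<longleftrightarrow>
     (\<forall>u w. cmod (bform I J M u w) \<le> C * l2 I u * l2 J w)"

lemma mboundedD:
  "mbounded I J M C \<Longrightarrow> cmod (bform I J M u w) \<le> C * l2 I u * l2 J w"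
  by (simp add: mbounded_def)

lemma l2_nonneg: "0 \<le> l2 I u"
  by (simp add: L2_set_nonneg)

lemma l2_mult: "l2 I (\<lambda>i. c * u i) = cmod c * l2 I u"
  by (simp add: L2_set_right_distrib norm_mult)

lemma l2_sq: "(l2 I u)\<^sup>2 = (\<Sum>i\<in>I. (cmod (u i))\<^sup>2)"
  by (simp add: L2_set_def sum_nonneg)

lemma l2_le_mono: "0 \<le> a \<Longrightarrow> (\<Sum>i\<in>I. (cmod (u i))\<^sup>2) \<le> a\<^sup>2 \<Longrightarrow> l2 I u \<le> a"
  by (metis l2_sq power2_le_imp_le)

lemma cmod_sum_mult_le: "cmod (\<Sum>i\<in>I. u i * w i) \<le> l2 I u * l2 I w"
proof -
  have "cmod (\<Sum>i\<in>I. u i * w i) \<le> (\<Sum>i\<in>I. \<bar>cmod (u i)\<bar> * \<bar>cmod (w i)\<bar>)"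
    by (rule order_trans[OF norm_sum]) (simp add: norm_mult)
  also have "\<dots> \<le> l2 I u * l2 I w" by (rule L2_set_mult_ineq)
  finally show ?thesis .
qed

lemma mbounded_mono: "mbounded I J M C \<Longrightarrow> C \<le> D \<Longrightarrow> mbounded I J M D"
  unfolding mbounded_def
  by (meson L2_set_nonneg mult_right_mono order_trans)

lemma mbounded_cong:
  "(\<And>i j. i \<in> I \<Longrightarrow> j \<in> J \<Longrightarrow> M i j = M' i j) \<Longrightarrow> mbounded I J M C \<longleftrightarrow> mbounded I J M' C"
  by (simp add: mbounded_def cong: sum.cong)

text \<open>A crude bound whose point is finiteness: it makes the supremum in \<open>opnorm\<close>
  meaningful and later bounds quadratic forms from below.\<close>

lemma mbounded_sum_cmod:
  assumes "finite I" "finite J"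
  shows "mbounded I J M (\<Sum>i\<in>I. \<Sum>j\<in>J. cmod (M i j))"
  unfolding mbounded_def
proof (intro allI)
  fix u w
  have *: "cmod (u i * M i j * w j) \<le> cmod (M i j) * l2 I u * l2 J w" if "i \<in> I" "j \<in> J" for i j
  proof -
    have "cmod (u i) \<le> l2 I u" and "cmod (w j) \<le> l2 J w"
      using assms that by (intro member_le_L2_set; simp)+
    then have "cmod (M i j) * cmod (u i) * cmod (w j) \<le> cmod (M i j) * l2 I u * l2 J w"
      by (intro mult_mono) auto
    then show ?thesis by (simp add: norm_mult mult_ac)
  qed
  have "cmod (bform I J M u w)
      \<le> (\<Sum>i\<in>I. \<Sum>j\<in>J. cmod (M i j) * l2 I u * l2 J w)"
    by (intro sum_norm_le *)
  then show "cmod (bform I J M u w)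
      \<le> (\<Sum>i\<in>I. \<Sum>j\<in>J. cmod (M i j)) * l2 I u * l2 J w"
    by (simp add: sum_distrib_right)
qed

text \<open>Testing the form against the conjugate of \<open>M w\<close> turns its value into the
  squared norm of \<open>M w\<close>; one factor then cancels.\<close>

lemma mbounded_apply:
  assumes "mbounded I J M C" "0 \<le> C"
  shows "l2 I (\<lambda>i. \<Sum>j\<in>J. M i j * w j) \<le> C * l2 J w"
proof -
  define v where "v i = (\<Sum>j\<in>J. M i j * w j)" for i
  have "(\<Sum>i\<in>I. \<Sum>j\<in>J. cnj (v i) * M i j * w j) = (\<Sum>i\<in>I. cnj (v i) * v i)"
    by (simp add: v_def sum_distrib_left mult.assoc)
  also have "\<dots> = complex_of_real ((l2 I v)\<^sup>2)"
    unfolding l2_sq by (simp add: mult.commute[of "cnj _"] complex_norm_square[symmetric])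
  finally have "(l2 I v)\<^sup>2 \<le> C * l2 I (\<lambda>i. cnj (v i)) * l2 J w"
    using mboundedD[OF assms(1), of "\<lambda>i. cnj (v i)" w] by (simp add: norm_power)
  then have "l2 I v * l2 I v \<le> l2 I v * (C * l2 J w)"
    by (simp add: power2_eq_square mult_ac)
  then have "l2 I v \<le> C * l2 J w"
    using assms(2) l2_nonneg[of v I] l2_nonneg[of w J]
    by (cases "l2 I v = 0") (simp_all add: mult_le_cancel_left)
  then show ?thesis by (simp add: v_def)
qed

lemma mbounded_of_apply:
  assumes "\<And>w. l2 I (\<lambda>i. \<Sum>j\<in>J. M i j * w j) \<le> C * l2 J w"
  shows "mbounded I J M C"
  unfolding mbounded_def
proof (intro allI)
  fix u w
  have "(bform I J M u w) = (\<Sum>i\<in>I. u i * (\<Sum>j\<in>J. M i j * w j))"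
    by (simp add: sum_distrib_left mult.assoc)
  also have "cmod \<dots> \<le> l2 I u * l2 I (\<lambda>i. \<Sum>j\<in>J. M i j * w j)" by (rule cmod_sum_mult_le)
  also have "\<dots> \<le> l2 I u * (C * l2 J w)"
    by (intro mult_left_mono assms) (simp add: L2_set_nonneg)
  finally show "cmod (bform I J M u w) \<le> C * l2 I u * l2 J w"
    by (simp add: mult_ac)
qed

lemma mbounded_transpose: "mbounded I J M C \<longleftrightarrow> mbounded J I (\<lambda>j i. M i j) C"
proof -
  have *: "mbounded J I (\<lambda>j i. M i j) C" if "mbounded I J M C" for I :: "'a set" and J :: "'b set" and M
    unfolding mbounded_def
  proof (intro allI)
    fix u w
    have "(\<Sum>j\<in>J. \<Sum>i\<in>I. u j * M i j * w i) = (bform I J M w u)"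
      by (subst sum.swap) (simp add: mult_ac)
    then show "cmod (\<Sum>j\<in>J. \<Sum>i\<in>I. u j * M i j * w i) \<le> C * l2 J u * l2 I w"
      using mboundedD[OF that, of w u] by (simp add: mult_ac)
  qed
  have "mbounded I J M C" if "mbounded J I (\<lambda>j i. M i j) C"
    unfolding mbounded_def
  proof (intro allI)
    fix u w
    have "(\<Sum>j\<in>J. \<Sum>i\<in>I. w j * M i j * u i) = (bform I J M u w)"
      by (subst sum.swap) (simp add: mult_ac)
    then show "cmod (bform I J M u w) \<le> C * l2 I u * l2 J w"
      using mboundedD[OF that, of w u] by (simp add: mult_ac)
  qed
  with * show ?thesis by blast
qed

lemma mbounded_reindex:
  assumes h: "bij_betw h I' I" and k: "bij_betw k J' J"
  shows "mbounded I J M C \<longleftrightarrow> mbounded I' J' (\<lambda>i j. M (h i) (k j)) C"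
proof
  assume L: "mbounded I J M C"
  show "mbounded I' J' (\<lambda>i j. M (h i) (k j)) C"
    unfolding mbounded_def
  proof (intro allI)
    fix u w :: "_ \<Rightarrow> complex"
    define u' where "u' = u \<circ> the_inv_into I' h"
    define w' where "w' = w \<circ> the_inv_into J' k"
    have u: "u' (h i) = u i" if "i \<in> I'" for i
      using h that by (auto simp: u'_def bij_betw_def the_inv_into_f_f)
    have w: "w' (k i) = w i" if "i \<in> J'" for i
      using k that by (auto simp: w'_def bij_betw_def the_inv_into_f_f)
    have "(bform I J M u' w') = (\<Sum>i\<in>I'. \<Sum>j\<in>J'. u' (h i) * M (h i) (k j) * w' (k j))"
      by (simp add: sum.reindex_bij_betw[OF h, symmetric] sum.reindex_bij_betw[OF k, symmetric])
    also have "\<dots> = (\<Sum>i\<in>I'. \<Sum>j\<in>J'. u i * M (h i) (k j) * w j)"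
      by (simp add: u w)
    finally have *: "(bform I J M u' w') = \<dots>" .
    have "(\<Sum>i\<in>I. (cmod (u' i))\<^sup>2) = (\<Sum>i\<in>I'. (cmod (u i))\<^sup>2)"
      by (simp add: sum.reindex_bij_betw[OF h, symmetric] u)
    moreover have "(\<Sum>i\<in>J. (cmod (w' i))\<^sup>2) = (\<Sum>i\<in>J'. (cmod (w i))\<^sup>2)"
      by (simp add: sum.reindex_bij_betw[OF k, symmetric] w)
    ultimately show "cmod (\<Sum>i\<in>I'. \<Sum>j\<in>J'. u i * M (h i) (k j) * w j) \<le> C * l2 I' u * l2 J' w"
      using mboundedD[OF L, of u' w'] unfolding * by (simp add: L2_set_def)
  qed
next
  assume L: "mbounded I' J' (\<lambda>i j. M (h i) (k j)) C"
  show "mbounded I J M C"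
    unfolding mbounded_def
  proof (intro allI)
    fix u w
    have "cmod (\<Sum>i\<in>I'. \<Sum>j\<in>J'. u (h i) * M (h i) (k j) * w (k j))
        \<le> C * l2 I' (\<lambda>i. u (h i)) * l2 J' (\<lambda>j. w (k j))"
      using L by (rule mboundedD)
    then show "cmod (bform I J M u w) \<le> C * l2 I u * l2 J w"
      by (simp add: L2_set_def sum.reindex_bij_betw[OF h, symmetric] sum.reindex_bij_betw[OF k, symmetric])
  qed
qed


section \<open>Operator norms expressed by bilinear forms\<close>

lemma vnorm_mult_mat_vec:
  assumes "A \<in> carrier_mat r c" "v \<in> carrier_vec c"
  shows "vnorm (A *\<^sub>v v) = l2 {..<r} (\<lambda>i. \<Sum>j<c. A $$ (i, j) * v $ j)"
  using assms unfolding vnorm_def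
  by (intro L2_set_cong) (auto simp: scalar_prod_def atLeast0LessThan intro!: arg_cong[of _ _ cmod] sum.cong)

lemma bdd_above_opnorm:
  assumes A: "A \<in> carrier_mat r c"
  shows "bdd_above ((\<lambda>v. vnorm (A *\<^sub>v v)) ` {v \<in> carrier_vec (dim_col A). vnorm v \<le> 1})"
proof (rule bdd_aboveI2)
  let ?C = "\<Sum>i<r. \<Sum>j<c. cmod (A $$ (i, j))"
  fix v assume v: "v \<in> {v \<in> carrier_vec (dim_col A). vnorm v \<le> 1}"
  have "l2 {..<r} (\<lambda>i. \<Sum>j<c. A $$ (i, j) * v $ j) \<le> ?C * l2 {..<c} (\<lambda>j. v $ j)"
    by (intro mbounded_apply mbounded_sum_cmod) (auto intro!: sum_nonneg)
  also have "\<dots> \<le> ?C * 1"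
    using v A by (intro mult_left_mono) (auto simp: vnorm_def intro!: sum_nonneg)
  finally show "vnorm (A *\<^sub>v v) \<le> ?C"
    using v A by (simp add: vnorm_mult_mat_vec)
qed

lemma opnorm_ball_nonempty: "{v \<in> carrier_vec n. vnorm v \<le> 1} \<noteq> {}"
  by (rule ex_in_conv[THEN iffD1], rule exI[of _ "0\<^sub>v n"]) (simp add: vnorm_def L2_set_def)

text \<open>Removes the supremum from \<open>opnorm\<close>. In the direction towards
  \<open>mbounded\<close> a vector has to be normalised, so a vector of norm zero is treated
  apart.\<close>

lemma opnorm_le_iff:
  assumes A: "A \<in> carrier_mat r c" and C: "0 \<le> C"
  shows "opnorm A \<le> C \<longleftrightarrow> mbounded {..<r} {..<c} (\<lambda>i j. A $$ (i, j)) C"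
proof
  assume M: "mbounded {..<r} {..<c} (\<lambda>i j. A $$ (i, j)) C"
  show "opnorm A \<le> C" unfolding opnorm_def
  proof (rule cSUP_least[OF opnorm_ball_nonempty])
    fix v assume v: "v \<in> {v \<in> carrier_vec (dim_col A). vnorm v \<le> 1}"
    have "vnorm (A *\<^sub>v v) \<le> C * l2 {..<c} (\<lambda>j. v $ j)"
      using v A mbounded_apply[OF M C] by (simp add: vnorm_mult_mat_vec)
    also have "\<dots> \<le> C * 1" using v A C by (intro mult_left_mono) (auto simp: vnorm_def)
    finally show "vnorm (A *\<^sub>v v) \<le> C" by simp
  qed
next
  assume O: "opnorm A \<le> C"
  show "mbounded {..<r} {..<c} (\<lambda>i j. A $$ (i, j)) C"
  proof (rule mbounded_of_apply)
    fix w :: "nat \<Rightarrow> complex"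
    let ?n = "l2 {..<c} w"
    show "l2 {..<r} (\<lambda>i. \<Sum>j<c. A $$ (i, j) * w j) \<le> C * ?n"
    proof (cases "?n = 0")
      case True
      then have "\<And>j. j < c \<Longrightarrow> w j = 0" by (simp add: L2_set_eq_0_iff)
      then show ?thesis using True by (simp add: L2_set_def)
    next
      case False
      then have n: "?n > 0" using l2_nonneg[of w] by (simp add: less_le)
      define v where "v = vec c (\<lambda>j. of_real (1 / ?n) * w j)"
      have vj: "v $ j = of_real (1 / ?n) * w j" if "j < c" for j using that by (simp add: v_def)
      have "vnorm v = l2 {..<c} (\<lambda>j. of_real (1 / ?n) * w j)"
        unfolding vnorm_def by (rule L2_set_cong) (auto simp: v_def)
      also have "\<dots> = 1" unfolding l2_mult using n by (simp add: norm_divide)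
      finally have v: "v \<in> {v \<in> carrier_vec (dim_col A). vnorm v \<le> 1}" using A by (simp add: v_def)
      have "vnorm (A *\<^sub>v v) \<le> C"
        using cSUP_upper[OF v bdd_above_opnorm[OF A]] O unfolding opnorm_def by linarith
      moreover have "vnorm (A *\<^sub>v v) = l2 {..<r} (\<lambda>i. of_real (1 / ?n) * (\<Sum>j<c. A $$ (i, j) * w j))"
        using v A by (subst vnorm_mult_mat_vec[OF A])
          (auto intro!: L2_set_cong arg_cong[of _ _ cmod] sum.cong simp: vj sum_distrib_left mult_ac)
      moreover have "\<dots> = l2 {..<r} (\<lambda>i. \<Sum>j<c. A $$ (i, j) * w j) / ?n"
        unfolding l2_mult using n by (simp add: norm_divide)
      ultimately have "l2 {..<r} (\<lambda>i. \<Sum>j<c. A $$ (i, j) * w j) / ?n \<le> C" by argo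
      then show ?thesis using n by (simp only: pos_divide_le_eq)
    qed
  qed
qed

lemma opnorm_nonneg: "0 \<le> opnorm A"
proof -
  have "0\<^sub>v (dim_col A) \<in> {v \<in> carrier_vec (dim_col A). vnorm v \<le> 1}"
    by (simp add: vnorm_def L2_set_def)
  from cSUP_upper[OF this bdd_above_opnorm, of "dim_row A" "dim_col A"]
  have "vnorm (A *\<^sub>v 0\<^sub>v (dim_col A)) \<le> opnorm A" unfolding opnorm_def by auto
  moreover have "0 \<le> vnorm (A *\<^sub>v 0\<^sub>v (dim_col A))" by (simp add: vnorm_def L2_set_nonneg)
  ultimately show ?thesis by linarith
qed


section \<open>Block matrices indexed by pairs\<close>

lemma bij_betw_divmod:
  assumes "0 < (n::nat)"
  shows "bij_betw (\<lambda>(a, s). a * n + s) (grid m n) {..<m * n}"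
proof (rule bij_betw_byWitness[where f' = "\<lambda>r. (r div n, r mod n)"])
  show "(\<lambda>(a, s). a * n + s) ` (grid m n) \<subseteq> {..<m * n}"
  proof clarsimp
    fix a s assume "a < m" "s < n"
    then have "a * n + s < Suc a * n" by simp
    also have "\<dots> \<le> m * n" using \<open>a < m\<close> by (intro mult_le_mono1) simp
    finally show "a * n + s < m * n" .
  qed
next
  show "(\<lambda>r. (r div n, r mod n)) ` {..<m * n} \<subseteq> grid m n"
    using assms by (auto simp: less_mult_imp_div_less)
qed (use assms in \<open>simp_all add: split_beta\<close>)

lemma amplify_carrier: "X \<in> carrier_mat m m \<Longrightarrow> amplify n T X \<in> carrier_mat (m * n) (m * n)"
  by (simp add: amplify_def)

text \<open>The block matrix of \<open>amplify\<close> with rows and columns indexed by (block,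
  position in the block) instead of quotient and remainder. Exchanging the roles of the two
  arguments of a pairing becomes a swap of coordinates.\<close>

definition block_entries :: "('a \<Rightarrow> 'k \<Rightarrow> 'l \<Rightarrow> complex) \<Rightarrow> 'a mat \<Rightarrow> nat \<times> 'k \<Rightarrow> nat \<times> 'l \<Rightarrow> complex" where
  "block_entries T X = (\<lambda>(a, s) (b, t). T (X $$ (a, b)) s t)"

abbreviation block_bounded :: "nat \<Rightarrow> nat \<Rightarrow> ('a \<Rightarrow> complex) mat \<Rightarrow> 'a mat \<Rightarrow> real \<Rightarrow> bool" where
  "block_bounded m n F X \<equiv> mbounded (grid m n) (grid m n) (block_entries (\<lambda>x s t. (F $$ (s, t)) x) X)"

lemma opnorm_amplify_le_iff:
  assumes n: "0 < n" and X: "X \<in> carrier_mat m m" and C: "0 \<le> C"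
  shows "opnorm (amplify n T X) \<le> C \<longleftrightarrow>
    mbounded (grid m n) (grid m n) (block_entries (\<lambda>x s t. T x $$ (s, t)) X) C"
proof -
  have lt: "a * n + s < m * n" if "a < m" "s < n" for a s
    using bij_betwE[OF bij_betw_divmod[OF n, of m]] that by (metis SigmaI case_prod_conv lessThan_iff)
  let ?h = "\<lambda>(a, s). a * n + s" and ?I = "grid m n"
  have "opnorm (amplify n T X) \<le> C \<longleftrightarrow>
      mbounded {..<m * n} {..<m * n} (\<lambda>i j. amplify n T X $$ (i, j)) C"
    by (rule opnorm_le_iff[OF amplify_carrier[OF X] C])
  also have "\<dots> \<longleftrightarrow> mbounded ?I ?I (\<lambda>i j. amplify n T X $$ (?h i, ?h j)) C"
    by (rule mbounded_reindex[OF bij_betw_divmod[OF n] bij_betw_divmod[OF n]])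
  also have "\<dots> \<longleftrightarrow> mbounded ?I ?I (block_entries (\<lambda>x s t. T x $$ (s, t)) X) C"
  proof (rule mbounded_cong)
    fix i j assume "i \<in> ?I" "j \<in> ?I"
    then obtain a s b t where ij: "i = (a, s)" "j = (b, t)" "a < m" "s < n" "b < m" "t < n" by auto
    then show "amplify n T X $$ (?h i, ?h j) = block_entries (\<lambda>x s t. T x $$ (s, t)) X i j"
      using lt[of a s] lt[of b t] carrier_matD[OF X] by (simp add: amplify_def block_entries_def)
  qed
  finally show ?thesis .
qed

section \<open>Separation from cones and the Cholesky factorisation\<close>

text \<open>The scalar multiplication is a parameter, to be instantiated with \<open>tscale\<close>
  on triples.\<close>

definition convex_cone_wrt :: "(real \<Rightarrow> 'a::ab_group_add \<Rightarrow> 'a) \<Rightarrow> 'a set \<Rightarrow> bool" where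
  "convex_cone_wrt sc C \<longleftrightarrow> 0 \<in> C \<and> (\<forall>x\<in>C. \<forall>y\<in>C. x + y \<in> C) \<and> (\<forall>r\<ge>0. \<forall>x\<in>C. sc r x \<in> C)"

lemma convex_cone_wrt_Union_chain:
  assumes "\<C> \<noteq> {}" "\<And>M. M \<in> \<C> \<Longrightarrow> convex_cone_wrt sc M"
    and "\<And>M N. M \<in> \<C> \<Longrightarrow> N \<in> \<C> \<Longrightarrow> M \<subseteq> N \<or> N \<subseteq> M"
  shows "convex_cone_wrt sc (\<Union>\<C>)"
  unfolding convex_cone_wrt_def
proof (intro conjI ballI allI impI)
  show "0 \<in> \<Union>\<C>" using assms(1,2) by (auto simp: convex_cone_wrt_def)
next
  fix x y assume "x \<in> \<Union>\<C>" "y \<in> \<Union>\<C>"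
  then obtain M N where "M \<in> \<C>" "x \<in> M" "N \<in> \<C>" "y \<in> N" by blast
  with assms(3)[of M N] obtain K where "K \<in> \<C>" "x \<in> K" "y \<in> K" by blast
  with assms(2)[of K] show "x + y \<in> \<Union>\<C>" by (auto simp: convex_cone_wrt_def)
next
  fix r :: real and x assume "0 \<le> r" "x \<in> \<Union>\<C>"
  then obtain M where "M \<in> \<C>" "x \<in> M" by blast
  moreover with assms(2)[of M] \<open>0 \<le> r\<close> have "sc r x \<in> M" by (auto simp: convex_cone_wrt_def)
  ultimately show "sc r x \<in> \<Union>\<C>" by blast
qed

lemma convex_cone_wrt_add_ray:
  assumes vs: "vector_space sc" and C: "convex_cone_wrt sc C"
  shows "convex_cone_wrt sc {c + sc s x | c s. c \<in> C \<and> 0 \<le> s}"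
  unfolding convex_cone_wrt_def
proof (intro conjI ballI allI impI)
  interpret vector_space sc by fact
  show "0 \<in> {c + sc s x | c s. c \<in> C \<and> 0 \<le> s}"
    using C by (intro CollectI exI[of _ 0]) (simp add: convex_cone_wrt_def)
  fix u v assume "u \<in> {c + sc s x | c s. c \<in> C \<and> 0 \<le> s}" "v \<in> {c + sc s x | c s. c \<in> C \<and> 0 \<le> s}"
  then obtain c s d t where "u = c + sc s x" "v = d + sc t x" "c \<in> C" "d \<in> C" "0 \<le> s" "0 \<le> t"
    by blast
  then show "u + v \<in> {c + sc s x | c s. c \<in> C \<and> 0 \<le> s}"
    using C by (intro CollectI exI[of _ "c + d"] exI[of _ "s + t"])
      (simp add: convex_cone_wrt_def scale_left_distrib algebra_simps)
next
  interpret vector_space sc by fact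
  fix r :: real and u assume "0 \<le> r" "u \<in> {c + sc s x | c s. c \<in> C \<and> 0 \<le> s}"
  then obtain c s where "u = c + sc s x" "c \<in> C" "0 \<le> s" by blast
  then show "sc r u \<in> {c + sc s x | c s. c \<in> C \<and> 0 \<le> s}"
    using C \<open>0 \<le> r\<close> by (intro CollectI exI[of _ "sc r c"] exI[of _ "r * s"])
      (simp add: convex_cone_wrt_def scale_right_distrib)
qed

lemma subset_add_ray: "vector_space sc \<Longrightarrow> C \<subseteq> {c + sc s x | c s. c \<in> C \<and> (0::real) \<le> s}"
proof
  fix c assume "vector_space sc" "c \<in> C"
  then have "c = c + sc 0 x" by (simp add: module.scale_zero_left module_iff_vector_space)
  with \<open>c \<in> C\<close> show "c \<in> {c + sc s x | c s. c \<in> C \<and> 0 \<le> s}" by blast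
qed

text \<open>Take a maximal convex cone \<open>M\<close> that contains \<open>C\<close> and
  \<open>- z\<close> but not \<open>- e\<close>. Maximality forces \<open>x\<close> or
  \<open>- x\<close> into \<open>M\<close> for every \<open>x\<close>, so \<open>M\<close> is a
  total preorder on \<open>E\<close> with \<open>e\<close> as order unit, and the functional reads
  off the position of \<open>x\<close> on the line through \<open>e\<close>.\<close>

lemma cone_separation:
  fixes sc :: "real \<Rightarrow> 'a::ab_group_add \<Rightarrow> 'a"
  assumes vs: "vector_space sc" and E: "module.subspace sc E"
    and C: "convex_cone_wrt sc C" "C \<subseteq> E" and e: "e \<in> E" and z: "z \<in> E" "z \<notin> C"
    and core: "\<And>x. x \<in> E \<Longrightarrow> \<exists>t>0. x + sc t e \<in> C"
  obtains \<Lambda> where "\<And>x y. x \<in> E \<Longrightarrow> y \<in> E \<Longrightarrow> \<Lambda> (x + y) = \<Lambda> x + \<Lambda> y"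
    "\<And>r x. x \<in> E \<Longrightarrow> \<Lambda> (sc r x) = r * \<Lambda> x"
    "\<And>x. x \<in> C \<Longrightarrow> 0 \<le> \<Lambda> x" "\<Lambda> e = 1" "\<Lambda> z \<le> (0::real)"
proof -
  interpret vector_space sc by fact
  have Eadd: "x + y \<in> E" if "x \<in> E" "y \<in> E" for x y using E that subspace_add by blast
  have Esc: "sc r x \<in> E" if "x \<in> E" for x r using E that subspace_scale by blast
  have C0: "0 \<in> C" and Cadd: "\<And>x y. x \<in> C \<Longrightarrow> y \<in> C \<Longrightarrow> x + y \<in> C"
    and Csc: "\<And>r x. 0 \<le> r \<Longrightarrow> x \<in> C \<Longrightarrow> sc r x \<in> C"
    using C(1) by (auto simp: convex_cone_wrt_def)
  have eC: "e \<in> C"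
  proof -
    from core[of 0] E obtain t where t: "t > 0" "sc t e \<in> C" by (auto simp: subspace_0)
    have "sc (1 / t) (sc t e) \<in> C" by (rule Csc[OF _ t(2)]) (use t in simp)
    then show ?thesis using \<open>t > 0\<close> by simp
  qed
  define P where "P M \<longleftrightarrow> convex_cone_wrt sc M \<and> C \<subseteq> M \<and> M \<subseteq> E \<and> - z \<in> M \<and> - e \<notin> M" for M
  define C' where "C' = {c + sc s (- z) | c s. c \<in> C \<and> 0 \<le> s}"
  have "P C'"
    unfolding P_def
  proof (intro conjI)
    show "convex_cone_wrt sc C'" unfolding C'_def by (rule convex_cone_wrt_add_ray[OF vs C(1)])
    show "C \<subseteq> C'" unfolding C'_def by (rule subset_add_ray[OF vs])
    show "C' \<subseteq> E" using C(2) subspace_neg[OF E z(1)] Eadd Esc by (auto simp: C'_def simp del: scale_minus_right)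
    show "- z \<in> C'" using C0 by (auto simp: C'_def intro!: exI[of _ 0] exI[of _ 1])
    \<comment> \<open>For \<open>s > 0\<close> a relation \<open>- e = c - s z\<close> would make
      \<open>z\<close> a positive multiple of an element of \<open>C\<close>. For
      \<open>s = 0\<close> it would put \<open>- e\<close> into \<open>C\<close>, and then the order
      unit property would put \<open>z\<close> there too.\<close>
    show "- e \<notin> C'"
    proof
      assume "- e \<in> C'"
      then obtain c s where c: "- e = c + sc s (- z)" "c \<in> C" "0 \<le> s" by (auto simp: C'_def)
      then have sz: "sc s z = c + e" by (simp add: algebra_simps)
      show False
      proof (cases "s = 0")
        case True
        with sz c eC have "- e \<in> C" by (metis add.commute add_0 minus_unique scale_zero_left neg_eq_iff_add_eq_0)
        obtain t where t: "t > 0" "z + sc t e \<in> C" using core z by blast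
        have "sc t (- e) \<in> C" using t \<open>- e \<in> C\<close> by (intro Csc) auto
        from Cadd[OF t(2) this] have "z \<in> C" by simp
        with z show False by simp
      next
        case False
        have "sc (1 / s) (sc s z) \<in> C" unfolding sz using c eC by (intro Csc Cadd) auto
        with False z show False by simp
      qed
    qed
  qed
  have "\<exists>M\<in>{M. P M}. \<forall>X\<in>{M. P M}. M \<subseteq> X \<longrightarrow> X = M"
  proof (rule subset_Zorn_nonempty)
    show "{M. P M} \<noteq> {}" using \<open>P C'\<close> by blast
    fix \<C> assume ch: "\<C> \<noteq> {}" "subset.chain {M. P M} \<C>"
    have *: "P M" if "M \<in> \<C>" for M using ch that by (auto simp: subset.chain_def)
    have "convex_cone_wrt sc (\<Union>\<C>)"
      by (rule convex_cone_wrt_Union_chain[OF ch(1)]) (use * ch(2) in \<open>auto simp: P_def subset_chain_def\<close>)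
    then show "\<Union>\<C> \<in> {M. P M}" using * ch(1) unfolding P_def mem_Collect_eq by blast
  qed
  then obtain M where PM: "P M" and max: "\<And>X. P X \<Longrightarrow> M \<subseteq> X \<Longrightarrow> X = M" by blast
  have Mc: "convex_cone_wrt sc M" and CM: "C \<subseteq> M" and ME: "M \<subseteq> E" and zM: "- z \<in> M" and eM: "- e \<notin> M"
    using PM by (auto simp: P_def)
  have Madd: "\<And>x y. x \<in> M \<Longrightarrow> y \<in> M \<Longrightarrow> x + y \<in> M"
    and Msc: "\<And>r x. 0 \<le> r \<Longrightarrow> x \<in> M \<Longrightarrow> sc r x \<in> M"
    using Mc by (auto simp: convex_cone_wrt_def)
  \<comment> \<open>If adjoining the ray through \<open>x\<close> did not produce
    \<open>- e\<close>, maximality would place \<open>x\<close> in \<open>M\<close>.\<close>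
  have ext: "\<exists>m\<in>M. \<exists>s>0. - e = m + sc s x" if "x \<in> E" "x \<notin> M" for x
  proof (rule ccontr)
    assume no: "\<not> (\<exists>m\<in>M. \<exists>s>0. - e = m + sc s x)"
    define X where "X = {c + sc s x | c s. c \<in> M \<and> 0 \<le> s}"
    have MX: "M \<subseteq> X" unfolding X_def by (rule subset_add_ray[OF vs])
    have xX: "x \<in> X" using C0 CM by (auto simp: X_def intro!: exI[of _ 0] exI[of _ 1])
    have "P X"
      unfolding P_def
    proof (intro conjI)
      show "convex_cone_wrt sc X" unfolding X_def by (rule convex_cone_wrt_add_ray[OF vs Mc])
      show "X \<subseteq> E" using ME that Eadd Esc by (auto simp: X_def)
      show "- e \<notin> X"
      proof
        assume "- e \<in> X"
        then obtain m s where "m \<in> M" "0 \<le> s" "- e = m + sc s x" by (auto simp: X_def)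
        with no eM show False by (cases "s = 0") (auto simp: less_le)
      qed
    qed (use MX CM zM in auto)
    from max[OF this MX] xX that show False by simp
  qed
  \<comment> \<open>If neither belonged to \<open>M\<close>, each would yield an expression for
    \<open>- e\<close>. The combination in which the two multiples of \<open>x\<close> cancel puts a
    positive multiple of \<open>- e\<close> into \<open>M\<close>.\<close>
  have total: "x \<in> M \<or> - x \<in> M" if xE: "x \<in> E" for x
  proof (rule ccontr)
    assume n: "\<not> (x \<in> M \<or> - x \<in> M)"
    obtain m s where m: "m \<in> M" "s > 0" "- e = m + sc s x" using ext[OF xE] n by blast
    have "- x \<in> E" using E xE by (rule subspace_neg)
    then obtain m' s' where m': "m' \<in> M" "s' > 0" "- e = m' + sc s' (- x)"
      using ext[of "- x"] n by blast
    have "sc s' (- e) = sc s' m + sc (s * s') x" "sc s (- e) = sc s m' - sc (s * s') x"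
      by (simp only: m(3) scale_right_distrib scale_scale mult.commute)
        (simp only: m'(3) scale_right_distrib scale_scale scale_minus_right diff_conv_add_uminus)
    then have "sc s' (- e) + sc s (- e) = sc s' m + sc s m'"
      by simp
    then have "sc (s + s') (- e) \<in> M"
      using Madd[OF Msc[of s' m] Msc[of s m']] m m' by (simp only: scale_left_distrib add.commute less_imp_le)
    then have "sc (1 / (s + s')) (sc (s + s') (- e)) \<in> M"
      by (rule Msc[rotated]) (use m m' in simp)
    moreover have "1 / (s + s') * (s + s') = 1" using m m' by simp
    ultimately show False using eM by (simp only: scale_scale scale_one)
  qed
  have e_iff: "sc t e \<in> M \<longleftrightarrow> 0 \<le> t" for t
  proof
    assume a: "sc t e \<in> M"
    show "0 \<le> t"
    proof (rule ccontr)
      assume "\<not> 0 \<le> t"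
      then have "sc (- 1 / t) (sc t e) \<in> M" using Msc[OF _ a, of "- 1 / t"] by simp
      moreover have "- 1 / t * t = - 1" using \<open>\<not> 0 \<le> t\<close> by simp
      ultimately show False using eM by (simp only: scale_scale) simp
    qed
  qed (use eC CM Msc in auto)
  \<comment> \<open>A half line extending to minus infinity; for \<open>x\<close> in
    \<open>E\<close> it is nonempty and bounded above. Its supremum measures how many copies of
    \<open>e\<close> fit below \<open>x\<close> in the preorder of \<open>M\<close>.\<close>
  define S where "S x = {t. x - sc t e \<in> M}" for x
  define \<Lambda> where "\<Lambda> x = Sup (S x)" for x
  have down: "t' \<in> S x" if "t \<in> S x" "t' \<le> t" for t t' x
  proof -
    have "(x - sc t e) + sc (t - t') e \<in> M" using that by (intro Madd) (auto simp: S_def e_iff)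
    then show ?thesis by (simp add: S_def scale_left_diff_distrib)
  qed
  have ne: "S x \<noteq> {}" if "x \<in> E" for x
  proof -
    obtain t where "x + sc t e \<in> C" using core[OF \<open>x \<in> E\<close>] by blast
    then have "- t \<in> S x" using CM by (auto simp: S_def)
    then show ?thesis by blast
  qed
  have bdd: "bdd_above (S x)" if x: "x \<in> E" for x
  proof -
    obtain t where t: "- x + sc t e \<in> M" using core[of "- x"] x E subspace_neg CM by blast
    have "s \<le> t" if "s \<in> S x" for s
    proof -
      have "(x - sc s e) + (- x + sc t e) \<in> M"
        by (rule Madd[OF _ t]) (use that in \<open>simp add: S_def\<close>)
      then have "sc (t - s) e \<in> M" by (simp add: scale_left_diff_distrib)
      then show ?thesis by (simp add: e_iff)
    qed
    then show ?thesis by (rule bdd_aboveI)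
  qed
  have le: "t \<le> \<Lambda> x" if "x \<in> E" "t \<in> S x" for t x
    unfolding \<Lambda>_def using bdd[OF that(1)] that(2) by (rule cSup_upper[rotated])
  have inS: "t \<in> S x" if xt: "x \<in> E" "t < \<Lambda> x" for t x
  proof -
    obtain s where "s \<in> S x" "t < s"
      using xt(2) less_cSup_iff[OF ne[OF xt(1)] bdd[OF xt(1)]] unfolding \<Lambda>_def by blast
    then show ?thesis using down by (meson less_imp_le)
  qed
  have super: "\<Lambda> x + \<Lambda> y \<le> \<Lambda> (x + y)" if x: "x \<in> E" and y: "y \<in> E" for x y
  proof (rule field_le_epsilon)
    fix d :: real assume "0 < d"
    then have "\<Lambda> x - d / 2 \<in> S x" "\<Lambda> y - d / 2 \<in> S y" using inS x y by auto
    then have "(x - sc (\<Lambda> x - d / 2) e) + (y - sc (\<Lambda> y - d / 2) e) \<in> M"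
      using Madd by (auto simp: S_def)
    moreover have "(x - sc (\<Lambda> x - d / 2) e) + (y - sc (\<Lambda> y - d / 2) e) = x + y - sc (\<Lambda> x + \<Lambda> y - d) e"
      by (simp add: algebra_simps scale_left_distrib scale_left_diff_distrib flip: scale_left_distrib)
    ultimately have "\<Lambda> x + \<Lambda> y - d \<in> S (x + y)" by (simp add: S_def)
    from le[OF Eadd[OF x y] this] show "\<Lambda> x + \<Lambda> y \<le> \<Lambda> (x + y) + d" by simp
  qed
  have Lte: "\<Lambda> (sc t e) = t" for t
  proof -
    have "S (sc t e) = {..t}"
      by (auto simp: S_def e_iff simp flip: scale_left_diff_distrib)
    then show ?thesis by (simp add: \<Lambda>_def)
  qed
  have L0: "\<Lambda> 0 = 0" using Lte[of 0] by simp
  have neg: "\<Lambda> (- x) = - \<Lambda> x" if x: "x \<in> E" for x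
  proof (rule antisym)
    have nx: "- x \<in> E" using E x subspace_neg by blast
    show "\<Lambda> (- x) \<le> - \<Lambda> x" using super[OF x nx] L0 by simp
    \<comment> \<open>This is where totality enters: just above the supremum, \<open>x - t e\<close>
      is not in \<open>M\<close>, hence its negative is.\<close>
    show "- \<Lambda> x \<le> \<Lambda> (- x)"
    proof (rule field_le_epsilon)
      fix d :: real assume "0 < d"
      then have "\<Lambda> x + d \<notin> S x" using le[OF x] by fastforce
      then have "- (x - sc (\<Lambda> x + d) e) \<in> M" using total[of "x - sc (\<Lambda> x + d) e"] x e E Esc
        by (auto simp: S_def subspace_diff)
      moreover have "- x - sc (- \<Lambda> x - d) e = - (x - sc (\<Lambda> x + d) e)"
        by (simp add: scale_left_distrib scale_left_diff_distrib)
      ultimately have "- \<Lambda> x - d \<in> S (- x)" by (simp only: S_def mem_Collect_eq)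
      from le[OF nx this] show "- \<Lambda> x \<le> \<Lambda> (- x) + d" by simp
    qed
  qed
  have add: "\<Lambda> (x + y) = \<Lambda> x + \<Lambda> y" if x: "x \<in> E" and y: "y \<in> E" for x y
  proof (rule antisym[OF _ super[OF x y]])
    have "- y \<in> E" using E y subspace_neg by blast
    from super[OF Eadd[OF x y] this] show "\<Lambda> (x + y) \<le> \<Lambda> x + \<Lambda> y" using neg[OF y] by simp
  qed
  have posge: "r * \<Lambda> x \<le> \<Lambda> (sc r x)" if x: "x \<in> E" and r: "r > 0" for r x
  proof (rule field_le_epsilon)
    fix d :: real assume "0 < d"
    then have "\<Lambda> x - d / r \<in> S x" using inS x r by simp
    then have "sc r (x - sc (\<Lambda> x - d / r) e) \<in> M" using r by (auto simp: S_def intro!: Msc)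
    moreover have "r * (\<Lambda> x - d / r) = r * \<Lambda> x - d" using r by (simp add: field_simps)
    ultimately have "r * \<Lambda> x - d \<in> S (sc r x)" by (simp add: S_def scale_right_diff_distrib)
    from le[OF Esc[OF x] this] show "r * \<Lambda> x \<le> \<Lambda> (sc r x) + d" by simp
  qed
  have pos: "\<Lambda> (sc r x) = r * \<Lambda> x" if x: "x \<in> E" and r: "r > 0" for r x
  proof (rule antisym[OF _ posge[OF x r]])
    have "1 / r * \<Lambda> (sc r x) \<le> \<Lambda> (sc (1 / r) (sc r x))"
      by (rule posge) (use Esc x r in auto)
    then show "\<Lambda> (sc r x) \<le> r * \<Lambda> x" using r by (simp add: field_simps)
  qed
  have hom: "\<Lambda> (sc r x) = r * \<Lambda> x" if x: "x \<in> E" for r x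
  proof -
    consider "r > 0" | "r = 0" | "r < 0" by linarith
    then show ?thesis
    proof cases
      case 3
      then have "\<Lambda> (- sc (- r) x) = - (- r * \<Lambda> x)" using x Esc by (simp only: neg pos)
      then show ?thesis by simp
    qed (use pos x L0 in auto)
  qed
  show ?thesis
  proof (rule that[of \<Lambda>])
    fix x assume "x \<in> C"
    then have "0 \<in> S x" "x \<in> E" using CM C(2) by (auto simp: S_def)
    then show "0 \<le> \<Lambda> x" using le by blast
  next
    have "0 \<in> S (- z)" "- z \<in> E" using zM ME by (auto simp: S_def)
    then have "0 \<le> \<Lambda> (- z)" using le by blast
    then show "\<Lambda> z \<le> 0" using neg[OF z(1)] by simp
  qed (use add hom Lte[of 1] in auto)
qed

text \<open>Induction by completing the square in the last variable. The factor \<open>r'\<close>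
  and its inverse \<open>r\<close> are built together, with both one-sided inverse identities,
  because each of them is used when the separating functional is renormalised.\<close>

lemma cholesky_hermitian:
  fixes w :: "nat \<Rightarrow> nat \<Rightarrow> complex"
  assumes "\<And>i j. i < n \<Longrightarrow> j < n \<Longrightarrow> w j i = cnj (w i j)"
    and "\<And>u. \<exists>i<n. u i \<noteq> 0 \<Longrightarrow> 0 < Re (\<Sum>i<n. \<Sum>j<n. u i * w i j * cnj (u j))"
  shows "\<exists>r r'. (\<forall>u. (\<Sum>i<n. \<Sum>j<n. u i * w i j * cnj (u j)) = of_real (\<Sum>s<n. (cmod (\<Sum>i<n. r' s i * u i))\<^sup>2))
    \<and> (\<forall>s<n. \<forall>t<n. (\<Sum>i<n. r' s i * r i t) = (if s = t then 1 else 0))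
    \<and> (\<forall>i<n. \<forall>j<n. (\<Sum>s<n. r i s * r' s j) = (if i = j then 1 else 0))"
  using assms
proof (induction n arbitrary: w)
  case 0
  then show ?case by simp
next
  case (Suc n)
  define d where "d = Re (w n n)"
  have wnn: "w n n = of_real d" using Suc.prems(1)[of n n] by (simp add: d_def complex_eq_iff)
  \<comment> \<open>Testing the form at the last unit vector makes the pivot positive.\<close>
  have "0 < Re (\<Sum>i<Suc n. \<Sum>j<Suc n. (if i = n then 1 else 0) * w i j * cnj (if j = n then 1 else 0))"
    by (rule Suc.prems(2)) auto
  also have "(\<Sum>i<Suc n. \<Sum>j<Suc n. (if i = n then 1 else 0) * w i j * cnj (if j = n then 1 else 0)) = w n n"
    by simp
  finally have d: "0 < d" by (simp add: d_def)
  define c where "c i = w i n / of_real d" for i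
  have win: "w i n = of_real d * c i" for i using d by (simp add: c_def)
  have wni: "w n i = of_real d * cnj (c i)" if "i < n" for i
    using Suc.prems(1)[of i n] that win[of i] by simp
  \<comment> \<open>The Schur complement of the pivot, that is, the form left after the square of
    the last variable has been split off.\<close>
  define w' where "w' i j = w i j - of_real d * c i * cnj (c j)" for i j
  have split: "(\<Sum>i<Suc n. \<Sum>j<Suc n. u i * w i j * cnj (u j))
      = (\<Sum>i<n. \<Sum>j<n. u i * w' i j * cnj (u j)) + of_real (d * (cmod (u n + (\<Sum>i<n. c i * u i)))\<^sup>2)" for u
  proof -
    define T where "T = (\<Sum>i<n. c i * u i)"
    have T': "cnj T = (\<Sum>i<n. cnj (c i) * cnj (u i))" by (simp add: T_def)
    have 1: "(\<Sum>i<n. \<Sum>j<n. u i * (of_real d * c i * cnj (c j)) * cnj (u j)) = of_real d * T * cnj T"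
      unfolding T' unfolding T_def by (simp add: sum_distrib_left sum_distrib_right mult_ac)
    have 2: "(\<Sum>i<n. u i * w i n * cnj (u n)) = of_real d * T * cnj (u n)"
      unfolding T_def by (simp add: sum_distrib_left sum_distrib_right mult_ac win)
    have 3: "(\<Sum>i<n. u n * w n i * cnj (u i)) = of_real d * u n * cnj T"
      unfolding T' by (simp add: sum_distrib_left sum_distrib_right mult_ac wni)
    have "(\<Sum>i<Suc n. \<Sum>j<Suc n. u i * w i j * cnj (u j))
       = (\<Sum>i<n. \<Sum>j<n. u i * w i j * cnj (u j)) + (\<Sum>i<n. u i * w i n * cnj (u n))
         + (\<Sum>i<n. u n * w n i * cnj (u i)) + u n * w n n * cnj (u n)"
      by (simp add: sum.distrib)
    also have "(\<Sum>i<n. \<Sum>j<n. u i * w i j * cnj (u j))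
       = (\<Sum>i<n. \<Sum>j<n. u i * w' i j * cnj (u j)) + of_real d * T * cnj T"
      unfolding 1[symmetric] by (simp add: w'_def sum.distrib[symmetric] algebra_simps)
    finally show ?thesis
      unfolding 2 3 wnn T_def[symmetric] of_real_mult
      by (simp only: complex_norm_square complex_cnj_add) (simp add: algebra_simps)
  qed
  have herm': "w' j i = cnj (w' i j)" if "i < n" "j < n" for i j
    using Suc.prems(1)[of i j] that by (simp add: w'_def)
  have pos': "0 < Re (\<Sum>i<n. \<Sum>j<n. u i * w' i j * cnj (u j))" if "\<exists>i<n. u i \<noteq> 0" for u
  proof -
    \<comment> \<open>The last coordinate is chosen so that the split-off square vanishes; the full
      form at \<open>v\<close> is then the Schur complement at \<open>u\<close>.\<close>
    define v where "v i = (if i = n then - (\<Sum>i<n. c i * u i) else u i)" for i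
    have "\<exists>i<Suc n. v i \<noteq> 0" using that by (auto simp: v_def intro: less_SucI)
    from Suc.prems(2)[OF this] show ?thesis unfolding split by (simp add: v_def)
  qed
  have "\<exists>r r'. (\<forall>u. (\<Sum>i<n. \<Sum>j<n. u i * w' i j * cnj (u j)) = of_real (\<Sum>s<n. (cmod (\<Sum>i<n. r' s i * u i))\<^sup>2))
    \<and> (\<forall>s<n. \<forall>t<n. (\<Sum>i<n. r' s i * r i t) = (if s = t then 1 else 0))
    \<and> (\<forall>i<n. \<forall>j<n. (\<Sum>s<n. r i s * r' s j) = (if i = j then 1 else 0))"
    by (rule Suc.IH[OF herm' pos'])
  then obtain r r' where
    Q: "\<And>u. (\<Sum>i<n. \<Sum>j<n. u i * w' i j * cnj (u j)) = of_real (\<Sum>s<n. (cmod (\<Sum>i<n. r' s i * u i))\<^sup>2)"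
    and r'r: "\<And>s t. s < n \<Longrightarrow> t < n \<Longrightarrow> (\<Sum>i<n. r' s i * r i t) = (if s = t then 1 else 0)"
    and rr': "\<And>i j. i < n \<Longrightarrow> j < n \<Longrightarrow> (\<Sum>s<n. r i s * r' s j) = (if i = j then 1 else 0)"
    by (elim exE conjE) blast
  define q where "q = complex_of_real (sqrt d)"
  have q: "q \<noteq> 0" "(cmod q)\<^sup>2 = d" using d by (auto simp: q_def)
  \<comment> \<open>The new row of \<open>R'\<close> is \<open>q\<close> times the linear form under
    the split-off square, where \<open>q\<close> is the square root of the pivot. Both
    \<open>R'\<close> and \<open>R\<close> are block triangular, so the inverse is explicit.\<close>
  define R' where "R' s i = (if s < n then (if i < n then r' s i else 0) else if i < n then q * c i else q)" for s i
  define R where "R i s = (if i < n then (if s < n then r i s else 0)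
    else if s < n then - (\<Sum>k<n. c k * r k s) else 1 / q)" for i s
  have "(\<Sum>i<Suc n. \<Sum>j<Suc n. u i * w i j * cnj (u j))
      = of_real (\<Sum>s<Suc n. (cmod (\<Sum>i<Suc n. R' s i * u i))\<^sup>2)" for u
  proof -
    have "(\<Sum>i<n. q * c i * u i) + q * u n = q * (u n + (\<Sum>i<n. c i * u i))"
      by (simp add: algebra_simps sum_distrib_left)
    then show ?thesis
      unfolding split Q by (simp add: R'_def norm_mult power_mult_distrib q)
  qed
  moreover have "(\<Sum>i<Suc n. R' s i * R i t) = (if s = t then 1 else 0)" if "s < Suc n" "t < Suc n" for s t
  proof -
    have "(\<Sum>i<n. q * c i * r i t) = q * (\<Sum>i<n. c i * r i t)" by (simp add: sum_distrib_left mult.assoc)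
    then show ?thesis using that q(1) r'r by (auto simp: R'_def R_def less_Suc_eq)
  qed
  moreover have "(\<Sum>s<Suc n. R i s * R' s j) = (if i = j then 1 else 0)" if "i < Suc n" "j < Suc n" for i j
  proof -
    have "(\<Sum>s<n. - (\<Sum>k<n. c k * r k s) * r' s j) = - c j" if j: "j < n"
    proof -
      have "(\<Sum>s<n. - (\<Sum>k<n. c k * r k s) * r' s j) = - (\<Sum>s<n. \<Sum>k<n. c k * (r k s * r' s j))"
        by (simp add: sum_distrib_right sum_negf mult.assoc)
      also have "\<dots> = - (\<Sum>k<n. c k * (\<Sum>s<n. r k s * r' s j))"
        by (subst sum.swap) (simp add: sum_distrib_left)
      also have "\<dots> = - (\<Sum>k<n. c k * (if k = j then 1 else 0))"
        using rr' j by simp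
      also have "(\<Sum>k<n. c k * (if k = j then 1 else 0)) = (\<Sum>k<n. if k = j then c j else 0)"
        by (rule sum.cong) auto
      finally show ?thesis using j by simp
    qed
    then show ?thesis using that q(1) rr' by (auto simp: R'_def R_def less_Suc_eq)
  qed
  ultimately show ?case by (intro exI[of _ R] exI[of _ R'] conjI allI impI)
qed

text \<open>The real part of the form sees only the Hermitian part \<open>v\<close> of
  \<open>w\<close>, so \<open>w\<close> itself may be arbitrary.\<close>

lemma cholesky:
  fixes w :: "nat \<Rightarrow> nat \<Rightarrow> complex"
  assumes pos: "\<And>u. \<exists>i<n. u i \<noteq> 0 \<Longrightarrow> 0 < Re (\<Sum>i<n. \<Sum>j<n. u i * w i j * cnj (u j))"
  obtains r' r where
    "\<And>u. Re (\<Sum>i<n. \<Sum>j<n. u i * w i j * cnj (u j)) = (\<Sum>s<n. (cmod (\<Sum>i<n. r' s i * u i))\<^sup>2)"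
    "\<And>s t. s < n \<Longrightarrow> t < n \<Longrightarrow> (\<Sum>i<n. r' s i * r i t) = (if s = t then 1 else 0)"
    "\<And>i j. i < n \<Longrightarrow> j < n \<Longrightarrow> (\<Sum>s<n. r i s * r' s j) = (if i = j then 1 else 0)"
proof -
  define v where "v i j = (w i j + cnj (w j i)) / 2" for i j
  have eq: "Re (\<Sum>i<n. \<Sum>j<n. u i * v i j * cnj (u j)) = Re (\<Sum>i<n. \<Sum>j<n. u i * w i j * cnj (u j))" for u
  proof -
    let ?W = "\<Sum>i<n. \<Sum>j<n. u i * w i j * cnj (u j)"
    have "cnj ?W = (\<Sum>i<n. \<Sum>j<n. u i * cnj (w j i) * cnj (u j))"
      by (subst sum.swap) (simp add: mult_ac)
    then have "?W + cnj ?W = (\<Sum>i<n. \<Sum>j<n. u i * w i j * cnj (u j) + u i * cnj (w j i) * cnj (u j))"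
      by (simp only: sum.distrib)
    also have "\<dots> = (\<Sum>i<n. \<Sum>j<n. 2 * (u i * v i j * cnj (u j)))"
      by (intro sum.cong refl) (simp add: v_def field_simps)
    also have "\<dots> = 2 * (\<Sum>i<n. \<Sum>j<n. u i * v i j * cnj (u j))"
      by (simp only: sum_distrib_left)
    finally have "complex_of_real (2 * Re ?W) = 2 * (\<Sum>i<n. \<Sum>j<n. u i * v i j * cnj (u j))"
      unfolding complex_add_cnj .
    from arg_cong[OF this, of Re] show ?thesis by (simp del: Re_sum)
  qed
  have "\<exists>r r'. (\<forall>u. (\<Sum>i<n. \<Sum>j<n. u i * v i j * cnj (u j)) = of_real (\<Sum>s<n. (cmod (\<Sum>i<n. r' s i * u i))\<^sup>2))
    \<and> (\<forall>s<n. \<forall>t<n. (\<Sum>i<n. r' s i * r i t) = (if s = t then 1 else 0))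
    \<and> (\<forall>i<n. \<forall>j<n. (\<Sum>s<n. r i s * r' s j) = (if i = j then 1 else 0))"
  proof (rule cholesky_hermitian)
    fix u :: "nat \<Rightarrow> complex" assume "\<exists>i<n. u i \<noteq> 0"
    then show "0 < Re (\<Sum>i<n. \<Sum>j<n. u i * v i j * cnj (u j))" unfolding eq by (rule pos)
  qed (simp add: v_def add.commute)
  then obtain r r' where *: "\<And>u. (\<Sum>i<n. \<Sum>j<n. u i * v i j * cnj (u j)) = of_real (\<Sum>s<n. (cmod (\<Sum>i<n. r' s i * u i))\<^sup>2)"
    "\<forall>s<n. \<forall>t<n. (\<Sum>i<n. r' s i * r i t) = (if s = t then 1 else 0)"
    "\<forall>i<n. \<forall>j<n. (\<Sum>s<n. r i s * r' s j) = (if i = j then 1 else 0)" by (elim exE conjE) blast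
  show ?thesis
  proof (rule that[of r' r])
    fix u show "Re (\<Sum>i<n. \<Sum>j<n. u i * w i j * cnj (u j)) = (\<Sum>s<n. (cmod (\<Sum>i<n. r' s i * u i))\<^sup>2)"
      unfolding eq[symmetric] *(1) Re_complex_of_real ..
  qed (use *(2,3) in blast)+
qed

section \<open>Norms of matrices of functions\<close>

lemma mbounded_add:
  assumes "mbounded I J M C" "mbounded I J N D"
  shows "mbounded I J (\<lambda>i j. M i j + N i j) (C + D)"
  unfolding mbounded_def
proof (intro allI)
  fix u w
  have "(\<Sum>i\<in>I. \<Sum>j\<in>J. u i * (M i j + N i j) * w j)
      = (bform I J M u w) + (bform I J N u w)"
    by (simp add: algebra_simps sum.distrib)
  also have "cmod \<dots> \<le> C * l2 I u * l2 J w + D * l2 I u * l2 J w"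
    by (intro norm_triangle_mono mboundedD assms)
  finally show "cmod (\<Sum>i\<in>I. \<Sum>j\<in>J. u i * (M i j + N i j) * w j) \<le> (C + D) * l2 I u * l2 J w"
    by (simp add: algebra_simps)
qed

lemma mbounded_scale:
  assumes "mbounded I J M C"
  shows "mbounded I J (\<lambda>i j. c * M i j) (cmod c * C)"
  unfolding mbounded_def
proof (intro allI)
  fix u w
  have "(\<Sum>i\<in>I. \<Sum>j\<in>J. u i * (c * M i j) * w j) = c * (bform I J M u w)"
    by (simp add: sum_distrib_left mult_ac)
  then show "cmod (\<Sum>i\<in>I. \<Sum>j\<in>J. u i * (c * M i j) * w j) \<le> cmod c * C * l2 I u * l2 J w"
    using mult_left_mono[OF mboundedD[OF assms, of u w], of "cmod c"] by (simp add: norm_mult mult_ac)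
qed

lemma l2_slice_le: 
  assumes "finite I" "finite K" "s \<in> K"
  shows "l2 I (\<lambda>a. u (a, s)) \<le> l2 (I \<times> K) u"
proof -
  have "(\<Sum>a\<in>I. (cmod (u (a, s)))\<^sup>2) \<le> (\<Sum>a\<in>I. \<Sum>k\<in>K. (cmod (u (a, k)))\<^sup>2)"
    using assms by (intro sum_mono member_le_sum) auto
  also have "\<dots> = (\<Sum>p\<in>I \<times> K. (cmod (u p))\<^sup>2)"
    by (simp add: sum.cartesian_product split_beta)
  finally show ?thesis by (simp add: L2_set_def)
qed

lemma sum_swap_blocks:
  "(\<Sum>(a, s)\<in>I \<times> K. \<Sum>(b, t)\<in>J \<times> L. f a s b t) = (\<Sum>s\<in>K. \<Sum>t\<in>L. \<Sum>a\<in>I. \<Sum>b\<in>J. f a s b (t::'l) :: 'c::comm_monoid_add)"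
proof -
  have "(\<Sum>(a, s)\<in>I \<times> K. \<Sum>(b, t)\<in>J \<times> L. f a s b t) = (\<Sum>a\<in>I. \<Sum>s\<in>K. \<Sum>b\<in>J. \<Sum>t\<in>L. f a s b t)"
    by (simp add: sum.cartesian_product')
  also have "\<dots> = (\<Sum>s\<in>K. \<Sum>a\<in>I. \<Sum>t\<in>L. \<Sum>b\<in>J. f a s b t)"
    by (subst sum.swap[of _ K I]) (intro sum.cong refl sum.swap)
  also have "\<dots> = (\<Sum>s\<in>K. \<Sum>t\<in>L. \<Sum>a\<in>I. \<Sum>b\<in>J. f a s b t)"
    by (intro sum.cong refl sum.swap)
  finally show ?thesis .
qed

text \<open>Used with the inner positions \<open>s\<close> and \<open>t\<close> as block labels. It
  shows that the suprema defining \<open>NH\<close> and \<open>ND\<close> are finite and yields the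
  estimate of \<open>ND\<close> by its entries.\<close>

lemma mbounded_blocks:
  assumes fin: "finite I" "finite J" "finite K" "finite L"
    and M: "\<And>s t. s \<in> K \<Longrightarrow> t \<in> L \<Longrightarrow> mbounded I J (\<lambda>a b. M a s b t) (C s t)"
    and C: "\<And>s t. s \<in> K \<Longrightarrow> t \<in> L \<Longrightarrow> 0 \<le> C s t"
  shows "mbounded (I \<times> K) (J \<times> L) (\<lambda>(a, s) (b, t). M a s b t) (\<Sum>s\<in>K. \<Sum>t\<in>L. C s t)"
  unfolding mbounded_def
proof (intro allI)
  fix u w
  have *: "cmod (\<Sum>a\<in>I. \<Sum>b\<in>J. u (a, s) * M a s b t * w (b, t)) \<le> C s t * l2 (I \<times> K) u * l2 (J \<times> L) w"
    if st: "s \<in> K" "t \<in> L" for s t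
  proof -
    have "cmod (\<Sum>a\<in>I. \<Sum>b\<in>J. u (a, s) * M a s b t * w (b, t))
        \<le> C s t * l2 I (\<lambda>a. u (a, s)) * l2 J (\<lambda>b. w (b, t))"
      by (rule mboundedD[OF M[OF st]])
    also have "\<dots> \<le> C s t * l2 (I \<times> K) u * l2 (J \<times> L) w"
      using fin st C[OF st] by (intro mult_mono l2_slice_le) (auto simp: L2_set_nonneg)
    finally show ?thesis .
  qed
  have "(\<Sum>p\<in>I \<times> K. \<Sum>q\<in>J \<times> L. u p * (case p of (a, s) \<Rightarrow> \<lambda>(b, t). M a s b t) q * w q)
      = (\<Sum>s\<in>K. \<Sum>t\<in>L. \<Sum>a\<in>I. \<Sum>b\<in>J. u (a, s) * M a s b t * w (b, t))"
    unfolding sum_swap_blocks[symmetric] by (simp add: split_beta)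
  also have "cmod \<dots> \<le> (\<Sum>s\<in>K. \<Sum>t\<in>L. C s t * l2 (I \<times> K) u * l2 (J \<times> L) w)"
    by (intro sum_norm_le *)
  finally show "cmod (\<Sum>p\<in>I \<times> K. \<Sum>q\<in>J \<times> L. u p * (case p of (a, s) \<Rightarrow> \<lambda>(b, t). M a s b t) q * w q)
      \<le> (\<Sum>s\<in>K. \<Sum>t\<in>L. C s t) * l2 (I \<times> K) u * l2 (J \<times> L) w"
    by (simp add: sum_distrib_right)
qed

text \<open>A common treatment of the two norms given by suprema of amplifications. The predicate
  \<open>P\<close> selects the test matrices: points of the open balls for \<open>NH\<close>,
  matrices of functions of norm at most 1 for \<open>ND\<close>. The bound \<open>C0\<close>
  guarantees that the supremum is a genuine one.\<close>

lemma Sup_amplify: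
  assumes n: "0 < n" and car: "\<And>m X. P m X \<Longrightarrow> X \<in> carrier_mat m m" and ne: "\<exists>m X. P m X"
    and bd: "0 \<le> C0" "\<And>m X. P m X \<Longrightarrow>
      mbounded (grid m n) (grid m n) (block_entries (\<lambda>x s t. T x $$ (s, t)) X) C0"
  shows "0 \<le> C \<Longrightarrow> Sup {opnorm (amplify n T X) | m X. P m X} \<le> C \<longleftrightarrow>
      (\<forall>m X. P m X \<longrightarrow>
        mbounded (grid m n) (grid m n) (block_entries (\<lambda>x s t. T x $$ (s, t)) X) C)"
    and "0 \<le> Sup {opnorm (amplify n T X) | m X. P m X}"
proof -
  let ?S = "{opnorm (amplify n T X) | m X. P m X}"
  have bdd: "bdd_above ?S"
    by (rule bdd_aboveI[of _ C0]) (auto simp: opnorm_amplify_le_iff[OF n car bd(1)] bd(2))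
  have ne': "?S \<noteq> {}" using ne by blast
  show "0 \<le> C \<Longrightarrow> Sup ?S \<le> C \<longleftrightarrow> (\<forall>m X. P m X \<longrightarrow>
        mbounded (grid m n) (grid m n) (block_entries (\<lambda>x s t. T x $$ (s, t)) X) C)"
    unfolding cSup_le_iff[OF ne' bdd] by (auto simp: opnorm_amplify_le_iff[OF n car, symmetric])
  obtain m X where "P m X" using ne by blast
  then show "0 \<le> Sup ?S" using cSup_upper[OF _ bdd, of "opnorm (amplify n T X)"] opnorm_nonneg[of "amplify n T X"]
    by force
qed

lemma matsD: "X \<in> mats n E \<Longrightarrow> X \<in> carrier_mat n n"
  "X \<in> mats n E \<Longrightarrow> i < n \<Longrightarrow> j < n \<Longrightarrow> X $$ (i, j) \<in> E"
  by (auto simp: mats_def intro!: elements_matI)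

lemma matsI: "X \<in> carrier_mat n n \<Longrightarrow> (\<And>i j. i < n \<Longrightarrow> j < n \<Longrightarrow> X $$ (i, j) \<in> E) \<Longrightarrow> X \<in> mats n E"
  by (auto simp: mats_def)

lemma sum_fun_apply: "(\<Sum>i\<in>I. f i) x = (\<Sum>i\<in>I. f i x :: 'b::comm_monoid_add)"
  by (induction I rule: infinite_finite_induct) auto

lemma bij_betw_Pair0: "bij_betw (\<lambda>a. (a, 0::nat)) A (A \<times> {..<1})"
  by (rule bij_betw_byWitness[where f' = fst]) auto

lemma l2_tensor: "l2 (I \<times> K) (\<lambda>(a, s). u a * w s) = l2 I u * l2 K w"
proof -
  have "(\<Sum>p\<in>I \<times> K. (cmod (case p of (a, s) \<Rightarrow> u a * w s))\<^sup>2) = (\<Sum>a\<in>I. (cmod (u a))\<^sup>2) * (\<Sum>s\<in>K. (cmod (w s))\<^sup>2)"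
    by (simp add: sum_product sum.cartesian_product split_beta norm_mult power_mult_distrib)
  then show ?thesis by (simp add: L2_set_def real_sqrt_mult)
qed

section \<open>The function space and its matrix norms\<close>

context operator_space
begin

abbreviation "ball_V \<equiv> open_mball mnorm"
abbreviation "H \<equiv> Hinf_cb scaleC mnorm"
abbreviation "NH \<equiv> Hinf_cb_mnorm mnorm"
abbreviation "HD \<equiv> Hinf_cb_dual scaleC mnorm"
abbreviation "G \<equiv> Ginf_cb scaleC mnorm"
abbreviation "ND \<equiv> Ginf_cb_mnorm scaleC mnorm"
abbreviation "dl \<equiv> \<delta> scaleC mnorm"
abbreviation "span_dl \<equiv> fun_space.span {dl x | x. norm x < 1}"

lemma ball_V_carrier: "X \<in> ball_V m \<Longrightarrow> X \<in> carrier_mat m m"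
  by (simp add: open_mball_def)

lemma mnorm_Suc_0: "mnorm (mat (Suc 0) (Suc 0) (\<lambda>_. v)) = norm v"
  using mnorm_1 by simp

lemma mnorm_0: "0 < m \<Longrightarrow> mnorm (0\<^sub>m m m) = 0"
  by (subst mnorm_eq_0) auto

lemma zero_in_ball_V: "0 < m \<Longrightarrow> 0\<^sub>m m m \<in> ball_V m"
  by (simp add: open_mball_def mnorm_0)

text \<open>Positivity comes from the triangle inequality for \<open>X\<close> and its
  negative.\<close>

lemma mnorm_nonneg:
  assumes "0 < n" "X \<in> carrier_mat n n"
  shows "0 \<le> mnorm X"
proof -
  have c: "map_mat (scaleC (- 1)) X \<in> carrier_mat n n" using assms by simp
  have "X + map_mat (scaleC (- 1)) X = 0\<^sub>m n n"
    using assms by (intro eq_matI) (auto simp: scale_minus_left)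
  then have "0 \<le> mnorm X + mnorm (map_mat (scaleC (- 1)) X)"
    using mnorm_triangle[OF assms c] assms by (simp add: mnorm_0)
  then show ?thesis using mnorm_scale[OF assms, of "- 1"] by simp
qed

text \<open>An entry is the compression of \<open>X\<close> by a coordinate row and a coordinate
  column, both of operator norm at most 1.\<close>

lemma norm_entry_le_mnorm:
  assumes X: "X \<in> carrier_mat m m" and ij: "i < m" "j < m"
  shows "norm (X $$ (i, j)) \<le> mnorm X"
proof -
  define \<alpha> where "\<alpha> = mat 1 m (\<lambda>(_, k). if k = i then 1 else 0 :: complex)"
  define \<beta> where "\<beta> = mat m 1 (\<lambda>(k, _). if k = j then 1 else 0 :: complex)"
  have a: "opnorm \<alpha> \<le> 1"
  proof (subst opnorm_le_iff)
    show "mbounded {..<1} {..<m} (\<lambda>i j. \<alpha> $$ (i, j)) 1"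
    proof (rule mbounded_of_apply)
      fix w :: "nat \<Rightarrow> complex"
      have "l2 {..<1} (\<lambda>k. \<Sum>j<m. \<alpha> $$ (k, j) * w j) = cmod (w i)"
        using ij by (simp add: \<alpha>_def L2_set_def if_distrib[of "\<lambda>x. x * _"] cong: if_cong)
      then show "l2 {..<1} (\<lambda>k. \<Sum>j<m. \<alpha> $$ (k, j) * w j) \<le> 1 * l2 {..<m} w"
        using ij member_le_L2_set[of "{..<m}" i "\<lambda>i. cmod (w i)"] by simp
    qed
  qed (auto simp: \<alpha>_def)
  have b: "opnorm \<beta> \<le> 1"
  proof (subst opnorm_le_iff)
    show "mbounded {..<m} {..<1} (\<lambda>i j. \<beta> $$ (i, j)) 1"
    proof (subst mbounded_transpose, rule mbounded_of_apply)
      fix w :: "nat \<Rightarrow> complex"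
      have "l2 {..<1} (\<lambda>k. \<Sum>i<m. \<beta> $$ (i, k) * w i) = cmod (w j)"
        using ij by (simp add: \<beta>_def L2_set_def if_distrib[of "\<lambda>x. x * _"] cong: if_cong)
      then show "l2 {..<1} (\<lambda>k. \<Sum>i<m. \<beta> $$ (i, k) * w i) \<le> 1 * l2 {..<m} w"
        using ij member_le_L2_set[of "{..<m}" j "\<lambda>i. cmod (w i)"] by simp
    qed
  qed (auto simp: \<beta>_def)
  have "bimult scaleC \<alpha> X \<beta> = mat 1 1 (\<lambda>_. X $$ (i, j))"
  proof (rule eq_matI)
    fix p q assume "p < dim_row (mat 1 1 (\<lambda>_. X $$ (i, j)))" "q < dim_col (mat 1 1 (\<lambda>_. X $$ (i, j)))"
    then have pq: "p = 0" "q = 0" by auto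
    have "(\<Sum>k<m. \<Sum>l<m. scaleC (\<alpha> $$ (0, k) * \<beta> $$ (l, 0)) (X $$ (k, l)))
        = (\<Sum>k<m. \<Sum>l<m. if k = i \<and> l = j then X $$ (i, j) else 0)"
      by (intro sum.cong refl) (auto simp: \<alpha>_def \<beta>_def)
    also have "\<dots> = (\<Sum>k<m. if k = i then X $$ (i, j) else 0)"
      using ij by (intro sum.cong refl) auto
    also have "\<dots> = X $$ (i, j)" using ij by simp
    finally show "bimult scaleC \<alpha> X \<beta> $$ (p, q) = mat 1 1 (\<lambda>_. X $$ (i, j)) $$ (p, q)"
      using X by (simp add: bimult_def pq \<alpha>_def \<beta>_def)
  qed (auto simp: bimult_def \<alpha>_def \<beta>_def)
  then have "norm (X $$ (i, j)) \<le> opnorm \<alpha> * mnorm X * opnorm \<beta>"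
    using mnorm_bimult[of 1 m X \<alpha> \<beta>] ij X by (auto simp: mnorm_Suc_0 \<alpha>_def \<beta>_def)
  also have "\<dots> \<le> 1 * mnorm X * 1"
    using a b mnorm_nonneg[OF _ X] ij by (intro mult_mono) (auto simp: opnorm_nonneg)
  finally show ?thesis by simp
qed

lemma norm_entry_ball: "X \<in> ball_V m \<Longrightarrow> i < m \<Longrightarrow> j < m \<Longrightarrow> norm (X $$ (i, j)) < 1"
  using norm_entry_le_mnorm[of X m i j] by (auto simp: open_mball_def)

definition cb_bounded :: "('v \<Rightarrow> complex) \<Rightarrow> real \<Rightarrow> bool" where
  "cb_bounded f C \<longleftrightarrow> (\<forall>m>0. \<forall>X\<in>ball_V m. mbounded {..<m} {..<m} (\<lambda>a b. f (X $$ (a, b))) C)"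

lemma H_iff: "f \<in> H \<longleftrightarrow> holomorphic_on_ball scaleC f \<and> (\<exists>C\<ge>0. cb_bounded f C) \<and> (\<forall>x. \<not> norm x < 1 \<longrightarrow> f x = 0)"
proof -
  have *: "opnorm (map_mat f X) \<le> C \<longleftrightarrow> mbounded {..<m} {..<m} (\<lambda>a b. f (X $$ (a, b))) C"
    if "X \<in> ball_V m" "0 \<le> C" for X m C
    using opnorm_le_iff[of "map_mat f X" m m C] ball_V_carrier[OF that(1)] that
    by (auto intro!: mbounded_cong)
  have "bdd_above {opnorm (map_mat f X) | m X. 0 < m \<and> X \<in> ball_V m} \<longleftrightarrow> (\<exists>C\<ge>0. cb_bounded f C)"
  proof
    assume "bdd_above {opnorm (map_mat f X) | m X. 0 < m \<and> X \<in> ball_V m}"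
    then obtain C where C: "\<And>m X. 0 < m \<Longrightarrow> X \<in> ball_V m \<Longrightarrow> opnorm (map_mat f X) \<le> C"
      unfolding bdd_above_def by blast
    have "cb_bounded f (max C 0)" unfolding cb_bounded_def
      using C by (auto simp: *[symmetric] le_max_iff_disj)
    then show "\<exists>C\<ge>0. cb_bounded f C" by (intro exI[of _ "max C 0"]) auto
  next
    assume "\<exists>C\<ge>0. cb_bounded f C"
    then obtain C where "C \<ge> 0" "cb_bounded f C" by blast
    then show "bdd_above {opnorm (map_mat f X) | m X. 0 < m \<and> X \<in> ball_V m}"
      by (intro bdd_aboveI[of _ C]) (auto simp: cb_bounded_def *)
  qed
  then show ?thesis by (simp add: Hinf_cb_def)
qed

lemma cb_bounded_norm_le:
  assumes "cb_bounded f C" "norm x < 1"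
  shows "cmod (f x) \<le> C"
proof -
  have "mat 1 1 (\<lambda>_. x) \<in> ball_V 1" using assms by (simp add: open_mball_def mnorm_Suc_0)
  then have "mbounded {..<1} {..<1} (\<lambda>a b. f (mat 1 1 (\<lambda>_. x) $$ (a, b))) C"
    using assms by (auto simp: cb_bounded_def)
  from mboundedD[OF this, of "\<lambda>_. 1" "\<lambda>_. 1"] show ?thesis by (simp add: L2_set_def)
qed

text \<open>Constants are not completely bounded: the all-ones matrix of size \<open>m\<close> has norm \<open>m\<close>.\<close>

lemma H_zero:
  assumes "f \<in> H"
  shows "f 0 = 0"
proof (rule ccontr)
  assume nz: "f 0 \<noteq> 0"
  obtain C where C: "cb_bounded f C" using assms by (auto simp: H_iff)
  obtain m :: nat where m: "C / cmod (f 0) < real m" using reals_Archimedean2 by blast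
  let ?m = "Suc m"
  have "mbounded {..<?m} {..<?m} (\<lambda>a b. f (0\<^sub>m ?m ?m $$ (a, b))) C"
    using C zero_in_ball_V[of ?m] by (auto simp: cb_bounded_def)
  from mboundedD[OF this, of "\<lambda>_. 1" "\<lambda>_. 1"]
  have "cmod (\<Sum>i<?m. \<Sum>j<?m. f 0) \<le> C * real ?m"
    by (simp add: L2_set_def mult.assoc del: of_nat_Suc)
  then have "real ?m * cmod (f 0) \<le> C"
    by (simp add: norm_mult del: of_nat_Suc)
  then show False using m nz by (simp add: field_simps) (smt (verit) norm_ge_zero)
qed

lemma H_support: "f \<in> H \<Longrightarrow> \<not> norm x < 1 \<Longrightarrow> f x = 0"
  by (auto simp: H_iff)

lemma zero_in_H: "0 \<in> H"
  unfolding H_iff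
proof (intro conjI)
  show "holomorphic_on_ball scaleC 0" unfolding holomorphic_on_ball_def
    by (intro allI impI exI[of _ "\<lambda>_. 0"]) (auto simp: zero_fun_def)
  show "\<exists>C\<ge>0. cb_bounded 0 C" by (intro exI[of _ 0]) (auto simp: cb_bounded_def mbounded_def)
qed auto

lemma add_in_H:
  assumes "f \<in> H" "g \<in> H"
  shows "f + g \<in> H"
  unfolding H_iff
proof (intro conjI)
  show "holomorphic_on_ball scaleC (f + g)" unfolding holomorphic_on_ball_def
  proof (intro allI impI)
    fix x :: 'v assume "norm x < 1"
    then obtain D D' where "(f has_derivative D) (at x)" "\<And>c h. D (scaleC c h) = c * D h"
      "(g has_derivative D') (at x)" "\<And>c h. D' (scaleC c h) = c * D' h"
      using assms unfolding H_iff holomorphic_on_ball_def by blast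
    then show "\<exists>D. (f + g has_derivative D) (at x) \<and> (\<forall>c h. D (scaleC c h) = c * D h)"
      by (intro exI[of _ "\<lambda>h. D h + D' h"]) (auto simp: plus_fun_def algebra_simps intro!: derivative_eq_intros)
  qed
  obtain C D where "0 \<le> C" "cb_bounded f C" "0 \<le> D" "cb_bounded g D" using assms by (auto simp: H_iff)
  then show "\<exists>C\<ge>0. cb_bounded (f + g) C"
    by (intro exI[of _ "C + D"]) (auto simp: cb_bounded_def intro!: mbounded_add)
qed (use assms in \<open>auto simp: H_iff\<close>)

lemma cb_bounded_scale: "cb_bounded f C \<Longrightarrow> cb_bounded (fun_scale c f) (cmod c * C)"
  by (auto simp: cb_bounded_def fun_scale_def intro!: mbounded_scale)

lemma scale_in_H:
  assumes "f \<in> H"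
  shows "fun_scale c f \<in> H"
  unfolding H_iff
proof (intro conjI)
  show "holomorphic_on_ball scaleC (fun_scale c f)" unfolding holomorphic_on_ball_def
  proof (intro allI impI)
    fix x :: 'v assume "norm x < 1"
    then obtain D where "(f has_derivative D) (at x)" "\<And>c h. D (scaleC c h) = c * D h"
      using assms unfolding H_iff holomorphic_on_ball_def by blast
    then show "\<exists>D. (fun_scale c f has_derivative D) (at x) \<and> (\<forall>c h. D (scaleC c h) = c * D h)"
      by (intro exI[of _ "\<lambda>h. c * D h"]) (auto simp: fun_scale_def algebra_simps intro!: derivative_eq_intros)
  qed
  obtain C where "0 \<le> C" "cb_bounded f C" using assms by (auto simp: H_iff)
  then show "\<exists>C\<ge>0. cb_bounded (fun_scale c f) C"
    by (intro exI[of _ "cmod c * C"]) (auto intro!: cb_bounded_scale)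
qed (use assms in \<open>auto simp: H_iff fun_scale_def\<close>)

lemma H_subspace: "fun_space.subspace H"
  by (simp add: fun_space.subspace_def zero_in_H add_in_H scale_in_H)

lemma NH_facts:
  assumes n: "0 < n" and F: "F \<in> mats n H"
  shows "0 \<le> C \<Longrightarrow> NH F \<le> C \<longleftrightarrow> (\<forall>m>0. \<forall>X\<in>ball_V m.
      block_bounded m n F X C)"
    and "0 \<le> NH F"
proof -
  have car: "X \<in> carrier_mat m m" if "0 < m \<and> X \<in> ball_V m" for m X using that ball_V_carrier by blast
  have dF: "dim_row F = n" "dim_col F = n" using matsD(1)[OF F] by auto
  have cong: "mbounded (grid m n) (grid m n) (block_entries (\<lambda>x s t. map_mat (\<lambda>f. f x) F $$ (s, t)) X) C
      \<longleftrightarrow> block_bounded m n F X C" for m X C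
    by (rule mbounded_cong) (auto simp: block_entries_def dF)
  have "\<exists>C\<ge>0. cb_bounded (F $$ (s, t)) C" if "s < n" "t < n" for s t
    using matsD(2)[OF F that] by (auto simp: H_iff)
  then obtain B where B: "\<And>s t. s < n \<Longrightarrow> t < n \<Longrightarrow> 0 \<le> B s t \<and> cb_bounded (F $$ (s, t)) (B s t)" by metis
  define C0 where "C0 = (\<Sum>s<n. \<Sum>t<n. B s t)"
  have C0: "0 \<le> C0" using B by (auto simp: C0_def intro!: sum_nonneg)
  have "block_bounded m n F X C0"
    if "0 < m \<and> X \<in> ball_V m" for m X
    unfolding C0_def block_entries_def using that B
    by (intro mbounded_blocks) (auto simp: cb_bounded_def)
  then have bd: "mbounded (grid m n) (grid m n) (block_entries (\<lambda>x s t. map_mat (\<lambda>f. f x) F $$ (s, t)) X) C0"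
    if "0 < m \<and> X \<in> ball_V m" for m X using that cong by blast
  have ne: "\<exists>m X. 0 < m \<and> X \<in> ball_V m" using zero_in_ball_V[of 1] by auto
  note * = Sup_amplify[where P = "\<lambda>m X. 0 < m \<and> X \<in> ball_V m", OF n car ne C0 bd]
  show "0 \<le> C \<Longrightarrow> NH F \<le> C \<longleftrightarrow> (\<forall>m>0. \<forall>X\<in>ball_V m.
      block_bounded m n F X C)"
    unfolding Hinf_cb_mnorm_def dF using *(1)[of C] unfolding cong by blast
  show "0 \<le> NH F" unfolding Hinf_cb_mnorm_def dF using *(2) .
qed

lemmas NH_le_iff = NH_facts(1) and NH_nonneg = NH_facts(2)

lemma NH_mbounded:
  assumes "0 < n" "F \<in> mats n H" "0 < m" "X \<in> ball_V m"
  shows "block_bounded m n F X (NH F)"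
  using NH_le_iff[OF assms(1,2) NH_nonneg[OF assms(1,2)]] assms(3,4) by blast

definition hn :: "('v \<Rightarrow> complex) \<Rightarrow> real" where "hn f = NH (mat 1 1 (\<lambda>_. f))"

lemma mat11_mats: "f \<in> E \<Longrightarrow> mat 1 1 (\<lambda>_. f) \<in> mats 1 E"
  by (rule matsI) auto

lemma hn_nonneg: "f \<in> H \<Longrightarrow> 0 \<le> hn f"
  unfolding hn_def by (intro NH_nonneg[of 1] mat11_mats) auto

lemma hn_le_iff:
  assumes "f \<in> H" "0 \<le> C"
  shows "hn f \<le> C \<longleftrightarrow> cb_bounded f C"
proof -
  have "mbounded (grid m 1) (grid m 1) (block_entries (\<lambda>x s t. (mat 1 1 (\<lambda>_. f) $$ (s, t)) x) X) C
     \<longleftrightarrow> mbounded {..<m} {..<m} (\<lambda>a b. f (X $$ (a, b))) C" for m X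
  proof -
    have "mbounded (grid m 1) (grid m 1) (block_entries (\<lambda>x s t. (mat 1 1 (\<lambda>_. f) $$ (s, t)) x) X) C
     \<longleftrightarrow> mbounded {..<m} {..<m} (\<lambda>a b. block_entries (\<lambda>x s t. (mat 1 1 (\<lambda>_. f) $$ (s, t)) x) X (a, 0) (b, 0)) C"
      by (rule mbounded_reindex[OF bij_betw_Pair0 bij_betw_Pair0])
    also have "\<dots> \<longleftrightarrow> mbounded {..<m} {..<m} (\<lambda>a b. f (X $$ (a, b))) C"
      by (rule mbounded_cong) (auto simp: block_entries_def)
    finally show ?thesis .
  qed
  then show ?thesis
    unfolding hn_def cb_bounded_def
    using NH_le_iff[OF _ mat11_mats[OF assms(1)] assms(2)] by simp
qed

lemma cb_bounded_hn: "f \<in> H \<Longrightarrow> cb_bounded f (hn f)"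
  by (subst hn_le_iff[symmetric]) (auto simp: hn_nonneg)

lemma norm_le_hn: "f \<in> H \<Longrightarrow> cmod (f x) \<le> hn f"
  by (cases "norm x < 1") (auto simp: cb_bounded_norm_le[OF cb_bounded_hn] H_support hn_nonneg)

lemma hn_scale_le: "f \<in> H \<Longrightarrow> hn (fun_scale c f) \<le> cmod c * hn f"
  by (subst hn_le_iff) (auto simp: scale_in_H hn_nonneg intro!: cb_bounded_scale cb_bounded_hn)

lemma sum_in_H: "(\<And>i. i \<in> I \<Longrightarrow> f i \<in> H) \<Longrightarrow> (\<Sum>i\<in>I. f i) \<in> H"
  by (rule fun_space.subspace_sum[OF H_subspace])

text \<open>The form of \<open>g\<close> at vectors \<open>u\<close> and \<open>w\<close> is the
  form of \<open>F\<close> at the tensors of these with \<open>\<eta>\<close> and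
  \<open>\<xi>\<close>, and norms of tensors multiply. Via this compression a bounded functional on
  \<open>H\<close> is completely bounded with the same constant.\<close>

lemma hn_compress:
  fixes \<eta> \<xi> :: "nat \<Rightarrow> complex"
  assumes n: "0 < n" and F: "F \<in> mats n H"
  defines "g \<equiv> \<Sum>s<n. \<Sum>t<n. fun_scale (\<eta> s * \<xi> t) (F $$ (s, t))"
  shows "g \<in> H" "hn g \<le> NH F * l2 {..<n} \<eta> * l2 {..<n} \<xi>"
proof -
  show gH: "g \<in> H" unfolding g_def using matsD(2)[OF F] by (intro sum_in_H scale_in_H) auto
  show "hn g \<le> NH F * l2 {..<n} \<eta> * l2 {..<n} \<xi>"
  proof (subst hn_le_iff[OF gH])
    show "cb_bounded g (NH F * l2 {..<n} \<eta> * l2 {..<n} \<xi>)"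
      unfolding cb_bounded_def mbounded_def
    proof (intro allI impI ballI)
      fix m :: nat and X u w assume m: "0 < m" and X: "X \<in> ball_V m"
      have "(\<Sum>a<m. \<Sum>b<m. u a * g (X $$ (a, b)) * w b)
          = (\<Sum>a<m. \<Sum>b<m. \<Sum>s<n. \<Sum>t<n. (u a * \<eta> s) * (F $$ (s, t)) (X $$ (a, b)) * (w b * \<xi> t))"
        by (simp add: g_def sum_fun_apply fun_scale_def sum_distrib_left sum_distrib_right mult_ac)
      also have "\<dots> = (\<Sum>a<m. \<Sum>s<n. \<Sum>b<m. \<Sum>t<n. (u a * \<eta> s) * (F $$ (s, t)) (X $$ (a, b)) * (w b * \<xi> t))"
        by (intro sum.cong refl sum.swap)
      also have "\<dots> = (\<Sum>p\<in>grid m n. \<Sum>q\<in>grid m n. (case p of (a, s) \<Rightarrow> u a * \<eta> s)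
          * block_entries (\<lambda>x s t. (F $$ (s, t)) x) X p q * (case q of (b, t) \<Rightarrow> w b * \<xi> t))"
        by (simp add: sum.cartesian_product' block_entries_def)
      also have "cmod \<dots> \<le> NH F * (l2 {..<m} u * l2 {..<n} \<eta>) * (l2 {..<m} w * l2 {..<n} \<xi>)"
        using mboundedD[OF NH_mbounded[OF n F m X]] unfolding l2_tensor[symmetric] .
      finally show "cmod (\<Sum>a<m. \<Sum>b<m. u a * g (X $$ (a, b)) * w b)
          \<le> NH F * l2 {..<n} \<eta> * l2 {..<n} \<xi> * l2 {..<m} u * l2 {..<m} w"
        by (simp add: mult_ac)
    qed
  qed (simp add: NH_nonneg[OF n F] L2_set_nonneg)
qed

end

section \<open>The dual norm and the closed matrix unit ball\<close>

lemma sum_lessThan_add: "(\<Sum>s<n + m::nat. f s) = (\<Sum>s<n. f s) + (\<Sum>s<m. f (n + s) :: 'b::comm_monoid_add)"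
  by (induction m) (auto simp: add.assoc)

lemma two_term_Cauchy_Schwarz:
  "(a::real) * c + b * d \<le> sqrt (a\<^sup>2 + b\<^sup>2) * sqrt (c\<^sup>2 + d\<^sup>2)"
proof -
  have "(a * c + b * d)\<^sup>2 \<le> (a\<^sup>2 + b\<^sup>2) * (c\<^sup>2 + d\<^sup>2)"
    using zero_le_power2[of "a * d - b * c"] by (simp add: power2_eq_square algebra_simps)
  then show ?thesis by (metis real_le_rsqrt real_sqrt_mult)
qed

text \<open>The two diagonal blocks act on orthogonal parts of the vectors. Cauchy--Schwarz for the
  two pairs of partial norms keeps the constant at \<open>C\<close>.\<close>

lemma mbounded_direct_sum:
  fixes n m :: nat
  assumes M: "mbounded (I \<times> {..<n}) (J \<times> {..<n}) M C" and N: "mbounded (I \<times> {..<m}) (J \<times> {..<m}) N C"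
    and C: "0 \<le> C"
  shows "mbounded (I \<times> {..<n + m}) (J \<times> {..<n + m}) (\<lambda>(a, s) (b, t).
      if s < n \<and> t < n then M (a, s) (b, t)
      else if n \<le> s \<and> n \<le> t then N (a, s - n) (b, t - n) else 0) C"
    (is "mbounded _ _ ?D C")
  unfolding mbounded_def
proof (intro allI)
  fix u :: "'a \<times> nat \<Rightarrow> complex" and w :: "'b \<times> nat \<Rightarrow> complex"
  define u' where "u' = (\<lambda>(a, s). u (a, n + s))"
  define w' where "w' = (\<lambda>(a, s). w (a, n + s))"
  have split: "(\<Sum>p\<in>I \<times> {..<n + m}. f p) = (\<Sum>p\<in>I \<times> {..<n}. f p) + (\<Sum>p\<in>I \<times> {..<m}. f (fst p, n + snd p))"
    for f :: "'i \<times> nat \<Rightarrow> complex" and I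
    by (simp add: sum.cartesian_product' sum_lessThan_add sum.distrib)
  have split_real: "(\<Sum>p\<in>I \<times> {..<n + m}. f p) = (\<Sum>p\<in>I \<times> {..<n}. f p) + (\<Sum>p\<in>I \<times> {..<m}. f (fst p, n + snd p))"
    for f :: "'i \<times> nat \<Rightarrow> real" and I
    by (simp add: sum.cartesian_product' sum_lessThan_add sum.distrib)
  have eq: "(bform (I \<times> {..<n + m}) (J \<times> {..<n + m}) ?D u w)
      = (bform (I \<times> {..<n}) (J \<times> {..<n}) M u w)
        + (bform (I \<times> {..<m}) (J \<times> {..<m}) N u' w')"
  proof -
    have "(\<Sum>q\<in>J \<times> {..<n + m}. u p * ?D p q * w q) = (\<Sum>q\<in>J \<times> {..<n}. u p * M p q * w q)"
      if "p \<in> I \<times> {..<n}" for p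
    proof -
      have "(\<Sum>q\<in>J \<times> {..<n}. u p * ?D p q * w q) = (\<Sum>q\<in>J \<times> {..<n}. u p * M p q * w q)"
        using that by (intro sum.cong refl) auto
      moreover have "(\<Sum>q\<in>J \<times> {..<m}. u p * ?D p (fst q, n + snd q) * w (fst q, n + snd q)) = 0"
        using that by (intro sum.neutral) auto
      ultimately show ?thesis unfolding split by simp
    qed
    moreover have "(\<Sum>q\<in>J \<times> {..<n + m}. u (fst p, n + snd p) * ?D (fst p, n + snd p) q * w q)
        = (\<Sum>q\<in>J \<times> {..<m}. u' p * N p q * w' q)" for p
    proof -
      have "(\<Sum>q\<in>J \<times> {..<n}. u (fst p, n + snd p) * ?D (fst p, n + snd p) q * w q) = 0"
        by (intro sum.neutral) auto
      moreover have "(\<Sum>q\<in>J \<times> {..<m}. u (fst p, n + snd p) * ?D (fst p, n + snd p) (fst q, n + snd q) * w (fst q, n + snd q))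
          = (\<Sum>q\<in>J \<times> {..<m}. u' p * N p q * w' q)"
        by (intro sum.cong refl) (auto simp: u'_def w'_def split_beta)
      ultimately show ?thesis unfolding split by simp
    qed
    ultimately show ?thesis unfolding split[of _ I] by simp
  qed
  have l2: "l2 (I \<times> {..<n + m}) v = sqrt ((l2 (I \<times> {..<n}) v)\<^sup>2 + (l2 (I \<times> {..<m}) (\<lambda>(a, s). v (a, n + s)))\<^sup>2)"
    for I and v :: "'i \<times> nat \<Rightarrow> complex"
    unfolding l2_sq unfolding L2_set_def split_real by (simp add: split_beta)
  have "cmod (bform (I \<times> {..<n + m}) (J \<times> {..<n + m}) ?D u w)
      \<le> C * l2 (I \<times> {..<n}) u * l2 (J \<times> {..<n}) w + C * l2 (I \<times> {..<m}) u' * l2 (J \<times> {..<m}) w'"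
    unfolding eq by (intro norm_triangle_mono mboundedD M N)
  also have "\<dots> = C * (l2 (I \<times> {..<n}) u * l2 (J \<times> {..<n}) w + l2 (I \<times> {..<m}) u' * l2 (J \<times> {..<m}) w')"
    by (simp add: algebra_simps)
  also have "\<dots> \<le> C * (l2 (I \<times> {..<n + m}) u * l2 (J \<times> {..<n + m}) w)"
    unfolding l2[of u I] l2[of w J] u'_def w'_def by (intro mult_left_mono two_term_Cauchy_Schwarz C)
  finally show "cmod (bform (I \<times> {..<n + m}) (J \<times> {..<n + m}) ?D u w)
      \<le> C * l2 (I \<times> {..<n + m}) u * l2 (J \<times> {..<n + m}) w" by (simp only: mult.assoc)
qed

text \<open>The matrix acts on the second coordinate alone, so its bound applies to every slice with
  the first coordinate fixed.\<close>

lemma l2_amplify_le: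
  assumes A: "mbounded K K' A c" and c: "0 \<le> c"
  shows "l2 (I \<times> K) (\<lambda>(a, k). \<Sum>s\<in>K'. A k s * u (a, s)) \<le> c * l2 (I \<times> K') u"
proof (rule l2_le_mono)
  have "(\<Sum>k\<in>K. (cmod (\<Sum>s\<in>K'. A k s * u (a, s)))\<^sup>2) \<le> c\<^sup>2 * (\<Sum>s\<in>K'. (cmod (u (a, s)))\<^sup>2)" for a
    using power_mono[OF mbounded_apply[OF A c, of "\<lambda>s. u (a, s)"] l2_nonneg, of 2]
    by (simp add: l2_sq power_mult_distrib)
  then have "(\<Sum>a\<in>I. \<Sum>k\<in>K. (cmod (\<Sum>s\<in>K'. A k s * u (a, s)))\<^sup>2) \<le> (\<Sum>a\<in>I. c\<^sup>2 * (\<Sum>s\<in>K'. (cmod (u (a, s)))\<^sup>2))"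
    by (rule sum_mono)
  then show "(\<Sum>p\<in>I \<times> K. (cmod (case p of (a, k) \<Rightarrow> \<Sum>s\<in>K'. A k s * u (a, s)))\<^sup>2) \<le> (c * l2 (I \<times> K') u)\<^sup>2"
    unfolding power_mult_distrib l2_sq by (simp add: sum.cartesian_product' sum_distrib_left)
qed (simp add: c L2_set_nonneg)

text \<open>The compressed form is the original form at \<open>u'\<close> and \<open>w'\<close>, the
  vectors transformed in their second coordinate; the chain of sum exchanges only assembles these
  two vectors.\<close>

lemma mbounded_bimult:
  fixes I :: "'a set" and J :: "'b set" and K :: "'k set" and L :: "'l set" and K' :: "'s set" and L' :: "'t set"
  assumes M: "mbounded (I \<times> K) (J \<times> L) M C" and C: "0 \<le> C"
    and A: "mbounded K' K A 1" and B: "mbounded L L' B 1"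
  shows "mbounded (I \<times> K') (J \<times> L')
      (\<lambda>(a, s) (b, t). \<Sum>k\<in>K. \<Sum>l\<in>L. A s k * B l t * M (a, k) (b, l)) C"
  unfolding mbounded_def
proof (intro allI)
  fix u :: "'a \<times> 's \<Rightarrow> complex" and w :: "'b \<times> 't \<Rightarrow> complex"
  define u' where "u' = (\<lambda>(a, k). \<Sum>s\<in>K'. A s k * u (a, s))"
  define w' where "w' = (\<lambda>(b, l). \<Sum>t\<in>L'. B l t * w (b, t))"
  have "(\<Sum>p\<in>I \<times> K'. \<Sum>q\<in>J \<times> L'. u p * (case p of (a, s) \<Rightarrow> \<lambda>(b, t). \<Sum>k\<in>K. \<Sum>l\<in>L. A s k * B l t * M (a, k) (b, l)) q * w q)
    = (\<Sum>a\<in>I. \<Sum>s\<in>K'. \<Sum>b\<in>J. \<Sum>t\<in>L'. \<Sum>k\<in>K. \<Sum>l\<in>L. (A s k * u (a, s)) * M (a, k) (b, l) * (B l t * w (b, t)))"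
    by (simp add: sum.cartesian_product' sum_distrib_left sum_distrib_right mult_ac)
  also have "\<dots> = (\<Sum>a\<in>I. \<Sum>s\<in>K'. \<Sum>b\<in>J. \<Sum>k\<in>K. \<Sum>t\<in>L'. \<Sum>l\<in>L. (A s k * u (a, s)) * M (a, k) (b, l) * (B l t * w (b, t)))"
    by (intro sum.cong refl sum.swap)
  also have "\<dots> = (\<Sum>a\<in>I. \<Sum>s\<in>K'. \<Sum>k\<in>K. \<Sum>b\<in>J. \<Sum>t\<in>L'. \<Sum>l\<in>L. (A s k * u (a, s)) * M (a, k) (b, l) * (B l t * w (b, t)))"
    by (intro sum.cong refl sum.swap)
  also have "\<dots> = (\<Sum>a\<in>I. \<Sum>k\<in>K. \<Sum>s\<in>K'. \<Sum>b\<in>J. \<Sum>l\<in>L. \<Sum>t\<in>L'. (A s k * u (a, s)) * M (a, k) (b, l) * (B l t * w (b, t)))"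
    by (subst sum.swap[of _ K']) (intro sum.cong refl sum.swap)
  also have "\<dots> = (\<Sum>a\<in>I. \<Sum>k\<in>K. \<Sum>b\<in>J. \<Sum>s\<in>K'. \<Sum>l\<in>L. \<Sum>t\<in>L'. (A s k * u (a, s)) * M (a, k) (b, l) * (B l t * w (b, t)))"
    by (intro sum.cong refl sum.swap)
  also have "\<dots> = (\<Sum>a\<in>I. \<Sum>k\<in>K. \<Sum>b\<in>J. \<Sum>l\<in>L. \<Sum>s\<in>K'. \<Sum>t\<in>L'. (A s k * u (a, s)) * M (a, k) (b, l) * (B l t * w (b, t)))"
    by (intro sum.cong refl sum.swap)
  also have "\<dots> = (bform (I \<times> K) (J \<times> L) M u' w')"
    by (simp add: sum.cartesian_product' u'_def w'_def sum_distrib_left sum_distrib_right)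
      (intro sum.cong refl sum.swap)
  also have "cmod \<dots> \<le> C * l2 (I \<times> K) u' * l2 (J \<times> L) w'"
    by (rule mboundedD[OF M])
  also have "\<dots> \<le> C * l2 (I \<times> K') u * l2 (J \<times> L') w"
  proof -
    have "mbounded K K' (\<lambda>k s. A s k) 1" using A mbounded_transpose by metis
    from l2_amplify_le[OF this, of u I] have "l2 (I \<times> K) u' \<le> l2 (I \<times> K') u" by (simp add: u'_def)
    moreover from l2_amplify_le[OF B, of w J] have "l2 (J \<times> L) w' \<le> l2 (J \<times> L') w" by (simp add: w'_def)
    ultimately show ?thesis by (intro mult_mono C) (auto simp: C L2_set_nonneg)
  qed
  finally show "cmod (\<Sum>p\<in>I \<times> K'. \<Sum>q\<in>J \<times> L'. u p * (case p of (a, s) \<Rightarrow> \<lambda>(b, t). \<Sum>k\<in>K. \<Sum>l\<in>L. A s k * B l t * M (a, k) (b, l)) q * w q)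
      \<le> C * l2 (I \<times> K') u * l2 (J \<times> L') w" .
qed

lemma abs_matrix_convex_hull_subset:
  "abs_matrix_convex scl E L \<Longrightarrow> (\<And>k. 0 < k \<Longrightarrow> K k \<subseteq> L k) \<Longrightarrow> abs_matrix_convex_hull scl E K n \<subseteq> L n"
  unfolding abs_matrix_convex_hull_def by blast

section \<open>Bounded functionals, the dual matrix norms and the predual\<close>

context operator_space
begin

definition fbounded :: "(('v \<Rightarrow> complex) \<Rightarrow> complex) \<Rightarrow> real \<Rightarrow> bool" where
  "fbounded \<phi> C \<longleftrightarrow> (\<forall>f\<in>H. cmod (\<phi> f) \<le> C * hn f)"

lemma HD_iff: "\<phi> \<in> HD \<longleftrightarrow> (\<forall>f\<in>H. \<forall>g\<in>H. \<phi> (f + g) = \<phi> f + \<phi> g) \<and>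
    (\<forall>c. \<forall>f\<in>H. \<phi> (fun_scale c f) = c * \<phi> f) \<and> (\<exists>C\<ge>0. fbounded \<phi> C) \<and> (\<forall>f. f \<notin> H \<longrightarrow> \<phi> f = 0)"
proof -
  have "fbounded \<phi> (max C 0)" if "fbounded \<phi> C" for C
    unfolding fbounded_def
  proof
    fix f assume f: "f \<in> H"
    then have "cmod (\<phi> f) \<le> C * hn f" using that by (simp add: fbounded_def)
    also have "\<dots> \<le> max C 0 * hn f" by (intro mult_right_mono hn_nonneg f) auto
    finally show "cmod (\<phi> f) \<le> max C 0 * hn f" .
  qed
  then have "(\<exists>C. fbounded \<phi> C) \<longleftrightarrow> (\<exists>C\<ge>0. fbounded \<phi> C)"
    by (meson max.cobounded2)
  then show ?thesis unfolding dual_def mem_Collect_eq hn_def[symmetric] fbounded_def[symmetric] by simp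
qed

lemma HD_D:
  assumes "\<phi> \<in> HD"
  shows "f \<in> H \<Longrightarrow> g \<in> H \<Longrightarrow> \<phi> (f + g) = \<phi> f + \<phi> g" "f \<in> H \<Longrightarrow> \<phi> (fun_scale c f) = c * \<phi> f"
    "\<exists>C\<ge>0. fbounded \<phi> C" "f \<notin> H \<Longrightarrow> \<phi> f = 0"
  using assms by (auto simp: HD_iff)

lemma HD_0: "\<phi> \<in> HD \<Longrightarrow> \<phi> 0 = 0"
  using HD_D(2)[of \<phi> 0 0] zero_in_H by (simp add: fun_scale_def zero_fun_def)

lemma HD_sum:
  assumes "\<phi> \<in> HD" "\<And>i. i \<in> I \<Longrightarrow> f i \<in> H"
  shows "\<phi> (\<Sum>i\<in>I. f i) = (\<Sum>i\<in>I. \<phi> (f i))"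
  using assms(2)
  by (induction I rule: infinite_finite_induct) (auto simp: HD_0 assms(1) HD_D(1)[OF assms(1)] sum_in_H)

lemma fbounded_add: "fbounded \<phi> C \<Longrightarrow> fbounded \<psi> D \<Longrightarrow> fbounded (\<phi> + \<psi>) (C + D)"
  unfolding fbounded_def
  by (auto simp: distrib_right intro!: norm_triangle_mono)

lemma fbounded_scale: "fbounded \<phi> C \<Longrightarrow> fbounded (fun_scale c \<phi>) (cmod c * C)"
  unfolding fbounded_def by (auto simp: fun_scale_def norm_mult mult.assoc intro!: mult_left_mono)

lemma fbounded_mono: "fbounded \<phi> C \<Longrightarrow> C \<le> D \<Longrightarrow> fbounded \<phi> D"
  unfolding fbounded_def by (meson hn_nonneg mult_right_mono order_trans)

lemma HD_subspace: "fun_space.subspace HD"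
  unfolding fun_space.subspace_def
proof (intro conjI ballI allI)
  show "0 \<in> HD" by (auto simp: HD_iff fbounded_def)
next
  fix \<phi> \<psi> assume "\<phi> \<in> HD" "\<psi> \<in> HD"
  moreover from this obtain C D where "0 \<le> C" "fbounded \<phi> C" "0 \<le> D" "fbounded \<psi> D" using HD_D(3) by metis
  then have "\<exists>C\<ge>0. fbounded (\<phi> + \<psi>) C" by (intro exI[of _ "C + D"]) (auto intro: fbounded_add)
  ultimately show "\<phi> + \<psi> \<in> HD" by (simp add: HD_iff algebra_simps)
next
  fix c \<phi> assume "\<phi> \<in> HD"
  moreover from this obtain C where "0 \<le> C" "fbounded \<phi> C" using HD_D(3) by metis
  then have "\<exists>C\<ge>0. fbounded (fun_scale c \<phi>) C" by (intro exI[of _ "cmod c * C"]) (auto intro: fbounded_scale)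
  ultimately show "fun_scale c \<phi> \<in> HD" by (simp add: HD_iff fun_scale_def algebra_simps)
qed

lemmas HD_zero = fun_space.subspace_0[OF HD_subspace]
  and HD_add = fun_space.subspace_add[OF HD_subspace]
  and HD_diff = fun_space.subspace_diff[OF HD_subspace]
  and HD_scale = fun_space.subspace_scale[OF HD_subspace]
  and HD_sums = fun_space.subspace_sum[OF HD_subspace]

lemma delta_apply: "f \<in> H \<Longrightarrow> dl x f = f x"
  by (simp add: \<delta>_def)

lemma fbounded_delta: "fbounded (dl x) 1"
  by (simp add: fbounded_def delta_apply norm_le_hn)

lemma delta_in_HD: "dl x \<in> HD"
  unfolding HD_iff
  by (auto simp: \<delta>_def fun_scale_def add_in_H scale_in_H[unfolded fun_scale_def] intro!: exI[of _ 1] fbounded_delta[unfolded \<delta>_def])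

lemma delta_0: "dl 0 = 0"
  by (auto simp: \<delta>_def fun_eq_iff H_zero)

text \<open>The bilinear form in question is the value of \<open>\<phi>\<close> at the scalar
  compression of \<open>F\<close> by \<open>u\<close> and \<open>w\<close>, so a bound of
  \<open>\<phi>\<close> on single functions suffices.\<close>

lemma mbounded_functional:
  assumes "\<phi> \<in> HD" "fbounded \<phi> C" "0 \<le> C" and m: "0 < m" and F: "F \<in> mats m H" "NH F \<le> 1"
  shows "mbounded {..<m} {..<m} (\<lambda>a b. \<phi> (F $$ (a, b))) C"
  unfolding mbounded_def
proof (intro allI)
  fix u w :: "nat \<Rightarrow> complex"
  let ?g = "\<Sum>s<m. \<Sum>t<m. fun_scale (u s * w t) (F $$ (s, t))"
  note g = hn_compress[OF m F(1), of u w]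
  have e: "F $$ (s, t) \<in> H" if "s < m" "t < m" for s t using matsD(2)[OF F(1)] that .
  have "\<phi> ?g = (\<Sum>s<m. \<phi> (\<Sum>t<m. fun_scale (u s * w t) (F $$ (s, t))))"
    by (rule HD_sum[OF assms(1)]) (auto intro!: sum_in_H scale_in_H e)
  also have "\<dots> = (\<Sum>s<m. \<Sum>t<m. \<phi> (fun_scale (u s * w t) (F $$ (s, t))))"
    by (intro sum.cong refl HD_sum[OF assms(1)]) (auto intro!: scale_in_H e)
  also have "\<dots> = (\<Sum>s<m. \<Sum>t<m. u s * \<phi> (F $$ (s, t)) * w t)"
    by (intro sum.cong refl) (auto simp: HD_D(2)[OF assms(1)] e)
  finally have "cmod (\<Sum>s<m. \<Sum>t<m. u s * \<phi> (F $$ (s, t)) * w t) \<le> C * hn ?g"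
    using assms(2) g(1) by (auto simp: fbounded_def)
  also have "\<dots> \<le> C * (1 * l2 {..<m} u * l2 {..<m} w)"
    using F(2) assms(3) by (intro mult_left_mono order_trans[OF g(2)] mult_right_mono) (auto simp: L2_set_nonneg)
  finally show "cmod (\<Sum>i<m. \<Sum>j<m. u i * \<phi> (F $$ (i, j)) * w j) \<le> C * l2 {..<m} u * l2 {..<m} w" by simp
qed

lemma mbounded_functional_blocks:
  assumes \<Phi>: "\<Phi> \<in> mats n HD" and B: "\<And>s t. s < n \<Longrightarrow> t < n \<Longrightarrow> 0 \<le> B s t \<and> fbounded (\<Phi> $$ (s, t)) (B s t)"
    and F: "0 < m" "F \<in> mats m H" "NH F \<le> 1"
  shows "block_bounded m n \<Phi> F (\<Sum>s<n. \<Sum>t<n. B s t)"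
  unfolding block_entries_def using B F matsD(2)[OF \<Phi>]
  by (intro mbounded_blocks mbounded_functional) auto

lemma ND_facts:
  assumes n: "0 < n" and \<Phi>: "\<Phi> \<in> mats n HD"
  shows "0 \<le> C \<Longrightarrow> ND \<Phi> \<le> C \<longleftrightarrow> (\<forall>m>0. \<forall>F\<in>mats m H. NH F \<le> 1 \<longrightarrow>
      block_bounded m n \<Phi> F C)"
    and "0 \<le> ND \<Phi>"
proof -
  let ?P = "\<lambda>m F. 0 < m \<and> F \<in> mats m H \<and> NH F \<le> 1"
  have car: "F \<in> carrier_mat m m" if "?P m F" for m F using that matsD(1) by blast
  have d\<Phi>: "dim_row \<Phi> = n" "dim_col \<Phi> = n" using matsD(1)[OF \<Phi>] by auto
  have cong: "mbounded (grid m n) (grid m n) (block_entries (\<lambda>f s t. map_mat (\<lambda>\<phi>. \<phi> f) \<Phi> $$ (s, t)) F) C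
      \<longleftrightarrow> block_bounded m n \<Phi> F C" for m F C
    by (rule mbounded_cong) (auto simp: block_entries_def d\<Phi>)
  have "\<exists>C\<ge>0. fbounded (\<Phi> $$ (s, t)) C" if "s < n" "t < n" for s t
    using HD_D(3)[OF matsD(2)[OF \<Phi> that]] .
  then obtain B where B: "\<And>s t. s < n \<Longrightarrow> t < n \<Longrightarrow> 0 \<le> B s t \<and> fbounded (\<Phi> $$ (s, t)) (B s t)" by metis
  define C0 where "C0 = (\<Sum>s<n. \<Sum>t<n. B s t)"
  have C0: "0 \<le> C0" using B by (auto simp: C0_def intro!: sum_nonneg)
  have bd: "mbounded (grid m n) (grid m n) (block_entries (\<lambda>f s t. map_mat (\<lambda>\<phi>. \<phi> f) \<Phi> $$ (s, t)) F) C0"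
    if "?P m F" for m F unfolding cong C0_def using mbounded_functional_blocks[OF \<Phi> B] that by blast
  have z: "0\<^sub>m 1 1 \<in> mats 1 H" by (rule matsI) (auto simp: zero_in_H)
  have "NH (0\<^sub>m 1 1) \<le> 1"
    by (subst NH_le_iff[OF _ z]) (auto simp: mbounded_def block_entries_def sum.cartesian_product' L2_set_nonneg)
  then have ne: "\<exists>m F. ?P m F" using z by (intro exI[of _ 1] exI[of _ "0\<^sub>m 1 1"]) auto
  note * = Sup_amplify[where P = ?P, OF n car ne C0 bd]
  show "0 \<le> C \<Longrightarrow> ND \<Phi> \<le> C \<longleftrightarrow> (\<forall>m>0. \<forall>F\<in>mats m H. NH F \<le> 1 \<longrightarrow>
      block_bounded m n \<Phi> F C)"
    unfolding Ginf_cb_mnorm_def dual_mnorm_def cb_norm_def d\<Phi> using *(1)[of C] unfolding cong by blast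
  show "0 \<le> ND \<Phi>" unfolding Ginf_cb_mnorm_def dual_mnorm_def cb_norm_def d\<Phi> using *(2) .
qed

lemmas ND_le_iff = ND_facts(1) and ND_nonneg = ND_facts(2)

lemma ND_mbounded:
  assumes "0 < n" "\<Phi> \<in> mats n HD" "ND \<Phi> \<le> C" "0 < m" "F \<in> mats m H" "NH F \<le> 1"
  shows "block_bounded m n \<Phi> F C"
  using ND_le_iff[OF assms(1,2), of C] ND_nonneg[OF assms(1,2)] assms(3-6) by auto

lemma ND_leI:
  assumes "0 < n" "\<Phi> \<in> mats n HD" "0 \<le> C" "\<And>m F. 0 < m \<Longrightarrow> F \<in> mats m H \<Longrightarrow> NH F \<le> 1 \<Longrightarrow>
    block_bounded m n \<Phi> F C"
  shows "ND \<Phi> \<le> C"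
  using ND_le_iff[OF assms(1-3)] assms(4) by blast

lemma ND_le_of_entries:
  assumes "0 < n" "\<Phi> \<in> mats n HD" "0 \<le> C" "\<And>s t. s < n \<Longrightarrow> t < n \<Longrightarrow> fbounded (\<Phi> $$ (s, t)) C"
  shows "ND \<Phi> \<le> real n * real n * C"
proof (rule ND_leI[OF assms(1,2)])
  fix m F assume "0 < m" "F \<in> mats m H" "NH F \<le> 1"
  then have "block_bounded m n \<Phi> F (\<Sum>s<n. \<Sum>t<n. C)"
    using assms by (intro mbounded_functional_blocks) auto
  then show "block_bounded m n \<Phi> F (real n * real n * C)"
    by (simp add: mult.assoc)
qed (use assms in auto)

lemma fbounded_of_ND:
  assumes \<phi>: "\<phi> \<in> HD" and C: "ND (mat 1 1 (\<lambda>_. \<phi>)) \<le> C"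
  shows "fbounded \<phi> C"
  unfolding fbounded_def
proof
  fix f assume f: "f \<in> H"
  show "cmod (\<phi> f) \<le> C * hn f"
  proof (cases "hn f = 0")
    \<comment> \<open>A function of norm zero cannot be normalised, but \<open>norm_le_hn\<close>
      shows that it vanishes.\<close>
    case True
    then have "f = 0" using norm_le_hn[OF f] by (auto simp: fun_eq_iff)
    then show ?thesis using True \<phi> by (simp add: HD_0)
  next
    case False
    then have pos: "0 < hn f" using hn_nonneg[OF f] by simp
    let ?c = "complex_of_real (1 / hn f)"
    have "hn (fun_scale ?c f) \<le> cmod ?c * hn f" by (rule hn_scale_le[OF f])
    then have "NH (mat 1 1 (\<lambda>_. fun_scale ?c f)) \<le> 1" using pos by (simp add: hn_def[symmetric, unfolded One_nat_def] norm_divide)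
    from ND_mbounded[OF _ mat11_mats[OF \<phi>] C _ mat11_mats[OF scale_in_H[OF f]] this]
    have "mbounded (grid 1 1) (grid 1 1)
        (block_entries (\<lambda>f s t. (mat 1 1 (\<lambda>_. \<phi>) $$ (s, t)) f) (mat 1 1 (\<lambda>_. fun_scale ?c f))) C" by simp
    from mboundedD[OF this, of "\<lambda>_. 1" "\<lambda>_. 1"]
    have "cmod (\<phi> (fun_scale ?c f)) \<le> C"
      by (simp add: L2_set_def sum.cartesian_product' block_entries_def lessThan_Suc)
    then show ?thesis using pos by (simp add: HD_D(2)[OF \<phi> f] norm_mult norm_divide divide_le_eq)
  qed
qed

text \<open>Trades the norm of one-by-one matrices for \<open>fbounded\<close>, so that
  approximation by the span is a statement about single functionals.\<close>

lemma G_iff: "\<phi> \<in> G \<longleftrightarrow> \<phi> \<in> HD \<and> (\<forall>e>0. \<exists>\<psi>\<in>span_dl. fbounded (\<phi> - \<psi>) e)"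
proof -
  have span: "\<psi> \<in> HD" if "\<psi> \<in> span_dl" for \<psi>
    using fun_space.span_minimal[OF _ HD_subspace, of "{dl x | x. norm x < 1}"] that delta_in_HD by blast
  have diff: "\<phi> - \<psi> \<in> HD" if "\<phi> \<in> HD" "\<psi> \<in> HD" for \<phi> \<psi>
    using HD_subspace that by (rule fun_space.subspace_diff)
  show ?thesis
  proof
    assume a: "\<phi> \<in> G"
    show "\<phi> \<in> HD \<and> (\<forall>e>0. \<exists>\<psi>\<in>span_dl. fbounded (\<phi> - \<psi>) e)"
    proof (intro conjI allI impI)
      show "\<phi> \<in> HD" using a by (simp add: Ginf_cb_def)
      fix e :: real assume "0 < e"
      then obtain \<psi> where \<psi>: "\<psi> \<in> span_dl" "ND (mat 1 1 (\<lambda>_. \<phi> - \<psi>)) < e"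
        using a unfolding Ginf_cb_def by blast
      then have "fbounded (\<phi> - \<psi>) e" using \<open>\<phi> \<in> HD\<close> span by (intro fbounded_of_ND diff) auto
      with \<psi>(1) show "\<exists>\<psi>\<in>span_dl. fbounded (\<phi> - \<psi>) e" by blast
    qed
  next
    assume a: "\<phi> \<in> HD \<and> (\<forall>e>0. \<exists>\<psi>\<in>span_dl. fbounded (\<phi> - \<psi>) e)"
    have "\<exists>\<psi>\<in>span_dl. ND (mat 1 1 (\<lambda>_. \<phi> - \<psi>)) < e" if "0 < e" for e
    proof -
      \<comment> \<open>Half of \<open>e\<close>, because \<open>Ginf_cb\<close> is defined by a
        strict inequality.\<close>
      obtain \<psi> where \<psi>: "\<psi> \<in> span_dl" "fbounded (\<phi> - \<psi>) (e / 2)"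
        using a \<open>0 < e\<close> by (meson half_gt_zero)
      have "ND (mat 1 1 (\<lambda>_. \<phi> - \<psi>)) \<le> real 1 * real 1 * (e / 2)"
        using a \<psi> span that by (intro ND_le_of_entries mat11_mats diff) auto
      then show ?thesis using \<psi>(1) that by (intro bexI[of _ \<psi>]) auto
    qed
    with a show "\<phi> \<in> G" by (auto simp: Ginf_cb_def)
  qed
qed

lemma G_approx:
  assumes "\<phi> \<in> G" "0 < e"
  obtains \<psi> where "\<psi> \<in> span_dl" "fbounded (\<phi> - \<psi>) e"
  using assms unfolding G_iff by blast

lemma G_subset_HD: "G \<subseteq> HD"
  by (auto simp: G_iff)

lemma span_delta_subset_G: "span_dl \<subseteq> G"
proof
  fix \<psi> assume a: "\<psi> \<in> span_dl"
  have "\<psi> \<in> HD"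
    using fun_space.span_minimal[OF _ HD_subspace, of "{dl x | x. norm x < 1}"] a delta_in_HD by blast
  moreover have "fbounded (\<psi> - \<psi>) e" if "0 < e" for e
    using that by (auto simp: fbounded_def hn_nonneg)
  ultimately show "\<psi> \<in> G" using a unfolding G_iff by blast
qed

lemma delta_in_G: "norm x < 1 \<Longrightarrow> dl x \<in> G"
  using span_delta_subset_G by (auto intro: fun_space.span_base)

lemma G_subspace: "fun_space.subspace G"
  unfolding fun_space.subspace_def
proof (intro conjI ballI allI)
  show "0 \<in> G" using span_delta_subset_G fun_space.span_zero by blast
next
  fix \<phi> \<psi> assume a: "\<phi> \<in> G" "\<psi> \<in> G"
  have "\<exists>\<theta>\<in>span_dl. fbounded (\<phi> + \<psi> - \<theta>) e" if "0 < e" for e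
  proof -
    have e: "0 < e / 2" using that by simp
    obtain \<phi>' where 1: "\<phi>' \<in> span_dl" "fbounded (\<phi> - \<phi>') (e / 2)"
      using G_approx[OF a(1) e] .
    obtain \<psi>' where 2: "\<psi>' \<in> span_dl" "fbounded (\<psi> - \<psi>') (e / 2)"
      using G_approx[OF a(2) e] .
    have "\<phi> + \<psi> - (\<phi>' + \<psi>') = (\<phi> - \<phi>') + (\<psi> - \<psi>')"
      by (simp add: fun_eq_iff)
    moreover have "fbounded ((\<phi> - \<phi>') + (\<psi> - \<psi>')) e" using fbounded_add[OF 1(2) 2(2)] by simp
    ultimately have "fbounded (\<phi> + \<psi> - (\<phi>' + \<psi>')) e" by (simp only:)
    then show ?thesis using fun_space.span_add[OF 1(1) 2(1)] by blast
  qed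
  then show "\<phi> + \<psi> \<in> G" using a HD_add by (auto simp: G_iff)
next
  fix c \<phi> assume a: "\<phi> \<in> G"
  have "\<exists>\<theta>\<in>span_dl. fbounded (fun_scale c \<phi> - \<theta>) e" if "0 < e" for e
  proof -
    \<comment> \<open>The summand 1 keeps the denominator positive when
      \<open>c = 0\<close>.\<close>
    have "0 < e / (cmod c + 1)" using that by (simp add: add_nonneg_pos)
    then obtain \<phi>' where *: "\<phi>' \<in> span_dl" "fbounded (\<phi> - \<phi>') (e / (cmod c + 1))"
      using G_approx[OF a] by blast
    have "fun_scale c \<phi> - fun_scale c \<phi>' = fun_scale c (\<phi> - \<phi>')"
      by (simp add: fun_space.scale_right_diff_distrib)
    moreover have "cmod c * (e / (cmod c + 1)) \<le> e" using that
      by (subst times_divide_eq_right, subst pos_divide_le_eq) (auto simp: algebra_simps intro: add_pos_nonneg)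
    ultimately show ?thesis using fbounded_mono[OF fbounded_scale[OF *(2), of c]] fun_space.span_scale[OF *(1)]
      by (intro bexI[of _ "fun_scale c \<phi>'"]) auto
  qed
  then show "fun_scale c \<phi> \<in> G" using a HD_scale by (auto simp: G_iff)
qed

lemma mats_G_HD: "X \<in> mats n G \<Longrightarrow> X \<in> mats n HD"
  using G_subset_HD by (auto simp: mats_def)

section \<open>Absolute matrix convexity and closedness of the closed matrix unit ball\<close>

lemma direct_sum_entry:
  assumes "X \<in> carrier_mat n n" "Y \<in> carrier_mat m m" "i < n + m" "j < n + m"
  shows "direct_sum X Y $$ (i, j) = (if i < n \<and> j < n then X $$ (i, j)
     else if n \<le> i \<and> n \<le> j then Y $$ (i - n, j - n) else 0)"
  using assms by (auto simp: direct_sum_def)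

lemma bimult_entry:
  assumes "X \<in> carrier_mat n n" "\<alpha> \<in> carrier_mat m n" "\<beta> \<in> carrier_mat n m" "i < m" "j < m"
  shows "bimult scl \<alpha> X \<beta> $$ (i, j) = (\<Sum>k<n. \<Sum>l<n. scl (\<alpha> $$ (i, k) * \<beta> $$ (l, j)) (X $$ (k, l)))"
  using assms by (auto simp: bimult_def)

lemma closed_mball_abs_matrix_convex: "abs_matrix_convex fun_scale G (closed_mball G ND)"
  unfolding abs_matrix_convex_def
proof (intro conjI allI impI ballI)
  fix n :: nat assume n: "0 < n"
  show "closed_mball G ND n \<subseteq> mats n G" by (auto simp: closed_mball_def)
  have z: "0\<^sub>m n n \<in> mats n G" by (rule matsI) (auto simp: fun_space.subspace_0[OF G_subspace])
  have "ND (0\<^sub>m n n) \<le> 1"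
    by (rule ND_leI[OF n mats_G_HD[OF z]]) (auto simp: mbounded_def block_entries_def split_beta sum.cartesian_product' L2_set_nonneg)
  with z show "closed_mball G ND n \<noteq> {}" by (auto simp: closed_mball_def)
next
  fix m n X Y assume mn: "0 < m" "0 < (n::nat)" and X: "X \<in> closed_mball G ND n" and Y: "Y \<in> closed_mball G ND m"
  have X': "X \<in> mats n G" "ND X \<le> 1" and Y': "Y \<in> mats m G" "ND Y \<le> 1" using X Y by (auto simp: closed_mball_def)
  note ent = direct_sum_entry[OF matsD(1)[OF X'(1)] matsD(1)[OF Y'(1)]]
  have D: "direct_sum X Y \<in> mats (n + m) G"
  proof (rule matsI)
    show "direct_sum X Y \<in> carrier_mat (n + m) (n + m)"
      using matsD(1)[OF X'(1)] matsD(1)[OF Y'(1)] by (auto simp: direct_sum_def)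
  qed (use matsD(2)[OF X'(1)] matsD(2)[OF Y'(1)] fun_space.subspace_0[OF G_subspace] in \<open>auto simp: ent\<close>)
  have "ND (direct_sum X Y) \<le> 1"
  proof (rule ND_leI[OF _ mats_G_HD[OF D]])
    fix k F assume F: "0 < k" "F \<in> mats k H" "NH F \<le> 1"
    have "mbounded (grid k (n + m)) (grid k (n + m)) (\<lambda>(a, s) (b, t).
      if s < n \<and> t < n then block_entries (\<lambda>f s t. (X $$ (s, t)) f) F (a, s) (b, t)
      else if n \<le> s \<and> n \<le> t then block_entries (\<lambda>f s t. (Y $$ (s, t)) f) F (a, s - n) (b, t - n) else 0) 1"
      by (rule mbounded_direct_sum[OF ND_mbounded[OF mn(2) mats_G_HD[OF X'(1)] X'(2) F] ND_mbounded[OF mn(1) mats_G_HD[OF Y'(1)] Y'(2) F]]) simp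
    also have "?this \<longleftrightarrow> mbounded (grid k (n + m)) (grid k (n + m))
        (block_entries (\<lambda>f s t. (direct_sum X Y $$ (s, t)) f) F) 1"
      by (rule mbounded_cong) (auto simp: block_entries_def ent)
    finally show "mbounded (grid k (n + m)) (grid k (n + m))
        (block_entries (\<lambda>f s t. (direct_sum X Y $$ (s, t)) f) F) 1" .
  qed (use mn in auto)
  with D show "direct_sum X Y \<in> closed_mball G ND (m + n)" by (auto simp: closed_mball_def add.commute)
next
  fix m n X \<alpha> \<beta> assume mn: "0 < m" "0 < (n::nat)" and X: "X \<in> closed_mball G ND n"
    and \<alpha>: "\<alpha> \<in> carrier_mat m n" and \<beta>: "\<beta> \<in> carrier_mat n m" and op: "opnorm \<alpha> \<le> 1 \<and> opnorm \<beta> \<le> 1"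
  have X': "X \<in> mats n G" "ND X \<le> 1" using X by (auto simp: closed_mball_def)
  note ent = bimult_entry[OF matsD(1)[OF X'(1)] \<alpha> \<beta>]
  have D: "bimult fun_scale \<alpha> X \<beta> \<in> mats m G"
  proof (rule matsI)
    show "bimult fun_scale \<alpha> X \<beta> \<in> carrier_mat m m" using \<alpha> \<beta> by (auto simp: bimult_def)
  qed (auto simp: ent intro!: fun_space.subspace_sum[OF G_subspace] fun_space.subspace_scale[OF G_subspace] matsD(2)[OF X'(1)])
  have "ND (bimult fun_scale \<alpha> X \<beta>) \<le> 1"
  proof (rule ND_leI[OF mn(1) mats_G_HD[OF D]])
    fix k F assume F: "0 < k" "F \<in> mats k H" "NH F \<le> 1"
    have "mbounded (grid k m) (grid k m) (\<lambda>(a, s) (b, t). \<Sum>p<n. \<Sum>q<n. \<alpha> $$ (s, p) * \<beta> $$ (q, t) *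
        block_entries (\<lambda>f s t. (X $$ (s, t)) f) F (a, p) (b, q)) 1"
      using op opnorm_le_iff[OF \<alpha>, of 1] opnorm_le_iff[OF \<beta>, of 1]
      by (intro mbounded_bimult[OF ND_mbounded[OF mn(2) mats_G_HD[OF X'(1)] X'(2) F]]) auto
    also have "?this \<longleftrightarrow> block_bounded k m (bimult fun_scale \<alpha> X \<beta>) F 1"
      by (rule mbounded_cong) (auto simp: block_entries_def ent sum_fun_apply fun_scale_def)
    finally show "block_bounded k m (bimult fun_scale \<alpha> X \<beta>) F 1" .
  qed auto
  with D show "bimult fun_scale \<alpha> X \<beta> \<in> closed_mball G ND m" by (auto simp: closed_mball_def)
qed

lemma mats_HD_diff: "X \<in> mats n HD \<Longrightarrow> Y \<in> mats n HD \<Longrightarrow> X - Y \<in> mats n HD"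
proof (rule matsI)
  assume X: "X \<in> mats n HD" and Y: "Y \<in> mats n HD"
  show "X - Y \<in> carrier_mat n n" using matsD(1)[OF Y] by (rule minus_carrier_mat)
  fix i j assume "i < n" "j < n"
  then show "(X - Y) $$ (i, j) \<in> HD"
    using matsD[OF X] matsD[OF Y] by (simp add: HD_diff)
qed

lemma matrix_closure_closed_mball:
  assumes n: "0 < n" and K: "K n \<subseteq> closed_mball G ND n"
  shows "matrix_closure G ND K n \<subseteq> closed_mball G ND n"
proof
  fix X assume a: "X \<in> matrix_closure G ND K n"
  then have X: "X \<in> mats n G" by (simp add: matrix_closure_def)
  have "ND X \<le> 1"
  proof (rule field_le_epsilon)
    fix e :: real assume e: "0 < e"
    then obtain Y where "Y \<in> K n" and N: "ND (X - Y) < e" using a by (auto simp: matrix_closure_def)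
    then have Y: "Y \<in> mats n G" "ND Y \<le> 1" using K by (auto simp: closed_mball_def)
    show "ND X \<le> 1 + e"
    proof (rule ND_leI[OF n mats_G_HD[OF X]])
      fix m F assume F: "0 < m" "F \<in> mats m H" "NH F \<le> 1"
      let ?I = "grid m n"
      have "mbounded ?I ?I (\<lambda>p q. block_entries (\<lambda>f s t. (Y $$ (s, t)) f) F p q + block_entries (\<lambda>f s t. ((X - Y) $$ (s, t)) f) F p q) (1 + e)"
        using N by (intro mbounded_add ND_mbounded[OF n _ _ F] mats_G_HD[OF Y(1)] mats_HD_diff mats_G_HD[OF X] Y(2)) auto
      also have "?this \<longleftrightarrow> mbounded ?I ?I (block_entries (\<lambda>f s t. (X $$ (s, t)) f) F) (1 + e)"
        using matsD(1)[OF X] matsD(1)[OF Y(1)] by (intro mbounded_cong) (auto simp: block_entries_def)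
      finally show "mbounded ?I ?I (block_entries (\<lambda>f s t. (X $$ (s, t)) f) F) (1 + e)" .
    qed (use e in auto)
  qed
  with X show "X \<in> closed_mball G ND n" by (simp add: closed_mball_def)
qed

end

section \<open>The Schwarz lemma\<close>

context operator_space
begin

lemma norm_scaleC: "norm (scaleC c v) = cmod c * norm v"
proof -
  have "map_mat (scaleC c) (mat 1 1 (\<lambda>_. v)) = mat 1 1 (\<lambda>_. scaleC c v)" by (intro eq_matI) auto
  then show ?thesis using mnorm_scale[of 1 "mat 1 1 (\<lambda>_. v)" c] by (simp add: mnorm_Suc_0)
qed

lemma bounded_linear_scaleC_left: "bounded_linear (\<lambda>z. scaleC z h)"
proof (rule bounded_linear_intro[where K = "norm h"])
  fix r :: real and z
  show "scaleC (r *\<^sub>R z) h = r *\<^sub>R scaleC z h"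
    by (simp add: scaleR_conv_of_real scaleC_of_real[symmetric])
qed (auto simp: scale_left_distrib norm_scaleC)


lemma scaleC_one: "scaleC 1 h = h"
  using scaleC_of_real[of 1 h] by simp

text \<open>Restriction to a complex line reduces the arguments to one complex variable. The
  derivative \<open>D\<close> is returned as well, since it identifies the slope of the restriction
  as a directional derivative.\<close>

lemma holomorphic_line:
  assumes f: "holomorphic_on_ball scaleC f" and z: "norm (x + scaleC z h) < 1"
  obtains D where "(f has_derivative D) (at (x + scaleC z h))"
    "((\<lambda>z. f (x + scaleC z h)) has_field_derivative D h) (at z)"
proof -
  obtain D where D: "(f has_derivative D) (at (x + scaleC z h))" "\<And>c h. D (scaleC c h) = c * D h"
    using f z unfolding holomorphic_on_ball_def by blast
  have "((\<lambda>z. x + scaleC z h) has_derivative (\<lambda>w. scaleC w h)) (at z)"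
    using bounded_linear.has_derivative[OF bounded_linear_scaleC_left has_derivative_ident]
    by (auto intro!: derivative_eq_intros)
  from has_derivative_compose[OF this D(1)]
  have "((\<lambda>z. f (x + scaleC z h)) has_field_derivative D h) (at z)"
    by (simp add: has_field_derivative_def D(2) mult_commute_abs)
  with D(1) show ?thesis by (rule that)
qed

text \<open>For fixed vectors \<open>u\<close> and \<open>w\<close>, the function
  \<open>g (z / r)\<close> with \<open>r = mnorm X\<close> is bounded by \<open>B\<close> on the
  unit disc, because \<open>(z / r) X\<close> stays in the open ball, and it vanishes at 0. The
  Schwarz lemma at the point \<open>r\<close> gives the factor \<open>mnorm X\<close>.\<close>

lemma mbounded_Schwarz:
  assumes n: "0 < n" and F: "F \<in> mats n H" and m: "0 < m" and X: "X \<in> ball_V m"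
  shows "block_bounded m n F X (mnorm X * NH F)"
  unfolding mbounded_def
proof (intro allI)
  fix u w :: "nat \<times> nat \<Rightarrow> complex"
  let ?I = "grid m n"
  define r where "r = mnorm X"
  have Xc: "X \<in> carrier_mat m m" using X by (rule ball_V_carrier)
  have r: "0 \<le> r" "r < 1" using X mnorm_nonneg[OF m Xc] by (auto simp: r_def open_mball_def)
  have dX: "dim_row X = m" "dim_col X = m" using Xc by auto
  have e: "F $$ (s, t) \<in> H" if "s < n" "t < n" for s t using matsD(2)[OF F] that .
  define g where "g z = (\<Sum>p\<in>?I. \<Sum>q\<in>?I. u p * (F $$ (snd p, snd q)) (0 + scaleC z (X $$ (fst p, fst q))) * w q)" for z
  have g1: "(\<Sum>p\<in>?I. \<Sum>q\<in>?I. u p * block_entries (\<lambda>x s t. (F $$ (s, t)) x) X p q * w q) = g 1"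
    by (simp add: g_def block_entries_def split_beta scaleC_one)
  show "cmod (\<Sum>p\<in>?I. \<Sum>q\<in>?I. u p * block_entries (\<lambda>x s t. (F $$ (s, t)) x) X p q * w q)
      \<le> mnorm X * NH F * l2 ?I u * l2 ?I w"
    unfolding g1
  proof (cases "r = 0")
    \<comment> \<open>Here one cannot divide by \<open>r\<close>; but \<open>X\<close> is zero, and
      functions in \<open>H\<close> vanish at the origin.\<close>
    case True
    then have "X = 0\<^sub>m m m" using mnorm_eq_0[OF m Xc] by (simp add: r_def)
    then have "g 1 = 0" unfolding g_def by (intro sum.neutral ballI) (auto simp: scaleC_one H_zero[OF e])
    then show "cmod (g 1) \<le> mnorm X * NH F * l2 ?I u * l2 ?I w"
      using NH_nonneg[OF n F] r by (simp add: r_def L2_set_nonneg)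
  next
    case False
    then have r0: "0 < r" using r by simp
    define B where "B = NH F * l2 ?I u * l2 ?I w"
    have B: "0 \<le> B" using NH_nonneg[OF n F] by (simp add: B_def L2_set_nonneg)
    have zX: "map_mat (scaleC (z / r)) X \<in> ball_V m" if "cmod z < 1" for z
      using mnorm_scale[OF m Xc, of "z / r"] Xc that r0 by (simp add: open_mball_def norm_divide r_def)
    have bd: "cmod (g (z / r)) \<le> B" if z: "cmod z < 1" for z
    proof -
      have "g (z / r) = (\<Sum>p\<in>?I. \<Sum>q\<in>?I. u p * block_entries (\<lambda>x s t. (F $$ (s, t)) x) (map_mat (scaleC (z / r)) X) p q * w q)"
        unfolding g_def by (intro sum.cong refl) (auto simp: block_entries_def dX)
      also have "cmod \<dots> \<le> NH F * l2 ?I u * l2 ?I w"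
        by (rule mboundedD[OF NH_mbounded[OF n F m zX[OF z]]])
      finally show ?thesis by (simp add: B_def)
    qed
    have hol: "(\<lambda>z. g (z / r)) holomorphic_on ball 0 1"
    proof -
      have "(\<lambda>z. (F $$ (s, t)) (0 + scaleC (z / r) (X $$ (a, b)))) holomorphic_on ball 0 1"
        if ab: "a < m" "b < m" "s < n" "t < n" for a b s t
        unfolding holomorphic_on_def
      proof
        fix z :: complex assume z: "z \<in> ball 0 1"
        have "norm (map_mat (scaleC (z / r)) X $$ (a, b)) < 1"
          by (rule norm_entry_ball[OF zX]) (use z ab in auto)
        then have "norm (0 + scaleC (z / r) (X $$ (a, b))) < 1" using ab dX by simp
        moreover have "holomorphic_on_ball scaleC (F $$ (s, t))" using e[OF ab(3,4)] by (simp add: H_iff)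
        ultimately obtain D where "((\<lambda>z. (F $$ (s, t)) (0 + scaleC z (X $$ (a, b)))) has_field_derivative D) (at (z / r))"
          by (metis holomorphic_line)
        then have "(\<lambda>z. (F $$ (s, t)) (0 + scaleC z (X $$ (a, b)))) field_differentiable (at (z / r))"
          unfolding field_differentiable_def by blast
        moreover have "(\<lambda>z. z / complex_of_real r) field_differentiable at z within ball 0 1"
          using r0 by (intro derivative_intros) auto
        ultimately show "(\<lambda>z. (F $$ (s, t)) (0 + scaleC (z / r) (X $$ (a, b)))) field_differentiable at z within ball 0 1"
          using field_differentiable_compose_within[of "\<lambda>z. z / complex_of_real r" z "ball 0 1" "\<lambda>z. (F $$ (s, t)) (0 + scaleC z (X $$ (a, b)))"]
          by (simp add: o_def field_differentiable_at_within)
      qed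
      then show ?thesis unfolding g_def by (intro holomorphic_intros) auto
    qed
    have g0: "g 0 = 0" unfolding g_def by (intro sum.neutral ballI) (auto simp: H_zero[OF e])
    have nB: "cmod (complex_of_real (B + d)) = B + d" if "0 < d" for d
      unfolding norm_of_real using B that by simp
    have "cmod (g 1) \<le> r * B"
    proof (rule field_le_epsilon)
      fix d :: real assume d: "0 < d"
      \<comment> \<open>The Schwarz lemma asks for a strict bound by 1; dividing by
        \<open>B + d\<close> ensures it and also covers \<open>B = 0\<close>.\<close>
      let ?h = "\<lambda>z::complex. g (z / of_real r) / of_real (B + d)"
      have "cmod (?h z) < 1" if "cmod z < 1" for z
        using bd[OF that] B d unfolding norm_divide nB[OF d] by simp
      moreover have "?h holomorphic_on ball 0 1"
        using nB[OF d] B d by (intro holomorphic_intros hol) auto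
      ultimately have "cmod (?h (of_real r)) \<le> cmod (of_real r)"
        using Schwarz_Lemma(1)[of ?h "of_real r"] g0 r by simp
      then have "cmod (g 1) / (B + d) \<le> r" using r0 unfolding norm_divide nB[OF d] by simp
      then have "cmod (g 1) \<le> r * (B + d)" using B d by (simp add: pos_divide_le_eq)
      also have "\<dots> \<le> r * B + d" using r d by (simp add: distrib_left mult_left_le_one_le)
      finally show "cmod (g 1) \<le> r * B + d" .
    qed
    then show "cmod (g 1) \<le> mnorm X * NH F * l2 ?I u * l2 ?I w" by (simp add: B_def r_def mult_ac)
  qed
qed

lemma mats_delta: "X \<in> ball_V n \<Longrightarrow> map_mat dl X \<in> mats n G"
  by (rule matsI) (auto simp: open_mball_def intro!: delta_in_G norm_entry_ball[unfolded open_mball_def])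

lemma mats_scale_G: "X \<in> mats n G \<Longrightarrow> map_mat (fun_scale c) X \<in> mats n G"
proof (rule matsI)
  assume X: "X \<in> mats n G"
  show "map_mat (fun_scale c) X \<in> carrier_mat n n" using matsD(1)[OF X] by simp
  fix i j assume "i < n" "j < n"
  then show "map_mat (fun_scale c) X $$ (i, j) \<in> G"
    using matsD[OF X] by (simp add: fun_space.subspace_scale[OF G_subspace])
qed

text \<open>Pairing \<open>dl\<close> of \<open>X\<close> with \<open>F\<close> gives the numbers
  obtained by pairing \<open>F\<close> with \<open>X\<close>, so the Schwarz estimate applies. The
  scalar \<open>c\<close> covers both matrix sets: 1 for \<open>A_set\<close> and
  \<open>1 / mnorm X\<close> for \<open>A_tilde\<close>.\<close>

lemma ND_delta_scaled_le:
  assumes n: "0 < n" and X: "X \<in> ball_V n" and c: "cmod c * mnorm X \<le> 1"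
  shows "map_mat (fun_scale c) (map_mat dl X) \<in> closed_mball G ND n"
proof -
  have Xc: "X \<in> carrier_mat n n" using X by (rule ball_V_carrier)
  let ?Y = "map_mat (fun_scale c) (map_mat dl X)"
  have Y: "?Y \<in> mats n G" by (intro mats_scale_G mats_delta X)
  have "ND ?Y \<le> 1"
  proof (rule ND_leI[OF n mats_G_HD[OF Y]])
    fix m F assume F: "0 < m" "F \<in> mats m H" "NH F \<le> 1"
    \<comment> \<open>In \<open>ND\<close> the index of \<open>F\<close> comes first in a pair and
      that of \<open>X\<close> second; in \<open>NH\<close> it is the other way round.\<close>
    have sw: "bij_betw prod.swap (grid m n) (grid n m)" by (auto simp: bij_betw_def)
    let ?M = "\<lambda>p q. c * block_entries (\<lambda>x s t. (F $$ (s, t)) x) X p q"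
    have "mbounded (grid n m) (grid n m) ?M (cmod c * (mnorm X * NH F))"
      by (intro mbounded_scale mbounded_Schwarz F n X)
    moreover have "cmod c * (mnorm X * NH F) \<le> 1"
    proof -
      have "cmod c * mnorm X * NH F \<le> 1 * 1"
        using c F mnorm_nonneg[OF n Xc] NH_nonneg[OF F(1,2)] by (intro mult_mono) auto
      then show ?thesis by (simp add: mult.assoc)
    qed
    ultimately have "mbounded (grid n m) (grid n m) ?M 1" by (rule mbounded_mono)
    also have "?this \<longleftrightarrow> mbounded (grid m n) (grid m n) (\<lambda>p q. ?M (prod.swap p) (prod.swap q)) 1"
      by (rule mbounded_reindex[OF sw sw])
    also have "\<dots> \<longleftrightarrow> block_bounded m n ?Y F 1"
      by (rule mbounded_cong) (use Xc matsD(2)[OF F(2)] in \<open>auto simp: block_entries_def fun_scale_def delta_apply\<close>)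
    finally show "block_bounded m n ?Y F 1" .
  qed simp
  with Y show ?thesis by (simp add: closed_mball_def)
qed

text \<open>Cauchy's inequality on circles of radius \<open>R / 4\<close> around points of modulus
  at most \<open>R / 2\<close> gives \<open>4 B / R\<close> for the first derivative and
  \<open>2 B / (R / 4)^2 = 32 B / R^2\<close> for the second.\<close>

lemma taylor2_bound:
  assumes u: "\<And>z. cmod z < R \<Longrightarrow> (u has_field_derivative u' z) (at z)" and B: "\<And>z. cmod z < R \<Longrightarrow> cmod (u z) \<le> B"
    and R: "0 < R" and z: "cmod z \<le> R / 4"
  shows "cmod (u z - u 0 - u' 0 * z) \<le> 32 * B / R\<^sup>2 * (cmod z)\<^sup>2" "cmod (u' 0) \<le> 4 * B / R"
proof -
  have hol: "u holomorphic_on ball 0 R"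
    using u unfolding holomorphic_on_def field_differentiable_def by (metis has_field_derivative_at_within mem_ball_0)
  have cauchy: "cmod ((deriv ^^ k) u w) \<le> fact k * B / (R / 4) ^ k" if w: "cmod w \<le> R / 2" for w k
  proof (rule Cauchy_inequality)
    have sub: "cball w (R / 4) \<subseteq> ball 0 R"
      using w R by (auto simp: dist_norm) (smt (verit) norm_minus_commute norm_triangle_sub)
    show "u holomorphic_on ball w (R / 4)" using hol sub by (meson ball_subset_cball holomorphic_on_subset order_trans)
    show "continuous_on (cball w (R / 4)) u" using hol sub by (meson holomorphic_on_imp_continuous_on holomorphic_on_subset)
    fix v assume "cmod (w - v) = R / 4"
    then have "v \<in> cball w (R / 4)" by (simp add: dist_norm)
    with sub show "cmod (u v) \<le> B" by (intro B) auto
  qed (use R in auto)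
  have d1: "deriv u w = u' w" if "cmod w < R" for w using u[OF that] by (rule DERIV_imp_deriv)
  have dk: "((deriv ^^ i) u has_field_derivative (deriv ^^ Suc i) u w) (at w within cball 0 (R / 2))"
    if "w \<in> cball 0 (R / 2)" for i w
  proof -
    have "(deriv ^^ i) u holomorphic_on ball 0 R" using hol by (rule holomorphic_higher_deriv) simp
    moreover have "w \<in> ball 0 R" using that R by simp
    ultimately have "((deriv ^^ i) u has_field_derivative deriv ((deriv ^^ i) u) w) (at w)"
      by (rule holomorphic_derivI[OF _ open_ball])
    then show ?thesis by (simp add: has_field_derivative_at_within)
  qed
  have "cmod ((deriv ^^ 0) u z - (\<Sum>i\<le>1. (deriv ^^ i) u 0 * (z - 0) ^ i / fact i))
      \<le> (32 * B / R\<^sup>2) * cmod (z - 0) ^ Suc 1 / fact 1"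
  proof (rule complex_Taylor[of "cball 0 (R / 2)" 1 "\<lambda>i. (deriv ^^ i) u"])
    fix x assume "x \<in> cball (0::complex) (R / 2)"
    then show "cmod ((deriv ^^ Suc 1) u x) \<le> 32 * B / R\<^sup>2"
      using cauchy[of x 2] by (simp add: numeral_2_eq_2 power2_eq_square fact_numeral field_simps)
  qed (use dk R z in \<open>auto simp del: funpow.simps\<close>)
  then show "cmod (u z - u 0 - u' 0 * z) \<le> 32 * B / R\<^sup>2 * (cmod z)\<^sup>2"
    using d1[of 0] R by (simp add: power2_eq_square diff_diff_eq)
  show "cmod (u' 0) \<le> 4 * B / R"
    using cauchy[of 0 1] d1[of 0] R by (simp add: field_simps)
qed

end

section \<open>Holomorphy of the evaluation map\<close>

context operator_space
begin

text \<open>The one-variable estimate along the direction of \<open>h\<close>. The constants depend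
  on \<open>f\<close> only through \<open>hn f\<close>; this uniformity over the unit ball of
  \<open>H\<close> is what makes \<open>dl\<close> itself differentiable.\<close>

lemma H_taylor:
  assumes f: "f \<in> H" and x: "norm x < 1" and D: "(f has_derivative D) (at x)"
  defines "R \<equiv> 1 - norm x"
  shows "norm h \<le> R / 4 \<Longrightarrow> cmod (f (x + h) - f x - D h) \<le> 32 * hn f / R\<^sup>2 * (norm h)\<^sup>2"
    and "cmod (D h) \<le> 4 * hn f / R * norm h"
proof -
  have R: "0 < R" using x by (simp add: R_def)
  have linD: "linear D" using D has_derivative_linear by blast
  \<comment> \<open>For \<open>h = 0\<close> division by zero gives \<open>k = 0\<close>, and
    \<open>h = norm h *\<^sub>R k\<close> still holds.\<close>
  define k where "k = (1 / norm h) *\<^sub>R h"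
  have hk: "h = norm h *\<^sub>R k" by (cases "h = 0") (auto simp: k_def)
  have nk: "norm k \<le> 1" by (simp add: k_def)
  define u where "u z = f (x + scaleC z k)" for z
  have inball: "norm (x + scaleC z k) < 1" if "cmod z < R" for z
  proof -
    have "norm (x + scaleC z k) \<le> norm x + cmod z * norm k"
      using norm_triangle_ineq[of x "scaleC z k"] by (simp add: norm_scaleC)
    also have "cmod z * norm k \<le> cmod z" using nk by (simp add: mult_left_le)
    finally show ?thesis using that by (simp add: R_def)
  qed
  have hol: "holomorphic_on_ball scaleC f" using f by (simp add: H_iff)
  have der: "(u has_field_derivative deriv u z) (at z)" if "cmod z < R" for z
    using holomorphic_line[OF hol inball[OF that]] unfolding u_def by (metis DERIV_imp_deriv)
  have d0: "deriv u 0 = D k"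
  proof -
    have "norm (x + scaleC 0 k) < 1" using x by simp
    then obtain D' where D': "(f has_derivative D') (at (x + scaleC 0 k))" "(u has_field_derivative D' k) (at 0)"
      using holomorphic_line[OF hol] unfolding u_def by metis
    have "D' = D" using D'(1) D has_derivative_unique by simp
    then show ?thesis using D'(2) DERIV_imp_deriv by blast
  qed
  have bd: "cmod (u z) \<le> hn f" for z using norm_le_hn[OF f] by (simp add: u_def)
  note T = taylor2_bound[of R u "deriv u" "hn f", OF der bd R]
  have uh: "u (of_real (norm h)) = f (x + h)"
    using hk by (simp add: u_def scaleC_of_real)
  have u0: "u 0 = f x" by (simp add: u_def)
  have Dh: "D h = D k * of_real (norm h)"
    using linear_scale[OF linD, of "norm h" k] hk by (simp add: scaleR_conv_of_real mult.commute)
  show "cmod (f (x + h) - f x - D h) \<le> 32 * hn f / R\<^sup>2 * (norm h)\<^sup>2" if "norm h \<le> R / 4"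
    using T(1)[of "of_real (norm h)"] that by (simp add: uh u0 d0 Dh)
  have "cmod (D k) \<le> 4 * hn f / R" using T(2)[of 0] R by (simp add: d0)
  then show "cmod (D h) \<le> 4 * hn f / R * norm h"
    using mult_right_mono[OF _ norm_ge_zero[of h]] by (metis Dh norm_mult norm_of_real abs_norm_cancel)
qed

text \<open>The derivative of \<open>dl\<close> at \<open>x\<close> in direction \<open>h\<close>,
  written down as a functional on \<open>H\<close>; thus no limit in the dual has to be
  taken.\<close>

definition dldiff :: "'v \<Rightarrow> 'v \<Rightarrow> ('v \<Rightarrow> complex) \<Rightarrow> complex" where
  "dldiff x h = (\<lambda>f. if f \<in> H then frechet_derivative f (at x) h else 0)"

lemma H_frechet:
  assumes "f \<in> H" "norm x < 1"
  shows "(f has_derivative frechet_derivative f (at x)) (at x)"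
    "frechet_derivative f (at x) (scaleC c h) = c * frechet_derivative f (at x) h"
proof -
  obtain D where D: "(f has_derivative D) (at x)" "\<And>c h. D (scaleC c h) = c * D h"
    using assms unfolding H_iff holomorphic_on_ball_def by blast
  have "D = frechet_derivative f (at x)" using frechet_derivative_at[OF D(1)] .
  with D show "(f has_derivative frechet_derivative f (at x)) (at x)"
    "frechet_derivative f (at x) (scaleC c h) = c * frechet_derivative f (at x) h" by auto
qed

lemma fbounded_dldiff:
  assumes "norm x < 1"
  shows "fbounded (dldiff x h) (4 / (1 - norm x) * norm h)"
  unfolding fbounded_def
  using H_taylor(2)[OF _ assms H_frechet(1)[OF _ assms]] by (simp add: dldiff_def mult_ac)

text \<open>Linearity in \<open>f\<close> comes from uniqueness of the Frechet derivative,
  boundedness from the Cauchy estimate.\<close>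

lemma dldiff_in_HD:
  assumes x: "norm x < 1"
  shows "dldiff x h \<in> HD"
proof -
  have add: "frechet_derivative (f + g) (at x) h = frechet_derivative f (at x) h + frechet_derivative g (at x) h"
    if "f \<in> H" "g \<in> H" for f g
  proof -
    have "(f + g has_derivative (\<lambda>h. frechet_derivative f (at x) h + frechet_derivative g (at x) h)) (at x)"
      unfolding plus_fun_def by (intro has_derivative_add H_frechet(1) that x)
    from fun_cong[OF has_derivative_unique[OF H_frechet(1)[OF add_in_H[OF that] x] this], of h]
    show ?thesis by simp
  qed
  have scl: "frechet_derivative (fun_scale c f) (at x) h = c * frechet_derivative f (at x) h" if "f \<in> H" for c f
  proof -
    have "(fun_scale c f has_derivative (\<lambda>h. c * frechet_derivative f (at x) h)) (at x)"
      unfolding fun_scale_def by (intro has_derivative_mult_right H_frechet(1) that x)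
    from fun_cong[OF has_derivative_unique[OF H_frechet(1)[OF scale_in_H[OF that] x] this], of h]
    show ?thesis by simp
  qed
  have "\<exists>C\<ge>0. fbounded (dldiff x h) C"
    using fbounded_dldiff[OF x, of h] x by (intro exI[of _ "4 / (1 - norm x) * norm h"]) auto
  then show ?thesis unfolding HD_iff by (auto simp: dldiff_def add_in_H scale_in_H add scl)
qed

lemma dldiff_add:
  assumes "norm x < 1"
  shows "dldiff x (h + k) = dldiff x h + dldiff x k"
  using linear_add[OF has_derivative_linear[OF H_frechet(1)[OF _ assms]]] by (auto simp: dldiff_def fun_eq_iff)

lemma dldiff_scaleC:
  assumes "norm x < 1"
  shows "dldiff x (scaleC c h) = fun_scale c (dldiff x h)"
  using H_frechet(2)[OF _ assms] by (auto simp: dldiff_def fun_eq_iff fun_scale_def)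

text \<open>An element of the bidual of \<open>H\<close> of norm at most \<open>c\<close>. The norm
  of \<open>\<phi>\<close> enters through its bounds \<open>M\<close>, so no supremum
  appears.\<close>

definition bounded_functional :: "((('v \<Rightarrow> complex) \<Rightarrow> complex) \<Rightarrow> complex) \<Rightarrow> real \<Rightarrow> bool" where
  "bounded_functional L c \<longleftrightarrow> 0 \<le> c \<and> (\<forall>\<phi>\<in>HD. \<forall>\<psi>\<in>HD. L (\<phi> + \<psi>) = L \<phi> + L \<psi>) \<and>
     (\<forall>z. \<forall>\<phi>\<in>HD. L (fun_scale z \<phi>) = z * L \<phi>) \<and>
     (\<forall>\<phi>\<in>HD. \<forall>M\<ge>0. fbounded \<phi> M \<longrightarrow> cmod (L \<phi>) \<le> c * M)"

lemma bounded_functionalD: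
  assumes "bounded_functional L c"
  shows "0 \<le> c" "\<phi> \<in> HD \<Longrightarrow> \<psi> \<in> HD \<Longrightarrow> L (\<phi> + \<psi>) = L \<phi> + L \<psi>" "\<phi> \<in> HD \<Longrightarrow> L (fun_scale z \<phi>) = z * L \<phi>"
    "\<phi> \<in> HD \<Longrightarrow> fbounded \<phi> M \<Longrightarrow> 0 \<le> M \<Longrightarrow> cmod (L \<phi>) \<le> c * M"
    "\<phi> \<in> HD \<Longrightarrow> \<psi> \<in> HD \<Longrightarrow> L (\<phi> - \<psi>) = L \<phi> - L \<psi>" "L 0 = 0"
proof -
  show add: "\<phi> \<in> HD \<Longrightarrow> \<psi> \<in> HD \<Longrightarrow> L (\<phi> + \<psi>) = L \<phi> + L \<psi>" for \<phi> \<psi>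
    using assms by (simp add: bounded_functional_def)
  show "\<phi> \<in> HD \<Longrightarrow> \<psi> \<in> HD \<Longrightarrow> L (\<phi> - \<psi>) = L \<phi> - L \<psi>"
    using add[of "\<phi> - \<psi>" \<psi>] fun_space.subspace_diff[OF HD_subspace, of \<phi> \<psi>] by simp
  show "L 0 = 0"
    using add[of 0 0] HD_zero by simp
qed (use assms in \<open>auto simp: bounded_functional_def\<close>)

text \<open>The functional \<open>dl y - dl x - dldiff x (y - x)\<close> has norm of order
  \<open>(norm (y - x))^2\<close>, so applying \<open>L\<close> to it yields the derivative of the
  composition.\<close>

lemma holomorphic_bounded_functional_delta:
  assumes L: "bounded_functional L c"
  shows "holomorphic_on_ball scaleC (\<lambda>x. L (dl x))"
  unfolding holomorphic_on_ball_def
proof (intro allI impI)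
  fix x :: 'v assume x: "norm x < 1"
  define R where "R = 1 - norm x"
  have R: "0 < R" using x by (simp add: R_def)
  note LD = bounded_functionalD[OF L]
  define D where "D h = L (dldiff x h)" for h
  have Dc: "D (scaleC z h) = z * D h" for z h
    by (simp add: D_def dldiff_scaleC[OF x] LD(3) dldiff_in_HD[OF x])
  have blD: "bounded_linear D"
  proof (rule bounded_linear_intro[where K = "c * (4 / R)"])
    fix h k show "D (h + k) = D h + D k" by (simp add: D_def dldiff_add[OF x] LD(2) dldiff_in_HD[OF x])
  next
    fix r :: real and h show "D (r *\<^sub>R h) = r *\<^sub>R D h"
      using Dc[of "of_real r" h] by (simp add: scaleC_of_real scaleR_conv_of_real)
  next
    fix h have "cmod (D h) \<le> c * (4 / R * norm h)"
      unfolding D_def R_def using x by (intro LD(4) dldiff_in_HD fbounded_dldiff) auto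
    then show "norm (D h) \<le> norm h * (c * (4 / R))" by (simp add: mult_ac)
  qed
  have rem: "cmod (L (dl y) - L (dl x) - D (y - x)) \<le> c * (32 / R\<^sup>2 * (norm (y - x))\<^sup>2)" if y: "norm (y - x) \<le> R / 4" for y
  proof -
    let ?\<phi> = "dl y - dl x - dldiff x (y - x)"
    have in_HD: "?\<phi> \<in> HD"
      by (intro HD_diff delta_in_HD dldiff_in_HD x)
    have "fbounded ?\<phi> (32 / R\<^sup>2 * (norm (y - x))\<^sup>2)"
      unfolding fbounded_def
    proof
      fix f assume f: "f \<in> H"
      show "cmod (?\<phi> f) \<le> 32 / R\<^sup>2 * (norm (y - x))\<^sup>2 * hn f"
        using H_taylor(1)[OF f x H_frechet(1)[OF f x], of "y - x"] y f
        by (simp add: R_def dldiff_def delta_apply mult_ac)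
    qed
    then have "cmod (L ?\<phi>) \<le> c * (32 / R\<^sup>2 * (norm (y - x))\<^sup>2)" by (intro LD(4) in_HD) auto
    moreover have "L ?\<phi> = L (dl y) - L (dl x) - D (y - x)"
      by (simp add: D_def LD(5) delta_in_HD dldiff_in_HD[OF x] HD_diff)
    ultimately show ?thesis by simp
  qed
  define K where "K = c * (32 / R\<^sup>2)"
  have K: "0 \<le> K" using LD(1) by (simp add: K_def)
  have "((\<lambda>x. L (dl x)) has_derivative D) (at x)"
    unfolding has_derivative_at_alt
  proof (intro conjI blD allI impI)
    fix e :: real assume e: "0 < e"
    show "\<exists>d>0. \<forall>y. norm (y - x) < d \<longrightarrow> norm (L (dl y) - L (dl x) - D (y - x)) \<le> e * norm (y - x)"
    \<comment> \<open>\<open>R / 4\<close> is the range of the remainder estimate;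
      \<open>K + 1\<close> stays positive also for \<open>K = 0\<close>.\<close>
    proof (intro exI[of _ "min (R / 4) (e / (K + 1))"] conjI allI impI)
      show "0 < min (R / 4) (e / (K + 1))" using R e K by simp
      fix y assume y: "norm (y - x) < min (R / 4) (e / (K + 1))"
      have "cmod (L (dl y) - L (dl x) - D (y - x)) \<le> (K * norm (y - x)) * norm (y - x)"
        using rem[of y] y by (simp add: K_def power2_eq_square mult_ac)
      also have "K * norm (y - x) \<le> (K + 1) * (e / (K + 1))" using y K by (intro mult_mono) auto
      also have "\<dots> = e" using K by simp
      finally show "norm (L (dl y) - L (dl x) - D (y - x)) \<le> e * norm (y - x)"
        by (simp add: mult_right_mono)
    qed
  qed
  with Dc show "\<exists>D. ((\<lambda>x. L (dl x)) has_derivative D) (at x) \<and> (\<forall>c h. D (scaleC c h) = c * D h)" by blast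
qed

lemma delta_outside: "\<not> norm x < 1 \<Longrightarrow> dl x = 0"
  by (auto simp: \<delta>_def fun_eq_iff H_support)

lemma functional_delta_in_H:
  assumes L: "bounded_functional L c" and cb: "0 \<le> C" "cb_bounded (\<lambda>x. L (dl x)) C"
  shows "(\<lambda>x. L (dl x)) \<in> H"
  unfolding H_iff
proof (intro conjI allI impI)
  show "holomorphic_on_ball scaleC (\<lambda>x. L (dl x))" by (rule holomorphic_bounded_functional_delta[OF L])
  show "\<exists>C\<ge>0. cb_bounded (\<lambda>x. L (dl x)) C" using cb by blast
  fix x :: 'v assume "\<not> norm x < 1"
  then have "dl x = 0" by (rule delta_outside)
  then show "L (dl x) = 0" using bounded_functionalD(6)[OF L] by simp
qed

text \<open>Both sides are linear and bounded in \<open>\<phi>\<close> and agree at the point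
  evaluations, hence on their span, and \<open>G\<close> consists of limits of that span. On
  \<open>G\<close> the bidual element is therefore evaluation at an actual function.\<close>

lemma G_eval_functional:
  assumes L: "bounded_functional L c" and f: "(\<lambda>x. L (dl x)) \<in> H" and \<phi>: "\<phi> \<in> G"
  shows "\<phi> (\<lambda>x. L (dl x)) = L \<phi>"
proof -
  let ?f = "\<lambda>x. L (dl x)"
  note LD = bounded_functionalD[OF L]
  have \<phi>D: "\<phi> \<in> HD" by (rule subsetD[OF G_subset_HD \<phi>])
  have span: "\<psi> \<in> HD \<and> \<psi> ?f = L \<psi>" if "\<psi> \<in> span_dl" for \<psi>
  proof -
    have "fun_space.subspace {\<psi> \<in> HD. \<psi> ?f = L \<psi>}"
    proof (rule fun_space.subspaceI)
      show "0 \<in> {\<psi> \<in> HD. \<psi> ?f = L \<psi>}" 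
        by (intro CollectI conjI HD_zero) (simp only: LD(6) zero_fun_apply)
    next
      fix \<phi> \<psi> assume a: "\<phi> \<in> {\<psi> \<in> HD. \<psi> ?f = L \<psi>}" "\<psi> \<in> {\<psi> \<in> HD. \<psi> ?f = L \<psi>}"
      then have "(\<phi> + \<psi>) ?f = L (\<phi> + \<psi>)" using LD(2)[of \<phi> \<psi>] by (simp only: mem_Collect_eq plus_fun_apply)
      then show "\<phi> + \<psi> \<in> {\<psi> \<in> HD. \<psi> ?f = L \<psi>}" using a HD_add by blast
    next
      fix z \<psi> assume a: "\<psi> \<in> {\<psi> \<in> HD. \<psi> ?f = L \<psi>}"
      then have "(fun_scale z \<psi>) ?f = L (fun_scale z \<psi>)" using LD(3)[of \<psi> z] by (simp only: mem_Collect_eq fun_scale_def[of z \<psi>])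
      then show "fun_scale z \<psi> \<in> {\<psi> \<in> HD. \<psi> ?f = L \<psi>}" using a HD_scale by blast
    qed
    moreover have "{dl x | x. norm x < 1} \<subseteq> {\<psi> \<in> HD. \<psi> ?f = L \<psi>}"
      using delta_in_HD delta_apply[OF f] by blast
    ultimately have "span_dl \<subseteq> {\<psi> \<in> HD. \<psi> ?f = L \<psi>}"
      by (intro fun_space.span_minimal)
    then show ?thesis using that by blast
  qed
  have "cmod (\<phi> ?f - L \<phi>) \<le> 0"
  proof (rule field_le_epsilon)
    fix e :: real assume e: "0 < e"
    \<comment> \<open>The two approximation errors are \<open>d\<close> times \<open>hn ?f\<close>
      and \<open>d\<close> times \<open>c\<close>; the summand 1 keeps the denominator
      positive.\<close>
    define d where "d = e / (hn ?f + c + 1)"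
    have s: "0 < hn ?f + c + 1" using hn_nonneg[OF f] LD(1) by simp
    have d: "0 < d" using e s by (simp add: d_def)
    obtain \<psi> where \<psi>: "\<psi> \<in> span_dl" "fbounded (\<phi> - \<psi>) d"
      using G_approx[OF \<phi> d] .
    have \<psi>': "\<psi> \<in> HD" "\<psi> ?f = L \<psi>" using span[OF \<psi>(1)] by blast+
    have diff: "\<phi> - \<psi> \<in> HD" using fun_space.subspace_diff[OF HD_subspace \<phi>D \<psi>'(1)] .
    have "cmod ((\<phi> - \<psi>) ?f) \<le> d * hn ?f" using \<psi>(2) f unfolding fbounded_def by (rule bspec)
    then have 1: "cmod (\<phi> ?f - \<psi> ?f) \<le> d * hn ?f" by (simp only: minus_apply)
    have "cmod (L (\<phi> - \<psi>)) \<le> c * d" by (rule LD(4)[OF diff \<psi>(2) less_imp_le[OF d]])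
    then have 2: "cmod (L \<phi> - L \<psi>) \<le> c * d" by (simp only: LD(5)[OF \<phi>D \<psi>'(1)])
    have 3: "cmod (\<phi> ?f - L \<phi>) \<le> d * hn ?f + c * d"
      by (rule norm_diff_triangle_le[OF 1]) (subst norm_minus_commute, subst \<psi>'(2), rule 2)
    have "d * (h + c + 1) = e \<Longrightarrow> d * h + c * d \<le> 0 + e" for h
      using d by (simp add: algebra_simps)
    moreover have "d * (hn ?f + c + 1) = e" unfolding d_def using s by simp
    ultimately have "d * hn ?f + c * d \<le> 0 + e" .
    with 3 show "cmod (\<phi> ?f - L \<phi>) \<le> 0 + e" by (rule order_trans)
  qed
  then show ?thesis by simp
qed

end

section \<open>The separating cone\<close>

text \<open>The conjugate sits on the second factor so that a Gram matrix gives a sum of squares.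
  The same convention makes a real functional on matrices, applied to a Gram matrix, a sum of values
  of its own form.\<close>

definition qform :: "nat \<Rightarrow> (nat \<Rightarrow> nat \<Rightarrow> complex) \<Rightarrow> (nat \<Rightarrow> complex) \<Rightarrow> real" where
  "qform n A v = Re (\<Sum>i<n. \<Sum>j<n. v i * A i j * cnj (v j))"

lemma qform_add: "qform n (\<lambda>i j. A i j + B i j) v = qform n A v + qform n B v"
  by (simp add: qform_def distrib_left distrib_right sum.distrib)

lemma qform_scale: "qform n (\<lambda>i j. of_real r * A i j) v = r * qform n A v"
proof -
  have "(\<Sum>i<n. \<Sum>j<n. v i * (of_real r * A i j) * cnj (v j)) = of_real r * (\<Sum>i<n. \<Sum>j<n. v i * A i j * cnj (v j))"
    by (simp add: sum_distrib_left mult_ac)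
  then show ?thesis by (simp add: qform_def del: Re_sum)
qed

lemma qform_diag: "qform n (\<lambda>i j. if i = j then of_real t else 0) v = t * (\<Sum>i<n. (cmod (v i))\<^sup>2)"
proof -
  have "(\<Sum>i<n. \<Sum>j<n. v i * (if i = j then of_real t else 0) * cnj (v j)) = (\<Sum>i<n. v i * of_real t * cnj (v i))"
    by (intro sum.cong refl) (simp add: if_distrib if_distribR cong: if_cong)
  also have "\<dots> = of_real (t * (\<Sum>i<n. (cmod (v i))\<^sup>2))"
    by (simp add: sum_distrib_left complex_norm_square mult_ac del: of_real_power)
  finally show ?thesis by (simp only: qform_def Re_complex_of_real)
qed

lemma qform_gram: "qform n (\<lambda>i j. \<Sum>a<m. \<alpha> i a * cnj (\<alpha> j a)) v = (\<Sum>a<m. (cmod (\<Sum>i<n. \<alpha> i a * v i))\<^sup>2)"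
proof -
  have "(\<Sum>i<n. \<Sum>j<n. v i * (\<Sum>a<m. \<alpha> i a * cnj (\<alpha> j a)) * cnj (v j))
      = (\<Sum>i<n. \<Sum>j<n. \<Sum>a<m. (\<alpha> i a * v i) * cnj (\<alpha> j a * v j))"
    by (simp add: sum_distrib_left sum_distrib_right mult_ac)
  also have "\<dots> = (\<Sum>i<n. \<Sum>a<m. \<Sum>j<n. (\<alpha> i a * v i) * cnj (\<alpha> j a * v j))"
    by (intro sum.cong refl sum.swap)
  also have "\<dots> = (\<Sum>a<m. \<Sum>i<n. \<Sum>j<n. (\<alpha> i a * v i) * cnj (\<alpha> j a * v j))"
    by (rule sum.swap)
  also have "\<dots> = (\<Sum>a<m. (\<Sum>i<n. \<alpha> i a * v i) * cnj (\<Sum>i<n. \<alpha> i a * v i))"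
    by (simp add: sum_product)
  also have "\<dots> = of_real (\<Sum>a<m. (cmod (\<Sum>i<n. \<alpha> i a * v i))\<^sup>2)"
    by (simp only: complex_norm_square[symmetric] of_real_sum of_real_power)
  finally show ?thesis by (simp only: qform_def Re_complex_of_real)
qed

lemma qform_cong: "(\<And>i j. i < n \<Longrightarrow> j < n \<Longrightarrow> A i j = B i j) \<Longrightarrow> qform n A v = qform n B v"
  unfolding qform_def by (intro arg_cong[of _ _ Re] sum.cong refl) auto

text \<open>Shows that a large enough multiple of the identity compensates any matrix, as an order
  unit requires.\<close>

lemma qform_lower:
  "- (\<Sum>i<n. \<Sum>j<n. cmod (A i j)) * (\<Sum>i<n. (cmod (v i))\<^sup>2) \<le> qform n A v"
proof -
  have "cmod (\<Sum>i<n. \<Sum>j<n. v i * A i j * cnj (v j)) \<le> (\<Sum>i<n. \<Sum>j<n. cmod (A i j)) * l2 {..<n} v * l2 {..<n} (\<lambda>j. cnj (v j))"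
    by (rule mboundedD[OF mbounded_sum_cmod]) auto
  also have "\<dots> = (\<Sum>i<n. \<Sum>j<n. cmod (A i j)) * (\<Sum>i<n. (cmod (v i))\<^sup>2)"
    unfolding l2_sq[symmetric] by (simp add: power2_eq_square mult.assoc)
  finally have "cmod (\<Sum>i<n. \<Sum>j<n. v i * A i j * cnj (v j)) \<le> (\<Sum>i<n. \<Sum>j<n. cmod (A i j)) * (\<Sum>i<n. (cmod (v i))\<^sup>2)" .
  then show ?thesis
    using abs_Re_le_cmod[of "\<Sum>i<n. \<Sum>j<n. v i * A i j * cnj (v j)"] unfolding qform_def by linarith
qed

type_synonym 'f triple = "(nat \<Rightarrow> nat \<Rightarrow> 'f \<Rightarrow> complex) \<times> (nat \<Rightarrow> nat \<Rightarrow> complex) \<times> (nat \<Rightarrow> nat \<Rightarrow> complex)"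

text \<open>Real scalars only: separation of cones is a real matter, and complex linearity is
  recovered afterwards from the real part.\<close>

definition tscale :: "real \<Rightarrow> 'f triple \<Rightarrow> 'f triple" where
  "tscale r = (\<lambda>(\<Psi>, A, B). (\<lambda>i j. fun_scale (of_real r) (\<Psi> i j), \<lambda>i j. of_real r * A i j, \<lambda>i j. of_real r * B i j))"

lemma vector_space_tscale: "vector_space tscale"
  by unfold_locales (auto simp: tscale_def fun_scale_def fun_eq_iff algebra_simps plus_prod_def)

definition unit_at :: "nat \<Rightarrow> nat \<Rightarrow> 'a::zero \<Rightarrow> nat \<Rightarrow> nat \<Rightarrow> 'a" where
  "unit_at i j z = (\<lambda>k l. if k = i \<and> l = j then z else 0)"

lemma sum_unit_at:
  assumes "\<And>k l. \<not> (k < n \<and> l < n) \<Longrightarrow> A k l = 0"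
  shows "(\<Sum>i<n. \<Sum>j<n. unit_at i j (A i j)) = (A :: nat \<Rightarrow> nat \<Rightarrow> 'a::comm_monoid_add)"
proof (intro ext)
  fix k l
  have "(\<Sum>i<n. \<Sum>j<n. unit_at i j (A i j)) k l = (\<Sum>i<n. \<Sum>j<n. if k = i \<and> l = j then A i j else 0)"
    by (simp add: sum_fun_apply unit_at_def)
  also have "\<dots> = (\<Sum>i<n. if k = i then (if l < n then A i l else 0) else 0)"
    by (intro sum.cong refl) auto
  also have "\<dots> = A k l" using assms[of k l] by auto
  finally show "(\<Sum>i<n. \<Sum>j<n. unit_at i j (A i j)) k l = A k l" .
qed

lemma unit_at_add: "unit_at i j (x + y) = unit_at i j x + (unit_at i j y :: nat \<Rightarrow> nat \<Rightarrow> 'a::monoid_add)"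
  by (auto simp: unit_at_def fun_eq_iff)

context operator_space
begin

text \<open>The entries range over the dual rather than \<open>G\<close>, so that the functionals
  found by separation can be applied to \<open>dldiff\<close>.\<close>

definition triple_space :: "('v \<Rightarrow> complex) triple set" where
  "triple_space = {(\<Psi>, A, B). \<forall>i j. \<Psi> i j \<in> HD}"

text \<open>
  Enlarging \<open>A\<close> and \<open>B\<close> by the error \<open>c M\<close> makes the separating functional bounded on the dual space.
  Only the real parts of the forms of \<open>A\<close> and \<open>B\<close> are constrained, so no Hermitian matrices are needed.
\<close>

definition factorisation where
  "factorisation n c \<Psi> A B m X \<alpha> \<beta> M \<longleftrightarrow> 0 < m \<and> X \<in> ball_V m \<and> 0 \<le> (M::real) \<and>
     (\<forall>i<n. \<forall>j<n. fbounded (\<Psi> i j - (\<Sum>a<m. \<Sum>b<m. fun_scale (\<alpha> i a * \<beta> j b) (dl (X $$ (a, b))))) M) \<and>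
     (\<forall>v. (\<Sum>a<m. (cmod (\<Sum>i<n. \<alpha> i a * v i))\<^sup>2) + c * M * (\<Sum>i<n. (cmod (v i))\<^sup>2) \<le> qform n A v) \<and>
     (\<forall>v. (\<Sum>a<m. (cmod (\<Sum>i<n. \<beta> i a * v i))\<^sup>2) + c * M * (\<Sum>i<n. (cmod (v i))\<^sup>2) \<le> qform n B v)"

definition factor_cone :: "nat \<Rightarrow> real \<Rightarrow> ('v \<Rightarrow> complex) triple set" where
  "factor_cone n c = {(\<Psi>, A, B). (\<forall>i j. \<Psi> i j \<in> HD) \<and> (\<exists>m X \<alpha> \<beta> M. factorisation n c \<Psi> A B m X \<alpha> \<beta> M)}"

lemma factorisationD:
  assumes "factorisation n c \<Psi> A B m X \<alpha> \<beta> M"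
  shows "0 < m" "X \<in> ball_V m" "0 \<le> M"
    "i < n \<Longrightarrow> j < n \<Longrightarrow> fbounded (\<Psi> i j - (\<Sum>a<m. \<Sum>b<m. fun_scale (\<alpha> i a * \<beta> j b) (dl (X $$ (a, b))))) M"
    "(\<Sum>a<m. (cmod (\<Sum>i<n. \<alpha> i a * v i))\<^sup>2) + c * M * (\<Sum>i<n. (cmod (v i))\<^sup>2) \<le> qform n A v"
    "(\<Sum>a<m. (cmod (\<Sum>i<n. \<beta> i a * v i))\<^sup>2) + c * M * (\<Sum>i<n. (cmod (v i))\<^sup>2) \<le> qform n B v"
  using assms unfolding factorisation_def by blast+

lemma factor_coneI:
  assumes "\<And>i j. \<Psi> i j \<in> HD" "0 < m" "X \<in> ball_V m" "0 \<le> M"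
    "\<And>i j. i < n \<Longrightarrow> j < n \<Longrightarrow> fbounded (\<Psi> i j - (\<Sum>a<m. \<Sum>b<m. fun_scale (\<alpha> i a * \<beta> j b) (dl (X $$ (a, b))))) M"
    "\<And>v. (\<Sum>a<m. (cmod (\<Sum>i<n. \<alpha> i a * v i))\<^sup>2) + c * M * (\<Sum>i<n. (cmod (v i))\<^sup>2) \<le> qform n A v"
    "\<And>v. (\<Sum>a<m. (cmod (\<Sum>i<n. \<beta> i a * v i))\<^sup>2) + c * M * (\<Sum>i<n. (cmod (v i))\<^sup>2) \<le> qform n B v"
  shows "(\<Psi>, A, B) \<in> factor_cone n c"
proof -
  have "factorisation n c \<Psi> A B m X \<alpha> \<beta> M"
    unfolding factorisation_def by (intro conjI allI impI assms)
  then show ?thesis using assms(1) unfolding factor_cone_def mem_Collect_eq prod.case by blast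
qed

lemma factor_cone_HD: "(\<Psi>, A, B) \<in> factor_cone n c \<Longrightarrow> \<Psi> i j \<in> HD"
  by (simp add: factor_cone_def)

lemma direct_sum_ball_V:
  assumes "0 < m" "0 < n" "X \<in> ball_V m" "Y \<in> ball_V n"
  shows "direct_sum X Y \<in> ball_V (m + n)"
proof -
  note c = ball_V_carrier[OF assms(3)] ball_V_carrier[OF assms(4)]
  have "mnorm (direct_sum X Y) < 1"
    using mnorm_direct_sum[OF assms(1,2) c] assms by (simp add: open_mball_def)
  moreover have "direct_sum X Y \<in> carrier_mat (m + n) (m + n)" using c by (auto simp: direct_sum_def)
  ultimately show ?thesis by (simp add: open_mball_def)
qed

text \<open>Two factorisations are joined by the direct sum of the points and concatenation of the
  coefficient matrices. Sums of squares and errors then add, and the off-diagonal blocks contribute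
  nothing by \<open>delta_0\<close>.\<close>

lemma factor_cone_add:
  assumes "(\<Psi>, A, B) \<in> factor_cone n c" "(\<Psi>', A', B') \<in> factor_cone n c"
  shows "(\<lambda>i j. \<Psi> i j + \<Psi>' i j, \<lambda>i j. A i j + A' i j, \<lambda>i j. B i j + B' i j) \<in> factor_cone n c"
proof -
  obtain m X \<alpha> \<beta> M where rep1: "factorisation n c \<Psi> A B m X \<alpha> \<beta> M"
    using assms(1) unfolding factor_cone_def by blast
  note 1 = factorisationD[OF rep1]
  obtain m' X' \<alpha>' \<beta>' M' where rep2: "factorisation n c \<Psi>' A' B' m' X' \<alpha>' \<beta>' M'"
    using assms(2) unfolding factor_cone_def by blast
  note 2 = factorisationD[OF rep2]
  define \<gamma> where "\<gamma> i a = (if a < m then \<alpha> i a else \<alpha>' i (a - m))" for i a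
  define \<epsilon> where "\<epsilon> i a = (if a < m then \<beta> i a else \<beta>' i (a - m))" for i a
  note ent = direct_sum_entry[OF ball_V_carrier[OF 1(2)] ball_V_carrier[OF 2(2)]]
  show ?thesis
  proof (rule factor_coneI)
    show "\<Psi> i j + \<Psi>' i j \<in> HD" for i j
      using factor_cone_HD[OF assms(1)] factor_cone_HD[OF assms(2)] HD_add by blast
    show "0 < m + m'" using 1 by simp
    show "direct_sum X X' \<in> ball_V (m + m')" by (rule direct_sum_ball_V[OF 1(1) 2(1) 1(2) 2(2)])
    show "0 \<le> M + M'" using 1 2 by simp
  next
    fix i j assume ij: "i < n" "j < n"
    let ?S = "\<Sum>a<m. \<Sum>b<m. fun_scale (\<alpha> i a * \<beta> j b) (dl (X $$ (a, b)))"
    let ?S' = "\<Sum>a<m'. \<Sum>b<m'. fun_scale (\<alpha>' i a * \<beta>' j b) (dl (X' $$ (a, b)))"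
    have z: "fun_scale w 0 = (0 :: ('v \<Rightarrow> complex) \<Rightarrow> complex)" for w by (simp add: fun_scale_def fun_eq_iff)
    have "(\<Sum>a<m + m'. \<Sum>b<m + m'. fun_scale (\<gamma> i a * \<epsilon> j b) (dl (direct_sum X X' $$ (a, b)))) = ?S + ?S'"
      unfolding sum_lessThan_add by (simp add: \<gamma>_def \<epsilon>_def ent delta_0 z)
    then have "\<Psi> i j + \<Psi>' i j - (\<Sum>a<m + m'. \<Sum>b<m + m'. fun_scale (\<gamma> i a * \<epsilon> j b) (dl (direct_sum X X' $$ (a, b))))
        = (\<Psi> i j - ?S) + (\<Psi>' i j - ?S')" by (simp only: add_diff_add)
    then show "fbounded (\<Psi> i j + \<Psi>' i j - (\<Sum>a<m + m'. \<Sum>b<m + m'. fun_scale (\<gamma> i a * \<epsilon> j b) (dl (direct_sum X X' $$ (a, b))))) (M + M')"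
      using fbounded_add[OF 1(4)[OF ij] 2(4)[OF ij]] by (simp only:)
  next
    fix v
    show "(\<Sum>a<m + m'. (cmod (\<Sum>i<n. \<gamma> i a * v i))\<^sup>2) + c * (M + M') * (\<Sum>i<n. (cmod (v i))\<^sup>2) \<le> qform n (\<lambda>i j. A i j + A' i j) v"
    proof -
      have "(\<Sum>a<m + m'. (cmod (\<Sum>i<n. \<gamma> i a * v i))\<^sup>2)
          = (\<Sum>a<m. (cmod (\<Sum>i<n. \<alpha> i a * v i))\<^sup>2) + (\<Sum>a<m'. (cmod (\<Sum>i<n. \<alpha>' i a * v i))\<^sup>2)"
        unfolding sum_lessThan_add by (simp add: \<gamma>_def)
      then show ?thesis using 1(5)[where v = v] 2(5)[where v = v] by (simp add: qform_add distrib_left distrib_right)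
    qed
    show "(\<Sum>a<m + m'. (cmod (\<Sum>i<n. \<epsilon> i a * v i))\<^sup>2) + c * (M + M') * (\<Sum>i<n. (cmod (v i))\<^sup>2) \<le> qform n (\<lambda>i j. B i j + B' i j) v"
    proof -
      have "(\<Sum>a<m + m'. (cmod (\<Sum>i<n. \<epsilon> i a * v i))\<^sup>2)
          = (\<Sum>a<m. (cmod (\<Sum>i<n. \<beta> i a * v i))\<^sup>2) + (\<Sum>a<m'. (cmod (\<Sum>i<n. \<beta>' i a * v i))\<^sup>2)"
        unfolding sum_lessThan_add by (simp add: \<epsilon>_def)
      then show ?thesis using 1(6)[where v = v] 2(6)[where v = v] by (simp add: qform_add distrib_left distrib_right)
    qed
  qed
qed

text \<open>The factor \<open>r\<close> is split as its square root on \<open>\<alpha>\<close> and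
  on \<open>\<beta>\<close>, so the product and both sums of squares scale by
  \<open>r\<close>.\<close>

lemma factor_cone_scale:
  assumes "(\<Psi>, A, B) \<in> factor_cone n c" and r: "0 \<le> r"
  shows "tscale r (\<Psi>, A, B) \<in> factor_cone n c"
proof -
  obtain m X \<alpha> \<beta> M where rep1: "factorisation n c \<Psi> A B m X \<alpha> \<beta> M"
    using assms(1) unfolding factor_cone_def by blast
  note 1 = factorisationD[OF rep1]
  define s where "s = complex_of_real (sqrt r)"
  have s: "s * s = of_real r" "(cmod s)\<^sup>2 = r" using r by (simp_all add: s_def flip: of_real_mult)
  have sq: "(\<Sum>a<m. (cmod (\<Sum>i<n. s * \<gamma> i a * v i))\<^sup>2) = r * (\<Sum>a<m. (cmod (\<Sum>i<n. \<gamma> i a * v i))\<^sup>2)" for \<gamma> :: "nat \<Rightarrow> nat \<Rightarrow> complex" and v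
    by (simp add: mult.assoc sum_distrib_left[symmetric] norm_mult power_mult_distrib s)
  show ?thesis
    unfolding tscale_def prod.case
  proof (rule factor_coneI[OF _ 1(1,2)])
    show "fun_scale (of_real r) (\<Psi> i j) \<in> HD" for i j
      using factor_cone_HD[OF assms(1)] HD_scale by blast
    show "0 \<le> r * M" using r 1 by simp
  next
    fix i j assume ij: "i < n" "j < n"
    have "(\<Sum>a<m. \<Sum>b<m. fun_scale ((s * \<alpha> i a) * (s * \<beta> j b)) (dl (X $$ (a, b))))
        = fun_scale (of_real r) (\<Sum>a<m. \<Sum>b<m. fun_scale (\<alpha> i a * \<beta> j b) (dl (X $$ (a, b))))"
      by (simp add: fun_space.scale_sum_right s(1)[symmetric] mult_ac)
    then have "fun_scale (of_real r) (\<Psi> i j) - (\<Sum>a<m. \<Sum>b<m. fun_scale ((s * \<alpha> i a) * (s * \<beta> j b)) (dl (X $$ (a, b))))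
        = fun_scale (of_real r) (\<Psi> i j - (\<Sum>a<m. \<Sum>b<m. fun_scale (\<alpha> i a * \<beta> j b) (dl (X $$ (a, b)))))"
      by (simp only: fun_space.scale_right_diff_distrib)
    then show "fbounded (fun_scale (of_real r) (\<Psi> i j) - (\<Sum>a<m. \<Sum>b<m. fun_scale ((s * \<alpha> i a) * (s * \<beta> j b)) (dl (X $$ (a, b))))) (r * M)"
      using fbounded_scale[OF 1(4)[OF ij], of "of_real r"] r by (simp only: norm_of_real abs_of_nonneg)
  next
    fix v
    show "(\<Sum>a<m. (cmod (\<Sum>i<n. s * \<alpha> i a * v i))\<^sup>2) + c * (r * M) * (\<Sum>i<n. (cmod (v i))\<^sup>2) \<le> qform n (\<lambda>i j. of_real r * A i j) v"
      using mult_left_mono[OF 1(5)[where v = v] r] unfolding sq qform_scale by (simp add: algebra_simps)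
    show "(\<Sum>a<m. (cmod (\<Sum>i<n. s * \<beta> i a * v i))\<^sup>2) + c * (r * M) * (\<Sum>i<n. (cmod (v i))\<^sup>2) \<le> qform n (\<lambda>i j. of_real r * B i j) v"
      using mult_left_mono[OF 1(6)[where v = v] r] unfolding sq qform_scale by (simp add: algebra_simps)
  qed
qed

text \<open>Elements that are pure error: the coefficients are zero and all of \<open>\<Psi>\<close>
  is charged to \<open>M\<close>.\<close>

lemma factor_cone_of_bound:
  assumes "\<And>i j. \<Psi> i j \<in> HD" "0 \<le> M" "\<And>i j. i < n \<Longrightarrow> j < n \<Longrightarrow> fbounded (\<Psi> i j) M"
    "\<And>v. c * M * (\<Sum>i<n. (cmod (v i))\<^sup>2) \<le> qform n A v" "\<And>v. c * M * (\<Sum>i<n. (cmod (v i))\<^sup>2) \<le> qform n B v"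
  shows "(\<Psi>, A, B) \<in> factor_cone n c"
proof (rule factor_coneI[where m = 1 and X = "0\<^sub>m 1 1" and \<alpha> = "\<lambda>_ _. 0" and \<beta> = "\<lambda>_ _. 0" and M = M])
  show "0\<^sub>m 1 1 \<in> ball_V 1" by (rule zero_in_ball_V) simp
  have "fun_scale w (dl (0\<^sub>m 1 1 $$ (0, 0))) = 0" for w by (simp add: fun_scale_def delta_0 fun_eq_iff)
  then show "fbounded (\<Psi> i j - (\<Sum>a<1. \<Sum>b<1. fun_scale (0 * 0) (dl (0\<^sub>m 1 1 $$ (a, b))))) M" if "i < n" "j < n" for i j
    using assms(3)[OF that] by simp
qed (use assms in auto)

text \<open>The cut-off at \<open>n\<close> gives support in the first \<open>n\<close> rows and
  columns, as the decomposition into matrix units requires.\<close>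

definition id_n :: "nat \<Rightarrow> nat \<Rightarrow> nat \<Rightarrow> complex" where
  "id_n n i j = (if i = j \<and> i < n then 1 else 0)"

lemma qform_id_n: "qform n (\<lambda>i j. of_real t * id_n n i j) v = t * (\<Sum>i<n. (cmod (v i))\<^sup>2)"
  unfolding qform_diag[symmetric] by (rule qform_cong) (auto simp: id_n_def)

lemma factor_cone_convex: "convex_cone_wrt tscale (factor_cone n c)"
  unfolding convex_cone_wrt_def
proof (intro conjI ballI allI impI)
  have "((\<lambda>i j. 0, \<lambda>i j. 0, \<lambda>i j. 0) :: ('v \<Rightarrow> complex) triple) \<in> factor_cone n c"
    by (rule factor_cone_of_bound[where M = 0]) (auto simp: HD_zero fbounded_def qform_def hn_nonneg)
  then show "0 \<in> factor_cone n c" by (simp add: zero_prod_def zero_fun_def)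
next
  fix x y assume "x \<in> factor_cone n c" "y \<in> factor_cone n c"
  then show "x + y \<in> factor_cone n c" using factor_cone_add by (cases x, cases y) (auto simp: plus_fun_def)
next
  fix r :: real and x assume "0 \<le> r" "x \<in> factor_cone n c"
  then show "tscale r x \<in> factor_cone n c" using factor_cone_scale by (cases x) auto
qed

lemma factor_cone_core:
  assumes c: "0 \<le> c" and x: "x \<in> triple_space"
  shows "\<exists>t>0. x + tscale t (0, id_n n, id_n n) \<in> factor_cone n c"
proof -
  obtain \<Psi> A B where xx: "x = (\<Psi>, A, B)" by (cases x) auto
  have \<Psi>: "\<Psi> i j \<in> HD" for i j using x by (simp add: triple_space_def xx)
  obtain N where N: "\<And>i j. 0 \<le> N i j \<and> fbounded (\<Psi> i j) (N i j)" using HD_D(3)[OF \<Psi>] by metis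
  define M where "M = (\<Sum>i<n. \<Sum>j<n. N i j)"
  have M0: "0 \<le> M" using N by (auto simp: M_def intro!: sum_nonneg)
  have NM: "N i j \<le> M" if "i < n" "j < n" for i j
  proof -
    have "N i j \<le> (\<Sum>j<n. N i j)" using that N by (intro member_le_sum) auto
    also have "\<dots> \<le> M" unfolding M_def using that N by (intro member_le_sum[of i _ "\<lambda>i. \<Sum>j<n. N i j"]) (auto intro!: sum_nonneg)
    finally show ?thesis .
  qed
  define a where "a = (\<Sum>i<n. \<Sum>j<n. cmod (A i j))"
  define b where "b = (\<Sum>i<n. \<Sum>j<n. cmod (B i j))"
  have ab: "0 \<le> a" "0 \<le> b" by (auto simp: a_def b_def intro!: sum_nonneg)
  \<comment> \<open>\<open>c * M\<close> pays for treating \<open>\<Psi>\<close> as pure error,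
    \<open>a\<close> and \<open>b\<close> for forms of \<open>A\<close> and \<open>B\<close> that
    may be negative, and 1 makes \<open>t\<close> positive.\<close>
  define t where "t = c * M + a + b + 1"
  have t: "0 < t" using c M0 ab by (auto simp: t_def intro!: add_nonneg_pos)
  have "(\<Psi>, \<lambda>i j. A i j + of_real t * id_n n i j, \<lambda>i j. B i j + of_real t * id_n n i j) \<in> factor_cone n c"
  proof (rule factor_cone_of_bound[OF \<Psi> M0])
    show "fbounded (\<Psi> i j) M" if "i < n" "j < n" for i j using N NM[OF that] fbounded_mono by blast
    fix v
    let ?s = "\<Sum>i<n. (cmod (v i))\<^sup>2"
    have s: "0 \<le> ?s" by (simp add: sum_nonneg)
    have "c * M * ?s \<le> (t - a) * ?s" "c * M * ?s \<le> (t - b) * ?s"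
      using s ab by (auto simp: t_def intro!: mult_right_mono)
    then show "c * M * ?s \<le> qform n (\<lambda>i j. A i j + of_real t * id_n n i j) v"
      "c * M * ?s \<le> qform n (\<lambda>i j. B i j + of_real t * id_n n i j) v"
      using qform_lower[where n = n and A = A and v = v] qform_lower[where n = n and A = B and v = v]
      unfolding qform_add qform_id_n a_def[symmetric] b_def[symmetric] by (simp_all add: algebra_simps)
  qed
  moreover have "x + tscale t (0, id_n n, id_n n)
      = (\<Psi>, \<lambda>i j. A i j + of_real t * id_n n i j, \<lambda>i j. B i j + of_real t * id_n n i j)"
    by (auto simp: xx tscale_def fun_scale_def fun_eq_iff)
  ultimately show ?thesis using t by auto
qed

lemma triple_space_subspace: "module.subspace tscale triple_space"
proof -
  interpret ts: vector_space "tscale :: real \<Rightarrow> ('v \<Rightarrow> complex) triple \<Rightarrow> _" by (rule vector_space_tscale)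
  show ?thesis
    unfolding ts.subspace_def triple_space_def
    by (auto simp: tscale_def zero_prod_def HD_zero HD_add
        intro!: HD_scale)
qed

end

lemma additive_on_sum:
  fixes h :: "'a::ab_group_add \<Rightarrow> real"
  assumes add: "\<And>x y. x \<in> S \<Longrightarrow> y \<in> S \<Longrightarrow> h (x + y) = h x + h y" and S: "0 \<in> S" "\<And>x y. x \<in> S \<Longrightarrow> y \<in> S \<Longrightarrow> x + y \<in> S"
    and f: "\<And>i. i \<in> I \<Longrightarrow> f i \<in> S"
  shows "h (\<Sum>i\<in>I. f i) = (\<Sum>i\<in>I. h (f i))" "(\<Sum>i\<in>I. f i) \<in> S"
proof -
  have h0: "h 0 = 0" using add[OF S(1) S(1)] by simp
  have "h (\<Sum>i\<in>I. f i) = (\<Sum>i\<in>I. h (f i)) \<and> (\<Sum>i\<in>I. f i) \<in> S"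
    using f by (induction I rule: infinite_finite_induct) (simp_all add: h0 S add)
  then show "h (\<Sum>i\<in>I. f i) = (\<Sum>i\<in>I. h (f i))" "(\<Sum>i\<in>I. f i) \<in> S" by blast+
qed

text \<open>Rotation by such a phase turns a lower bound for a real part into a bound for the
  modulus.\<close>

lemma ex_phase:
  obtains \<theta> where "cmod \<theta> = 1" "\<theta> * z = - complex_of_real (cmod z)"
proof (cases "z = 0")
  case True
  then show ?thesis by (intro that[of 1]) auto
next
  case False
  show ?thesis
  proof (rule that[of "- cnj z / complex_of_real (cmod z)"])
    show "cmod (- cnj z / complex_of_real (cmod z)) = 1" using False by (simp add: norm_divide)
    have "cnj z * z = complex_of_real (cmod z) * complex_of_real (cmod z)"
      using complex_norm_square[of z] by (simp add: power2_eq_square mult.commute)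
    then show "- cnj z / complex_of_real (cmod z) * z = - complex_of_real (cmod z)"
      using False by simp
  qed
qed

section \<open>The functional separating a triple from the cone\<close>

context operator_space
begin

lemma bounded_functional_sum:
  assumes "bounded_functional L c" "\<And>i. i \<in> I \<Longrightarrow> f i \<in> HD"
  shows "L (\<Sum>i\<in>I. f i) = (\<Sum>i\<in>I. L (f i))"
  using assms(2)
proof (induction I rule: infinite_finite_induct)
  case (insert x F)
  have "sum f F \<in> HD" by (rule HD_sums) (rule insert.prems, blast)
  moreover have "f x \<in> HD" by (rule insert.prems) blast
  ultimately have "L (f x + sum f F) = L (f x) + L (sum f F)" by (intro bounded_functionalD(2)[OF assms(1)])
  moreover have "L (sum f F) = (\<Sum>i\<in>F. L (f i))" by (rule insert.IH, rule insert.prems) blast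
  ultimately show ?case by (simp only: sum.insert[OF insert.hyps])
qed (simp_all add: bounded_functionalD(6)[OF assms(1)])

text \<open>The separating functional is a sum of a part on functionals, complexified to
  \<open>L\<close>, and two parts on scalar matrices, represented by \<open>w1\<close> and
  \<open>w2\<close>. Positivity on pure errors bounds \<open>L\<close> by \<open>c\<close>, and
  positivity on exact factorisations gives the inequality. The value 1 at the order unit normalises
  the traces; the value at the excluded triple gives the last claim.\<close>

lemma factor_cone_functional:
  assumes c: "0 < c" and \<Phi>: "\<And>i j. \<Phi> i j \<in> HD" "\<And>i j. \<not> (i < n \<and> j < n) \<Longrightarrow> \<Phi> i j = 0"
    and not_in: "(\<Phi>, id_n n, id_n n) \<notin> factor_cone n c"
  obtains L w1 w2 where "\<And>i j. i < n \<Longrightarrow> j < n \<Longrightarrow> bounded_functional (L i j) c"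
    "\<And>m X \<alpha> \<beta>. 0 < m \<Longrightarrow> X \<in> ball_V m \<Longrightarrow>
      cmod (\<Sum>i<n. \<Sum>j<n. \<Sum>a<m. \<Sum>b<m. \<alpha> i a * \<beta> j b * L i j (dl (X $$ (a, b))))
        \<le> (\<Sum>a<m. qform n w1 (\<lambda>i. \<alpha> i a)) + (\<Sum>b<m. qform n w2 (\<lambda>j. \<beta> j b))"
    "(\<Sum>i<n. Re (w1 i i)) + (\<Sum>i<n. Re (w2 i i)) = 1"
    "1 \<le> cmod (\<Sum>i<n. \<Sum>j<n. L i j (\<Phi> i j))"
proof -
  let ?e = "(0, id_n n, id_n n) :: ('v \<Rightarrow> complex) triple"
  have sub: "factor_cone n c \<subseteq> triple_space" by (auto simp: factor_cone_def triple_space_def)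
  have eE: "?e \<in> triple_space" by (simp add: triple_space_def HD_zero)
  have zE: "(\<Phi>, id_n n, id_n n) \<in> triple_space" using \<Phi>(1) by (simp add: triple_space_def)
  obtain \<Lambda> where \<Lambda>add: "\<And>x y. x \<in> triple_space \<Longrightarrow> y \<in> triple_space \<Longrightarrow> \<Lambda> (x + y) = \<Lambda> x + \<Lambda> y"
    and \<Lambda>scale: "\<And>r x. x \<in> triple_space \<Longrightarrow> \<Lambda> (tscale r x) = r * \<Lambda> x"
    and \<Lambda>pos: "\<And>x. x \<in> factor_cone n c \<Longrightarrow> 0 \<le> \<Lambda> x" and \<Lambda>e: "\<Lambda> ?e = 1" and \<Lambda>z: "\<Lambda> (\<Phi>, id_n n, id_n n) \<le> 0"
    using cone_separation[OF vector_space_tscale triple_space_subspace factor_cone_convex sub eE zE not_in factor_cone_core[OF less_imp_le[OF c]]] by blast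
  define h1 where "h1 \<Psi> = \<Lambda> (\<Psi>, 0, 0)" for \<Psi>
  define h2 where "h2 A = \<Lambda> (0, A, 0)" for A
  define h3 where "h3 B = \<Lambda> (0, 0, B)" for B
  define S where "S = {\<Psi> :: nat \<Rightarrow> nat \<Rightarrow> ('v \<Rightarrow> complex) \<Rightarrow> complex. \<forall>i j. \<Psi> i j \<in> HD}"
  have S0: "0 \<in> S" by (simp add: S_def HD_zero)
  have Sadd: "\<Psi> + \<Psi>' \<in> S" if "\<Psi> \<in> S" "\<Psi>' \<in> S" for \<Psi> \<Psi>'
    using that HD_add by (simp add: S_def)
  have SE: "(\<Psi>, A, B) \<in> triple_space" if "\<Psi> \<in> S" for \<Psi> A B using that by (simp add: S_def triple_space_def)
  have Su: "unit_at i j \<phi> \<in> S" if "\<phi> \<in> HD" for i j \<phi> using that by (simp add: S_def unit_at_def HD_zero)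
  have eval: "\<Lambda> (\<Psi>, A, B) = h1 \<Psi> + h2 A + h3 B" if "\<Psi> \<in> S" for \<Psi> A B
  proof -
    have "(\<Psi>, A, B) = (\<Psi>, 0, 0) + ((0, A, 0) + (0, 0, B))" by simp
    moreover have "(0, A, 0) + (0, 0, B) \<in> (triple_space :: ('v \<Rightarrow> complex) triple set)" using SE[OF S0] by simp
    ultimately show ?thesis
      by (simp only: h1_def h2_def h3_def \<Lambda>add SE[OF S0] SE[OF that] add.assoc)
  qed
  have h1add: "h1 (\<Psi> + \<Psi>') = h1 \<Psi> + h1 \<Psi>'" if "\<Psi> \<in> S" "\<Psi>' \<in> S" for \<Psi> \<Psi>'
    unfolding h1_def using \<Lambda>add[OF SE[OF that(1), of 0 0] SE[OF that(2), of 0 0]] by simp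
  have h2add: "h2 (A + A') = h2 A + h2 A'" for A A'
    unfolding h2_def using \<Lambda>add[OF SE[OF S0, of A 0] SE[OF S0, of A' 0]] by simp
  have h3add: "h3 (A + A') = h3 A + h3 A'" for A A'
    unfolding h3_def using \<Lambda>add[OF SE[OF S0, of 0 A] SE[OF S0, of 0 A']] by simp
  have ts: "tscale r (unit_at i j \<phi>, 0, 0) = (unit_at i j (fun_scale (of_real r) \<phi>), 0, 0)"
    "tscale r (0, unit_at i j z, 0) = (0, unit_at i j (of_real r * z), 0)"
    "tscale r (0, 0, unit_at i j z) = (0, 0, unit_at i j (of_real r * z))" for r i j z and \<phi> :: "('v \<Rightarrow> complex) \<Rightarrow> complex"
    by (auto simp: tscale_def unit_at_def fun_scale_def fun_eq_iff)
  define l where "l i j \<phi> = h1 (unit_at i j \<phi>)" for i j \<phi>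
  have ladd: "l i j (\<phi> + \<psi>) = l i j \<phi> + l i j \<psi>" if "\<phi> \<in> HD" "\<psi> \<in> HD" for i j \<phi> \<psi>
    unfolding l_def unit_at_add by (intro h1add Su that)
  have lscale: "l i j (fun_scale (of_real r) \<phi>) = r * l i j \<phi>" if "\<phi> \<in> HD" for i j r \<phi>
    unfolding l_def h1_def using \<Lambda>scale[OF SE[OF Su[OF that, of i j], of 0 0], of r] by (simp add: ts)
  \<comment> \<open>The usual complexification of a real linear functional with prescribed real
    part.\<close>
  define L where "L i j \<phi> = Complex (l i j \<phi>) (- l i j (fun_scale \<i> \<phi>))" for i j \<phi>
  have ReL: "Re (L i j \<phi>) = l i j \<phi>" for i j \<phi> by (simp add: L_def)
  have HDs: "fun_scale z \<phi> \<in> HD" if "\<phi> \<in> HD" for z \<phi> using HD_subspace that by (rule fun_space.subspace_scale)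
  have Ladd: "L i j (\<phi> + \<psi>) = L i j \<phi> + L i j \<psi>" if "\<phi> \<in> HD" "\<psi> \<in> HD" for i j \<phi> \<psi>
    by (simp add: L_def complex_eq_iff ladd that HDs fun_space.scale_right_distrib)
  have lz: "l i j (fun_scale z \<phi>) = Re z * l i j \<phi> + Im z * l i j (fun_scale \<i> \<phi>)" if "\<phi> \<in> HD" for i j z \<phi>
  proof -
    have "fun_scale z \<phi> = fun_scale (of_real (Re z)) \<phi> + fun_scale (of_real (Im z)) (fun_scale \<i> \<phi>)"
      by (auto simp: fun_scale_def fun_eq_iff complex_eq_iff)
    then show ?thesis by (simp only: ladd lscale HDs that)
  qed
  have Lscale: "L i j (fun_scale z \<phi>) = z * L i j \<phi>" if "\<phi> \<in> HD" for i j z \<phi>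
    using lz[OF that, of i j z] lz[OF that, of i j "\<i> * z"] by (simp add: L_def complex_eq_iff)
  have Lbound: "cmod (L i j \<phi>) \<le> c * M" if ij: "i < n" "j < n" and \<phi>: "\<phi> \<in> HD" "fbounded \<phi> M" and M: "0 \<le> M" for i j \<phi> M
  proof -
    obtain \<theta> where \<theta>: "cmod \<theta> = 1" "\<theta> * L i j \<phi> = - complex_of_real (cmod (L i j \<phi>))" by (rule ex_phase)
    let ?\<Psi> = "unit_at i j (fun_scale \<theta> \<phi>)"
    \<comment> \<open>As a pure error, \<open>?\<Psi>\<close> enters the cone at the cost of
      \<open>c * M\<close> times the order unit. By the choice of \<open>\<theta>\<close>,
      positivity there reads \<open>0 \<le> c * M - cmod (L i j \<phi>)\<close>.\<close>
    have "(?\<Psi>, \<lambda>i j. of_real (c * M) * id_n n i j, \<lambda>i j. of_real (c * M) * id_n n i j) \<in> factor_cone n c"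
    proof (rule factor_cone_of_bound[OF _ M])
      show "?\<Psi> k q \<in> HD" for k q using Su[OF HDs[OF \<phi>(1)]] by (simp add: S_def)
      have "fbounded (fun_scale \<theta> \<phi>) M" using fbounded_scale[OF \<phi>(2), of \<theta>] \<theta>(1) by simp
      then show "fbounded (?\<Psi> k q) M" for k q
        using M by (auto simp: unit_at_def fbounded_def hn_nonneg)
    qed (simp_all add: qform_id_n del: of_real_mult)
    moreover have "(?\<Psi>, \<lambda>i j. of_real (c * M) * id_n n i j, \<lambda>i j. of_real (c * M) * id_n n i j)
        = (?\<Psi>, 0, 0) + tscale (c * M) ?e"
      by (auto simp: tscale_def fun_scale_def fun_eq_iff)
    ultimately have "0 \<le> \<Lambda> ((?\<Psi>, 0, 0) + tscale (c * M) ?e)" using \<Lambda>pos by metis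
    also have "\<dots> = \<Lambda> (?\<Psi>, 0, 0) + \<Lambda> (tscale (c * M) ?e)"
    proof (rule \<Lambda>add[OF SE[OF Su[OF HDs[OF \<phi>(1)]]]])
      show "tscale (c * M) ?e \<in> triple_space" by (auto simp: tscale_def triple_space_def intro!: HDs HD_zero)
    qed
    also have "\<dots> = Re (L i j (fun_scale \<theta> \<phi>)) + c * M"
      by (simp add: \<Lambda>scale[OF eE] \<Lambda>e ReL l_def h1_def)
    also have "Re (L i j (fun_scale \<theta> \<phi>)) = - cmod (L i j \<phi>)"
      unfolding Lscale[OF \<phi>(1)] \<theta>(2) by simp
    finally show ?thesis by simp
  qed
  have Lbf: "bounded_functional (L i j) c" if "i < n" "j < n" for i j
    unfolding bounded_functional_def using c Ladd Lscale Lbound[OF that] by auto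
  have h1_sum: "h1 \<Psi> = (\<Sum>i<n. \<Sum>j<n. Re (L i j (\<Psi> i j)))"
    if \<Psi>: "\<And>i j. \<Psi> i j \<in> HD" and supp: "\<And>i j. \<not> (i < n \<and> j < n) \<Longrightarrow> \<Psi> i j = 0" for \<Psi>
  proof -
    have in_S: "unit_at i j (\<Psi> i j) \<in> S" for i j by (rule Su[OF \<Psi>])
    note row = additive_on_sum[of S h1, OF h1add S0 Sadd]
    have "h1 \<Psi> = h1 (\<Sum>i<n. \<Sum>j<n. unit_at i j (\<Psi> i j))" using sum_unit_at[of n \<Psi>, OF supp] by simp
    also have "\<dots> = (\<Sum>i<n. h1 (\<Sum>j<n. unit_at i j (\<Psi> i j)))"
      by (rule row(1)) (simp_all add: row(2) in_S)
    also have "\<dots> = (\<Sum>i<n. \<Sum>j<n. h1 (unit_at i j (\<Psi> i j)))"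
      by (intro sum.cong refl row(1)) (simp_all add: in_S)
    finally show ?thesis by (simp only: ReL l_def)
  qed
  \<comment> \<open>A real linear functional on complex matrices is the real part of a complex
    pairing; the coefficients come from its values at matrix units with entry 1 and
    \<open>\<i>\<close>.\<close>
  have repr: "h A = (\<Sum>i<n. \<Sum>j<n. Re (A i j * Complex (h (unit_at i j 1)) (- h (unit_at i j \<i>))))"
    if hadd: "\<And>A A'. h (A + A') = h A + h A'" and hs: "\<And>r i j z. h (unit_at i j (of_real r * z)) = r * h (unit_at i j z)"
      and supp: "\<And>i j. \<not> (i < n \<and> j < n) \<Longrightarrow> A i j = 0"
    for h :: "(nat \<Rightarrow> nat \<Rightarrow> complex) \<Rightarrow> real" and A
  proof -
    have unit: "h (unit_at i j z) = Re (z * Complex (h (unit_at i j 1)) (- h (unit_at i j \<i>)))" for i j z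
    proof -
      have "h (unit_at i j z) = h (unit_at i j (of_real (Re z) * 1) + unit_at i j (of_real (Im z) * \<i>))"
        unfolding unit_at_add[symmetric] by (rule arg_cong[of _ _ "\<lambda>z. h (unit_at i j z)"]) (simp add: complex_eq_iff)
      then show ?thesis by (simp only: hadd hs) simp
    qed
    note row = additive_on_sum(1)[of UNIV h]
    have "h A = h (\<Sum>i<n. \<Sum>j<n. unit_at i j (A i j))" using sum_unit_at[of n A, OF supp] by simp
    also have "\<dots> = (\<Sum>i<n. \<Sum>j<n. h (unit_at i j (A i j)))"
      by (simp add: row hadd)
    also have "\<dots> = (\<Sum>i<n. \<Sum>j<n. Re (A i j * Complex (h (unit_at i j 1)) (- h (unit_at i j \<i>))))"
      by (intro sum.cong refl) (rule unit)
    finally show ?thesis .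
  qed
  define w1 where "w1 i j = Complex (h2 (unit_at i j 1)) (- h2 (unit_at i j \<i>))" for i j
  define w2 where "w2 i j = Complex (h3 (unit_at i j 1)) (- h3 (unit_at i j \<i>))" for i j
  have h2_sum: "h2 A = (\<Sum>i<n. \<Sum>j<n. Re (A i j * w1 i j))" if "\<And>i j. \<not> (i < n \<and> j < n) \<Longrightarrow> A i j = 0" for A
    unfolding w1_def
  proof (rule repr[OF h2add _ that])
    show "h2 (unit_at i j (of_real r * z)) = r * h2 (unit_at i j z)" for r i j z
      unfolding h2_def using \<Lambda>scale[OF SE[OF S0, of "unit_at i j z" 0], of r] by (simp add: ts)
  qed
  have h3_sum: "h3 A = (\<Sum>i<n. \<Sum>j<n. Re (A i j * w2 i j))" if "\<And>i j. \<not> (i < n \<and> j < n) \<Longrightarrow> A i j = 0" for A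
    unfolding w2_def
  proof (rule repr[OF h3add _ that])
    show "h3 (unit_at i j (of_real r * z)) = r * h3 (unit_at i j z)" for r i j z
      unfolding h3_def using \<Lambda>scale[OF SE[OF S0, of 0 "unit_at i j z"], of r] by (simp add: ts)
  qed
  \<comment> \<open>Pairing \<open>w\<close> with the Gram matrix of \<open>\<alpha>\<close> sums
    the form of \<open>w\<close> over the columns of \<open>\<alpha>\<close>.\<close>
  have h_gram: "(\<Sum>i<n. \<Sum>j<n. Re ((if i < n \<and> j < n then \<Sum>a<m. \<alpha> i a * cnj (\<alpha> j a) else 0) * w i j))
      = (\<Sum>a<m. qform n w (\<lambda>i. \<alpha> i a))" for m and \<alpha> w :: "nat \<Rightarrow> nat \<Rightarrow> complex"
  proof -
    have "(\<Sum>a<m. qform n w (\<lambda>i. \<alpha> i a)) = (\<Sum>a<m. \<Sum>i<n. \<Sum>j<n. Re (\<alpha> i a * w i j * cnj (\<alpha> j a)))"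
      by (simp only: qform_def Re_sum)
    also have "\<dots> = (\<Sum>i<n. \<Sum>a<m. \<Sum>j<n. Re (\<alpha> i a * w i j * cnj (\<alpha> j a)))" by (rule sum.swap)
    also have "\<dots> = (\<Sum>i<n. \<Sum>j<n. \<Sum>a<m. Re (\<alpha> i a * w i j * cnj (\<alpha> j a)))"
      by (intro sum.cong refl sum.swap)
    also have "\<dots> = (\<Sum>i<n. \<Sum>j<n. Re ((if i < n \<and> j < n then \<Sum>a<m. \<alpha> i a * cnj (\<alpha> j a) else 0) * w i j))"
    proof (intro sum.cong refl)
      fix i j assume "i \<in> {..<n}" "j \<in> {..<n}"
      then show "(\<Sum>a<m. Re (\<alpha> i a * w i j * cnj (\<alpha> j a)))
          = Re ((if i < n \<and> j < n then \<Sum>a<m. \<alpha> i a * cnj (\<alpha> j a) else 0) * w i j)"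
        by (simp only: lessThan_iff simp_thms if_True sum_distrib_right Re_sum) (simp add: mult_ac)
    qed
    finally show ?thesis ..
  qed
  have bound: "cmod (\<Sum>i<n. \<Sum>j<n. \<Sum>a<m. \<Sum>b<m. \<alpha> i a * \<beta> j b * L i j (dl (X $$ (a, b))))
        \<le> (\<Sum>a<m. qform n w1 (\<lambda>i. \<alpha> i a)) + (\<Sum>b<m. qform n w2 (\<lambda>j. \<beta> j b))"
    if m: "0 < m" and X: "X \<in> ball_V m" for m X \<alpha> \<beta>
  proof -
    let ?T = "\<Sum>i<n. \<Sum>j<n. \<Sum>a<m. \<Sum>b<m. \<alpha> i a * \<beta> j b * L i j (dl (X $$ (a, b)))"
    obtain \<theta> where \<theta>: "cmod \<theta> = 1" "\<theta> * ?T = - complex_of_real (cmod ?T)" by (rule ex_phase)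
    \<comment> \<open>The phase is absorbed into the left coefficients; having modulus 1 it does not
      change the sums of squares. The factorisation is exact, so the error is 0.\<close>
    define \<Psi> where "\<Psi> i j = (if i < n \<and> j < n then \<Sum>a<m. \<Sum>b<m. fun_scale ((\<theta> * \<alpha> i a) * \<beta> j b) (dl (X $$ (a, b))) else 0)" for i j
    define A where "A \<gamma> i j = (if i < n \<and> j < n then \<Sum>a<m. \<gamma> i a * cnj (\<gamma> j a) else 0)" for \<gamma> :: "nat \<Rightarrow> nat \<Rightarrow> complex" and i j
    have A: "(\<Sum>a<m. (cmod (\<Sum>i<n. \<gamma> i a * v i))\<^sup>2) = qform n (A \<gamma>) v" for \<gamma> v
      unfolding qform_gram[symmetric] by (rule qform_cong) (simp add: A_def)
    have \<Psi>HD: "\<Psi> i j \<in> HD" for i j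
      by (auto simp: \<Psi>_def HD_zero intro!: HD_sums HDs delta_in_HD)
    have "(\<Psi>, A \<alpha>, A \<beta>) \<in> factor_cone n c"
    proof (rule factor_coneI[OF \<Psi>HD m X order_refl])
      show "fbounded (\<Psi> i j - (\<Sum>a<m. \<Sum>b<m. fun_scale ((\<theta> * \<alpha> i a) * \<beta> j b) (dl (X $$ (a, b))))) 0" if "i < n" "j < n" for i j
        using that by (simp add: \<Psi>_def fbounded_def)
      show "(\<Sum>a<m. (cmod (\<Sum>i<n. \<theta> * \<alpha> i a * v i))\<^sup>2) + c * 0 * (\<Sum>i<n. (cmod (v i))\<^sup>2) \<le> qform n (A \<alpha>) v" for v
        unfolding A[symmetric] by (simp add: mult.assoc sum_distrib_left[symmetric] norm_mult \<theta>(1))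
      show "(\<Sum>a<m. (cmod (\<Sum>i<n. \<beta> i a * v i))\<^sup>2) + c * 0 * (\<Sum>i<n. (cmod (v i))\<^sup>2) \<le> qform n (A \<beta>) v" for v
        unfolding A[symmetric] by simp
    qed
    then have "0 \<le> \<Lambda> (\<Psi>, A \<alpha>, A \<beta>)" by (rule \<Lambda>pos)
    moreover have "\<Psi> \<in> S" using \<Psi>HD by (simp add: S_def)
    ultimately have "0 \<le> h1 \<Psi> + h2 (A \<alpha>) + h3 (A \<beta>)" by (simp only: eval)
    also have "h2 (A \<alpha>) = (\<Sum>a<m. qform n w1 (\<lambda>i. \<alpha> i a))"
      unfolding h_gram[symmetric] by (subst h2_sum) (auto simp: A_def)
    also have "h3 (A \<beta>) = (\<Sum>a<m. qform n w2 (\<lambda>i. \<beta> i a))"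
      unfolding h_gram[symmetric] by (subst h3_sum) (auto simp: A_def)
    also have "h1 \<Psi> = Re (\<Sum>i<n. \<Sum>j<n. L i j (\<Psi> i j))"
      unfolding Re_sum by (rule h1_sum[OF \<Psi>HD]) (auto simp: \<Psi>_def)
    also have "(\<Sum>i<n. \<Sum>j<n. L i j (\<Psi> i j)) = \<theta> * ?T"
    proof -
      have "L i j (\<Psi> i j) = \<theta> * (\<Sum>a<m. \<Sum>b<m. \<alpha> i a * \<beta> j b * L i j (dl (X $$ (a, b))))" if ij: "i < n" "j < n" for i j
      proof -
        have "L i j (\<Psi> i j) = (\<Sum>a<m. L i j (\<Sum>b<m. fun_scale ((\<theta> * \<alpha> i a) * \<beta> j b) (dl (X $$ (a, b)))))"
          using ij unfolding \<Psi>_def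
          by (simp, intro bounded_functional_sum[OF Lbf[OF ij]] HD_sums HDs delta_in_HD)
        also have "\<dots> = (\<Sum>a<m. \<Sum>b<m. L i j (fun_scale ((\<theta> * \<alpha> i a) * \<beta> j b) (dl (X $$ (a, b)))))"
          by (intro sum.cong refl bounded_functional_sum[OF Lbf[OF ij]] HDs delta_in_HD)
        also have "\<dots> = (\<Sum>a<m. \<Sum>b<m. \<theta> * (\<alpha> i a * \<beta> j b * L i j (dl (X $$ (a, b)))))"
          by (simp only: Lscale delta_in_HD mult.assoc)
        finally show ?thesis by (simp only: sum_distrib_left)
      qed
      then have "(\<Sum>i<n. \<Sum>j<n. L i j (\<Psi> i j)) = (\<Sum>i<n. \<Sum>j<n. \<theta> * (\<Sum>a<m. \<Sum>b<m. \<alpha> i a * \<beta> j b * L i j (dl (X $$ (a, b)))))"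
        by (intro sum.cong refl) auto
      then show ?thesis by (simp only: sum_distrib_left)
    qed
    finally show ?thesis unfolding \<theta>(2) by simp
  qed
  have id_sum: "(\<Sum>i<n. \<Sum>j<n. Re (id_n n i j * w i j)) = (\<Sum>i<n. Re (w i i))" for w :: "nat \<Rightarrow> nat \<Rightarrow> complex"
  proof (intro sum.cong refl)
    fix i assume i: "i \<in> {..<n}"
    have "(\<Sum>j<n. Re (id_n n i j * w i j)) = (\<Sum>j<n. if i = j then Re (w i i) else 0)"
      using i by (intro sum.cong refl) (auto simp: id_n_def)
    then show "(\<Sum>j<n. Re (id_n n i j * w i j)) = Re (w i i)" using i by simp
  qed
  have idh: "h2 (id_n n) = (\<Sum>i<n. Re (w1 i i))" "h3 (id_n n) = (\<Sum>i<n. Re (w2 i i))"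
    unfolding id_sum[symmetric] by (rule h2_sum h3_sum, simp add: id_n_def, blast)+
  have h10: "h1 0 = 0" using h1add[OF S0 S0] by simp
  have tr: "(\<Sum>i<n. Re (w1 i i)) + (\<Sum>i<n. Re (w2 i i)) = 1"
    using \<Lambda>e eval[OF S0, of "id_n n" "id_n n"] by (simp add: idh h10)
  have \<Phi>S: "\<Phi> \<in> S" using \<Phi>(1) by (simp add: S_def)
  \<comment> \<open>The summand 1 is the value of the functional at the order unit, contained in the
    excluded triple.\<close>
  have "Re (\<Sum>i<n. \<Sum>j<n. L i j (\<Phi> i j)) + 1 \<le> 0"
    using \<Lambda>z eval[OF \<Phi>S, of "id_n n" "id_n n"] h1_sum[OF \<Phi>] tr by (simp add: idh)
  then have "1 \<le> cmod (\<Sum>i<n. \<Sum>j<n. L i j (\<Phi> i j))"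
    using abs_Re_le_cmod[of "\<Sum>i<n. \<Sum>j<n. L i j (\<Phi> i j)"] by linarith
  with Lbf bound tr show ?thesis by (rule that)
qed

end

section \<open>Separation by matrices of functions\<close>

text \<open>Test vectors supported on a single inner position extract one block. It is used to see
  that each entry of a bounded matrix of functions is completely bounded.\<close>

lemma mbounded_slice:
  assumes M: "mbounded (I \<times> K) (J \<times> L) M C" and fin: "finite K" "finite L" and st: "s \<in> K" "t \<in> L"
  shows "mbounded I J (\<lambda>a b. M (a, s) (b, t)) C"
  unfolding mbounded_def
proof (intro allI)
  fix u :: "'a \<Rightarrow> complex" and w :: "'c \<Rightarrow> complex"
  define u' where "u' = (\<lambda>(a, k). if k = s then u a else 0)"
  define w' where "w' = (\<lambda>(b, k). if k = t then w b else 0)"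
  have "(bform (I \<times> K) (J \<times> L) M u' w')
      = (\<Sum>a\<in>I. \<Sum>k\<in>K. \<Sum>b\<in>J. \<Sum>l\<in>L. if l = t then (if k = s then u a * M (a, s) (b, t) * w b else 0) else 0)"
    unfolding sum.cartesian_product' by (intro sum.cong refl) (auto simp: u'_def w'_def)
  also have "\<dots> = (\<Sum>a\<in>I. \<Sum>k\<in>K. if k = s then \<Sum>b\<in>J. u a * M (a, s) (b, t) * w b else 0)"
    using fin st by (intro sum.cong refl) (auto simp: sum.delta)
  also have "\<dots> = (\<Sum>a\<in>I. \<Sum>b\<in>J. u a * M (a, s) (b, t) * w b)"
    using fin st by (simp add: sum.delta)
  finally have eq: "(\<Sum>a\<in>I. \<Sum>b\<in>J. u a * M (a, s) (b, t) * w b) = (bform (I \<times> K) (J \<times> L) M u' w')" ..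
  have "(\<Sum>p\<in>I \<times> K. (cmod (u' p))\<^sup>2) = (\<Sum>a\<in>I. \<Sum>k\<in>K. if k = s then (cmod (u a))\<^sup>2 else 0)"
    unfolding sum.cartesian_product' by (intro sum.cong refl) (auto simp: u'_def)
  then have u: "l2 (I \<times> K) u' = l2 I u" using fin st by (simp add: L2_set_def sum.delta)
  have "(\<Sum>p\<in>J \<times> L. (cmod (w' p))\<^sup>2) = (\<Sum>a\<in>J. \<Sum>k\<in>L. if k = t then (cmod (w a))\<^sup>2 else 0)"
    unfolding sum.cartesian_product' by (intro sum.cong refl) (auto simp: w'_def)
  then have w: "l2 (J \<times> L) w' = l2 J w" using fin st by (simp add: L2_set_def sum.delta)
  show "cmod (\<Sum>a\<in>I. \<Sum>b\<in>J. u a * M (a, s) (b, t) * w b) \<le> C * l2 I u * l2 J w"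
    unfolding eq using mboundedD[OF M, of u' w'] unfolding u w .
qed

text \<open>Homogeneity turns the arithmetic-mean bound into the geometric-mean one.\<close>

lemma mbounded_of_mean:
  assumes fin: "finite I" "finite J"
    and B: "\<And>u w. cmod (bform I J M u w) \<le> ((l2 I u)\<^sup>2 + (l2 J w)\<^sup>2) / 2"
  shows "mbounded I J M 1"
  unfolding mbounded_def
proof (intro allI)
  fix u w
  let ?S = "\<lambda>u w. \<Sum>i\<in>I. \<Sum>j\<in>J. u i * M i j * w j"
  show "cmod (?S u w) \<le> 1 * l2 I u * l2 J w"
  proof (cases "l2 I u = 0 \<or> l2 J w = 0")
    case True
    then have "?S u w = 0"
    proof
      assume "l2 I u = 0"
      then have "\<And>i. i \<in> I \<Longrightarrow> u i = 0" using fin by (simp add: L2_set_eq_0_iff)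
      then show ?thesis by simp
    next
      assume "l2 J w = 0"
      then have "\<And>i. i \<in> J \<Longrightarrow> w i = 0" using fin by (simp add: L2_set_eq_0_iff)
      then show ?thesis by simp
    qed
    then show ?thesis by (simp add: L2_set_nonneg)
  next
    case False
    then have pos: "0 < l2 I u" "0 < l2 J w" using l2_nonneg[of u I] l2_nonneg[of w J] by linarith+
    define a where "a = complex_of_real (1 / l2 I u)"
    define b where "b = complex_of_real (1 / l2 J w)"
    have ab: "cmod a = 1 / l2 I u" "cmod b = 1 / l2 J w" unfolding a_def b_def norm_of_real using pos by simp_all
    have hom: "?S (\<lambda>i. a * u i) (\<lambda>j. b * w j) = a * b * ?S u w"
      by (simp add: sum_distrib_left mult_ac)
    have "cmod a * cmod b * cmod (?S u w) \<le> ((cmod a * l2 I u)\<^sup>2 + (cmod b * l2 J w)\<^sup>2) / 2"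
      using B[of "\<lambda>i. a * u i" "\<lambda>j. b * w j"] unfolding hom l2_mult unfolding norm_mult .
    then have "cmod (?S u w) / (l2 I u * l2 J w) \<le> 1"
      using pos unfolding ab by simp
    then show ?thesis using pos by (simp add: divide_le_eq)
  qed
qed

context operator_space
begin

lemma bounded_functional_lin_comb:
  assumes "\<And>i j. i < n \<Longrightarrow> j < n \<Longrightarrow> bounded_functional (L i j) c" "0 \<le> c"
  shows "\<exists>d. bounded_functional (\<lambda>\<phi>. \<Sum>i<n. \<Sum>j<n. r i j * L i j \<phi>) d"
proof
  show "bounded_functional (\<lambda>\<phi>. \<Sum>i<n. \<Sum>j<n. r i j * L i j \<phi>) (\<Sum>i<n. \<Sum>j<n. cmod (r i j) * c)"
    unfolding bounded_functional_def
  proof (intro conjI ballI allI impI)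
    show "0 \<le> (\<Sum>i<n. \<Sum>j<n. cmod (r i j) * c)" using assms(2) by (auto intro!: sum_nonneg)
  next
    fix \<phi> \<psi> assume "\<phi> \<in> HD" "\<psi> \<in> HD"
    then have "(\<Sum>i<n. \<Sum>j<n. r i j * L i j (\<phi> + \<psi>)) = (\<Sum>i<n. \<Sum>j<n. r i j * L i j \<phi> + r i j * L i j \<psi>)"
      using bounded_functionalD(2)[OF assms(1)] by (intro sum.cong refl) (simp only: lessThan_iff distrib_left)
    then show "(\<Sum>i<n. \<Sum>j<n. r i j * L i j (\<phi> + \<psi>)) = (\<Sum>i<n. \<Sum>j<n. r i j * L i j \<phi>) + (\<Sum>i<n. \<Sum>j<n. r i j * L i j \<psi>)"
      by (simp only: sum.distrib)
  next
    fix z \<phi> assume "\<phi> \<in> HD"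
    then have "(\<Sum>i<n. \<Sum>j<n. r i j * L i j (fun_scale z \<phi>)) = (\<Sum>i<n. \<Sum>j<n. z * (r i j * L i j \<phi>))"
      using bounded_functionalD(3)[OF assms(1)] by (intro sum.cong refl) (simp only: lessThan_iff mult.left_commute)
    then show "(\<Sum>i<n. \<Sum>j<n. r i j * L i j (fun_scale z \<phi>)) = z * (\<Sum>i<n. \<Sum>j<n. r i j * L i j \<phi>)"
      by (simp only: sum_distrib_left)
  next
    fix \<phi> and M :: real assume "\<phi> \<in> HD" "0 \<le> M" "fbounded \<phi> M"
    then have "cmod (r i j * L i j \<phi>) \<le> cmod (r i j) * c * M" if "i < n" "j < n" for i j
      using bounded_functionalD(4)[OF assms(1)[OF that], of \<phi> M]
      by (simp add: norm_mult mult.assoc mult_left_mono)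
    then have "cmod (\<Sum>i<n. \<Sum>j<n. r i j * L i j \<phi>) \<le> (\<Sum>i<n. \<Sum>j<n. cmod (r i j) * c * M)"
      by (intro sum_norm_le) auto
    then show "cmod (\<Sum>i<n. \<Sum>j<n. r i j * L i j \<phi>) \<le> (\<Sum>i<n. \<Sum>j<n. cmod (r i j) * c) * M"
      by (simp only: sum_distrib_right)
  qed
qed

lemma sum4_swap:
  "(\<Sum>i\<in>A. \<Sum>j\<in>B. \<Sum>k\<in>C. \<Sum>l\<in>D. f i j k l :: 'z::comm_monoid_add) = (\<Sum>k\<in>C. \<Sum>l\<in>D. \<Sum>i\<in>A. \<Sum>j\<in>B. f i j k l)"
proof -
  have "(\<Sum>i\<in>A. \<Sum>j\<in>B. \<Sum>k\<in>C. \<Sum>l\<in>D. f i j k l) = (\<Sum>p\<in>A \<times> B. \<Sum>q\<in>C \<times> D. f (fst p) (snd p) (fst q) (snd q))"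
    by (simp add: sum.cartesian_product')
  also have "\<dots> = (\<Sum>q\<in>C \<times> D. \<Sum>p\<in>A \<times> B. f (fst p) (snd p) (fst q) (snd q))" by (rule sum.swap)
  finally show ?thesis by (simp add: sum.cartesian_product')
qed

text \<open>
  Otherwise the separating functional, renormalised by Cholesky factors of its two positive parts,
  would be evaluation at a matrix of functions of norm at most one.
\<close>

lemma factor_cone_of_ND_less:
  assumes n: "0 < n" and c: "0 < c" and \<Phi>: "\<Phi> \<in> mats n G" and less: "ND \<Phi> < 1"
  shows "(\<lambda>i j. if i < n \<and> j < n then \<Phi> $$ (i, j) else 0, id_n n, id_n n) \<in> factor_cone n c"
proof (rule ccontr)
  assume notin: "(\<lambda>i j. if i < n \<and> j < n then \<Phi> $$ (i, j) else 0, id_n n, id_n n) \<notin> factor_cone n c"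
  note \<Phi>HD = mats_G_HD[OF \<Phi>]
  obtain L w1 w2 where L: "\<And>i j. i < n \<Longrightarrow> j < n \<Longrightarrow> bounded_functional (L i j) c"
    and bound: "\<And>m X \<alpha> \<beta>. 0 < m \<Longrightarrow> X \<in> ball_V m \<Longrightarrow>
      cmod (\<Sum>i<n. \<Sum>j<n. \<Sum>a<m. \<Sum>b<m. \<alpha> i a * \<beta> j b * L i j (dl (X $$ (a, b))))
        \<le> (\<Sum>a<m. qform n w1 (\<lambda>i. \<alpha> i a)) + (\<Sum>b<m. qform n w2 (\<lambda>j. \<beta> j b))"
    and tr: "(\<Sum>i<n. Re (w1 i i)) + (\<Sum>i<n. Re (w2 i i)) = 1"
    and big: "1 \<le> cmod (\<Sum>i<n. \<Sum>j<n. L i j (if i < n \<and> j < n then \<Phi> $$ (i, j) else 0))"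
    by (rule factor_cone_functional[OF c _ _ notin]) (auto simp: HD_zero matsD(2)[OF \<Phi>HD])
  define N where "N = ND \<Phi>"
  have N: "0 \<le> N" "N < 1" using ND_nonneg[OF n \<Phi>HD] less by (auto simp: N_def)
  \<comment> \<open>Adding \<open>e\<close> to the diagonals of both forms raises the total trace
    from 1 to \<open>1 + (1 - N) / 2\<close>, still small enough that its product with
    \<open>N\<close> is below 1.\<close>
  define e where "e = (1 - N) / (4 * real n)"
  have e: "0 < e" using N n by (simp add: e_def)
  \<comment> \<open>With one coefficient vector zero, the left side of \<open>bound\<close> vanishes
    and leaves the positivity of the other form.\<close>
  have q0: "0 \<le> qform n w1 u" "0 \<le> qform n w2 u" for u
  proof -
    have z: "0\<^sub>m 1 1 \<in> ball_V 1" by (rule zero_in_ball_V) simp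
    have "qform n w (\<lambda>_. 0) = 0" for w by (simp add: qform_def)
    then show "0 \<le> qform n w1 u" "0 \<le> qform n w2 u"
      using bound[OF _ z, of "\<lambda>i _. u i" "\<lambda>_ _. 0"] bound[OF _ z, of "\<lambda>_ _. 0" "\<lambda>i _. u i"] by simp_all
  qed
  \<comment> \<open>The perturbation makes the forms strictly positive, so that their Cholesky
    factors are invertible.\<close>
  define W where "W w i j = w i j + (if i = j then of_real e else 0)" for w :: "nat \<Rightarrow> nat \<Rightarrow> complex" and i j
  have qW: "qform n (W w) u = qform n w u + e * (\<Sum>i<n. (cmod (u i))\<^sup>2)" for w u
    unfolding W_def qform_add qform_diag ..
  have qle: "qform n w u \<le> qform n (W w) u" for w u
    unfolding qW using e by (simp add: sum_nonneg)
  have pos: "0 < qform n (W w) u" if nz: "\<exists>i<n. u i \<noteq> 0" and ge: "\<And>u. 0 \<le> qform n w u" for w u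
  proof -
    obtain i where "i < n" "u i \<noteq> 0" using nz by blast
    then have "0 < (\<Sum>i<n. (cmod (u i))\<^sup>2)" by (intro sum_pos2[of _ i]) auto
    then show ?thesis unfolding qW using e ge[of u] by (simp add: add_nonneg_pos)
  qed
  have chol: "\<exists>r r'. (\<forall>u. qform n (W w) u = (\<Sum>s<n. (cmod (\<Sum>i<n. r' s i * u i))\<^sup>2)) \<and>
      (\<forall>s<n. \<forall>t<n. (\<Sum>i<n. r' s i * r i t) = (if s = t then 1 else 0)) \<and>
      (\<forall>i<n. \<forall>j<n. (\<Sum>s<n. r i s * r' s j) = (if i = j then 1 else 0))"
    if ge: "\<And>u. 0 \<le> qform n w u" for w
  proof (rule cholesky[of n "W w"])
    fix u :: "nat \<Rightarrow> complex" assume "\<exists>i<n. u i \<noteq> 0"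
    then show "0 < Re (\<Sum>i<n. \<Sum>j<n. u i * W w i j * cnj (u j))" using pos[OF _ ge] unfolding qform_def by blast
  next
    fix r' r
    assume "\<And>u. Re (\<Sum>i<n. \<Sum>j<n. u i * W w i j * cnj (u j)) = (\<Sum>s<n. (cmod (\<Sum>i<n. r' s i * u i))\<^sup>2)"
      "\<And>s t. s < n \<Longrightarrow> t < n \<Longrightarrow> (\<Sum>i<n. r' s i * r i t) = (if s = t then 1 else 0)"
      "\<And>i j. i < n \<Longrightarrow> j < n \<Longrightarrow> (\<Sum>s<n. r i s * r' s j) = (if i = j then 1 else 0)"
    then show ?thesis unfolding qform_def by blast
  qed
  obtain r1 r1' where r1_all: "(\<forall>u. qform n (W w1) u = (\<Sum>s<n. (cmod (\<Sum>i<n. r1' s i * u i))\<^sup>2)) \<and>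
      (\<forall>s<n. \<forall>t<n. (\<Sum>i<n. r1' s i * r1 i t) = (if s = t then 1 else 0)) \<and>
      (\<forall>i<n. \<forall>j<n. (\<Sum>s<n. r1 i s * r1' s j) = (if i = j then 1 else 0))"
    using chol[OF q0(1)] by blast
  have r1: "qform n (W w1) u = (\<Sum>s<n. (cmod (\<Sum>i<n. r1' s i * u i))\<^sup>2)"
    "s < n \<Longrightarrow> t < n \<Longrightarrow> (\<Sum>i<n. r1' s i * r1 i t) = (if s = t then 1 else 0)"
    "s < n \<Longrightarrow> t < n \<Longrightarrow> (\<Sum>i<n. r1 s i * r1' i t) = (if s = t then 1 else 0)" for u s t
    using r1_all by blast+
  obtain r2 r2' where r2_all: "(\<forall>u. qform n (W w2) u = (\<Sum>s<n. (cmod (\<Sum>i<n. r2' s i * u i))\<^sup>2)) \<and>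
      (\<forall>s<n. \<forall>t<n. (\<Sum>i<n. r2' s i * r2 i t) = (if s = t then 1 else 0)) \<and>
      (\<forall>i<n. \<forall>j<n. (\<Sum>s<n. r2 i s * r2' s j) = (if i = j then 1 else 0))"
    using chol[OF q0(2)] by blast
  have r2: "qform n (W w2) u = (\<Sum>s<n. (cmod (\<Sum>i<n. r2' s i * u i))\<^sup>2)"
    "s < n \<Longrightarrow> t < n \<Longrightarrow> (\<Sum>i<n. r2' s i * r2 i t) = (if s = t then 1 else 0)"
    "s < n \<Longrightarrow> t < n \<Longrightarrow> (\<Sum>i<n. r2 s i * r2' i t) = (if s = t then 1 else 0)" for u s t
    using r2_all by blast+
  \<comment> \<open>Contracting \<open>L\<close> with the inverse Cholesky factors replaces both
    forms by Hilbert norms; halving turns their sum into an arithmetic mean.\<close>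
  define T where "T s t \<phi> = (\<Sum>i<n. \<Sum>j<n. (r1 i s * r2 j t / 2) * L i j \<phi>)" for s t \<phi>
  define f where "f s t = (\<lambda>x. T s t (dl x))" for s t
  have prod_sums: "(\<Sum>s<n. x s) * (\<Sum>t<n. y t) * z / 2 = (\<Sum>s<n. \<Sum>t<n. x s * y t * z / 2)"
    for x y :: "nat \<Rightarrow> complex" and z
    unfolding sum_product unfolding sum_distrib_right unfolding sum_divide_distrib ..
  \<comment> \<open>Substituting vectors of the form \<open>r \<eta>\<close> cancels the factor
    \<open>r'\<close> in the form, by the identity \<open>r' r = 1\<close>.\<close>
  have q_inv: "(\<Sum>a<m. qform n (W w) (\<lambda>i. \<Sum>s<n. r i s * \<eta> (a, s))) = (l2 (grid m n) \<eta>)\<^sup>2"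
    if r: "\<And>u. qform n (W w) u = (\<Sum>s<n. (cmod (\<Sum>i<n. r' s i * u i))\<^sup>2)"
      "\<And>s t. s < n \<Longrightarrow> t < n \<Longrightarrow> (\<Sum>i<n. r' s i * r i t) = (if s = t then 1 else 0)"
    for w and r r' :: "nat \<Rightarrow> nat \<Rightarrow> complex" and \<eta> and m :: nat
  proof -
    have inv: "(\<Sum>i<n. r' s i * (\<Sum>t<n. r i t * v t)) = v s" if "s < n" for s and v :: "nat \<Rightarrow> complex"
    proof -
      have "(\<Sum>i<n. r' s i * (\<Sum>t<n. r i t * v t)) = (\<Sum>i<n. \<Sum>t<n. (r' s i * r i t) * v t)"
        by (simp add: sum_distrib_left mult.assoc)
      also have "\<dots> = (\<Sum>t<n. (\<Sum>i<n. r' s i * r i t) * v t)"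
        by (subst sum.swap) (simp add: sum_distrib_right)
      also have "\<dots> = (\<Sum>t<n. if s = t then v s else 0)" using r(2) that by (intro sum.cong refl) auto
      also have "\<dots> = v s" using that by simp
      finally show ?thesis .
    qed
    have "qform n (W w) (\<lambda>i. \<Sum>s<n. r i s * \<eta> (a, s)) = (\<Sum>s<n. (cmod (\<eta> (a, s)))\<^sup>2)" for a
      unfolding r(1) by (intro sum.cong refl) (simp add: inv[where v = "\<lambda>t. \<eta> (a, t)"])
    then show ?thesis by (simp add: l2_sq sum.cartesian_product')
  qed
  have q_inv1: "(\<Sum>a<m. qform n (W w1) (\<lambda>i. \<Sum>s<n. r1 i s * \<eta> (a, s))) = (l2 (grid m n) \<eta>)\<^sup>2" for m and \<eta> :: "nat \<times> nat \<Rightarrow> complex"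
    using r1(1,2) by (rule q_inv)
  have q_inv2: "(\<Sum>a<m. qform n (W w2) (\<lambda>i. \<Sum>s<n. r2 i s * \<eta> (a, s))) = (l2 (grid m n) \<eta>)\<^sup>2" for m and \<eta> :: "nat \<times> nat \<Rightarrow> complex"
    using r2(1,2) by (rule q_inv)
  have mb: "mbounded (grid m n) (grid m n) (block_entries (\<lambda>x s t. f s t x) X) 1"
    if m: "0 < m" and X: "X \<in> ball_V m" for m X
  proof (rule mbounded_of_mean)
    fix u w :: "nat \<times> nat \<Rightarrow> complex"
    let ?I = "grid m n"
    \<comment> \<open>Moving \<open>r1\<close> and \<open>r2\<close> from \<open>T\<close> onto the
      vectors gives the coefficients to which \<open>bound\<close> applies.\<close>
    define \<alpha> where "\<alpha> i a = (\<Sum>s<n. r1 i s * u (a, s))" for i a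
    define \<beta> where "\<beta> j b = (\<Sum>t<n. r2 j t * w (b, t))" for j b
    have ab: "(\<Sum>s<n. \<Sum>t<n. u (a, s) * T s t (dl (X $$ (a, b))) * w (b, t))
          = (\<Sum>i<n. \<Sum>j<n. \<alpha> i a * \<beta> j b * L i j (dl (X $$ (a, b))) / 2)" for a b
    proof -
      have "(\<Sum>s<n. \<Sum>t<n. u (a, s) * T s t (dl (X $$ (a, b))) * w (b, t))
          = (\<Sum>s<n. \<Sum>t<n. \<Sum>i<n. \<Sum>j<n. (r1 i s * u (a, s)) * (r2 j t * w (b, t)) * L i j (dl (X $$ (a, b))) / 2)"
        unfolding T_def sum_distrib_left sum_distrib_right by (intro sum.cong refl) (simp add: mult_ac)
      also have "\<dots> = (\<Sum>i<n. \<Sum>j<n. \<Sum>s<n. \<Sum>t<n. (r1 i s * u (a, s)) * (r2 j t * w (b, t)) * L i j (dl (X $$ (a, b))) / 2)"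
        by (rule sum4_swap)
      also have "\<dots> = (\<Sum>i<n. \<Sum>j<n. \<alpha> i a * \<beta> j b * L i j (dl (X $$ (a, b))) / 2)"
        unfolding \<alpha>_def \<beta>_def prod_sums ..
      finally show ?thesis .
    qed
    have "(\<Sum>p\<in>?I. \<Sum>q\<in>?I. u p * block_entries (\<lambda>x s t. f s t x) X p q * w q)
        = (\<Sum>a<m. \<Sum>s<n. \<Sum>b<m. \<Sum>t<n. u (a, s) * T s t (dl (X $$ (a, b))) * w (b, t))"
      by (simp add: sum.cartesian_product' block_entries_def f_def)
    also have "\<dots> = (\<Sum>a<m. \<Sum>b<m. \<Sum>s<n. \<Sum>t<n. u (a, s) * T s t (dl (X $$ (a, b))) * w (b, t))"
      by (intro sum.cong refl sum.swap)
    also have "\<dots> = (\<Sum>a<m. \<Sum>b<m. \<Sum>i<n. \<Sum>j<n. \<alpha> i a * \<beta> j b * L i j (dl (X $$ (a, b))) / 2)"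
      by (simp only: ab)
    also have "\<dots> = (\<Sum>i<n. \<Sum>j<n. \<Sum>a<m. \<Sum>b<m. \<alpha> i a * \<beta> j b * L i j (dl (X $$ (a, b)))) / 2"
      by (subst sum4_swap) (simp only: sum_divide_distrib)
    finally have eq: "(\<Sum>p\<in>?I. \<Sum>q\<in>?I. u p * block_entries (\<lambda>x s t. f s t x) X p q * w q)
        = (\<Sum>i<n. \<Sum>j<n. \<Sum>a<m. \<Sum>b<m. \<alpha> i a * \<beta> j b * L i j (dl (X $$ (a, b)))) / 2" .
    have "cmod (\<Sum>i<n. \<Sum>j<n. \<Sum>a<m. \<Sum>b<m. \<alpha> i a * \<beta> j b * L i j (dl (X $$ (a, b))))
        \<le> (\<Sum>a<m. qform n w1 (\<lambda>i. \<alpha> i a)) + (\<Sum>b<m. qform n w2 (\<lambda>j. \<beta> j b))"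
      by (rule bound[OF m X])
    also have "\<dots> \<le> (\<Sum>a<m. qform n (W w1) (\<lambda>i. \<alpha> i a)) + (\<Sum>b<m. qform n (W w2) (\<lambda>j. \<beta> j b))"
      by (intro add_mono sum_mono qle)
    also have "\<dots> = (l2 ?I u)\<^sup>2 + (l2 ?I w)\<^sup>2"
      unfolding \<alpha>_def \<beta>_def q_inv1 q_inv2 ..
    finally show "cmod (\<Sum>p\<in>?I. \<Sum>q\<in>?I. u p * block_entries (\<lambda>x s t. f s t x) X p q * w q)
        \<le> ((l2 ?I u)\<^sup>2 + (l2 ?I w)\<^sup>2) / 2"
      unfolding eq by (simp add: norm_divide)
  qed auto
  have Tbf: "\<exists>d. bounded_functional (T s t) d" for s t
    unfolding T_def by (rule bounded_functional_lin_comb[OF L less_imp_le[OF c]])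
  have fH: "f s t \<in> H" if st: "s < n" "t < n" for s t
  proof -
    obtain d where d: "bounded_functional (T s t) d" using Tbf by blast
    have "cb_bounded (f s t) 1"
      unfolding cb_bounded_def
    proof (intro allI impI ballI)
      fix m X assume "0 < m" "X \<in> ball_V m"
      from mbounded_slice[OF mb[OF this], of s t] st
      show "mbounded {..<m} {..<m} (\<lambda>a b. f s t (X $$ (a, b))) 1" by (simp add: block_entries_def)
    qed
    then show ?thesis using functional_delta_in_H[OF d zero_le_one] unfolding f_def by blast
  qed
  define F where "F = mat n n (\<lambda>(s, t). f s t)"
  have F: "F \<in> mats n H" by (rule matsI) (auto simp: F_def fH)
  have NF: "NH F \<le> 1"
  proof (subst NH_le_iff[OF n F zero_le_one], intro allI impI ballI)
    fix m X assume mX: "0 < m" "X \<in> ball_V m"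
    have "mbounded (grid m n) (grid m n) (block_entries (\<lambda>x s t. f s t x) X) 1
      \<longleftrightarrow> block_bounded m n F X 1"
      by (rule mbounded_cong) (auto simp: block_entries_def F_def)
    with mb[OF mX] show "block_bounded m n F X 1" by blast
  qed
  have \<Phi>f: "(\<Phi> $$ (i, j)) (f s t) = T s t (\<Phi> $$ (i, j))" if "i < n" "j < n" "s < n" "t < n" for i j s t
  proof -
    obtain d where d: "bounded_functional (T s t) d" using Tbf by blast
    show ?thesis unfolding f_def
      by (rule G_eval_functional[OF d fH[OF that(3,4), unfolded f_def] matsD(2)[OF \<Phi> that(1,2)]])
  qed
  let ?J = "grid n n"
  \<comment> \<open>The Cholesky factors themselves serve as test vectors. By the identity
    \<open>r r' = 1\<close> they undo the contraction in \<open>T\<close>, so the pairing of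
    \<open>\<Phi>\<close> with \<open>F\<close> returns half of \<open>?S\<close>.\<close>
  let ?u = "\<lambda>(a, s). r1' a s" and ?w = "\<lambda>(b, t). r2' b t"
  let ?S = "\<Sum>i<n. \<Sum>j<n. L i j (\<Phi> $$ (i, j))"
  have "(\<Sum>p\<in>?J. \<Sum>q\<in>?J. ?u p * block_entries (\<lambda>f s t. (\<Phi> $$ (s, t)) f) F p q * ?w q)
      = (\<Sum>(a, s)\<in>?J. \<Sum>(b, t)\<in>?J. r1' a s * T a b (\<Phi> $$ (s, t)) * r2' b t)"
    by (intro sum.cong refl) (auto simp: block_entries_def F_def \<Phi>f intro!: sum.cong)
  also have "\<dots> = (\<Sum>s<n. \<Sum>t<n. \<Sum>a<n. \<Sum>b<n. r1' a s * T a b (\<Phi> $$ (s, t)) * r2' b t)"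
    by (rule sum_swap_blocks)
  also have "\<dots> = (\<Sum>s<n. \<Sum>t<n. \<Sum>a<n. \<Sum>b<n. \<Sum>i<n. \<Sum>j<n. (r1 i a * r1' a s) * (r2 j b * r2' b t) * L i j (\<Phi> $$ (s, t)) / 2)"
    unfolding T_def sum_distrib_left sum_distrib_right by (intro sum.cong refl) (simp add: mult_ac)
  also have "\<dots> = (\<Sum>s<n. \<Sum>t<n. L s t (\<Phi> $$ (s, t)) / 2)"
  proof (intro sum.cong refl)
    fix s t assume st: "s \<in> {..<n}" "t \<in> {..<n}"
    have "(\<Sum>a<n. \<Sum>b<n. \<Sum>i<n. \<Sum>j<n. (r1 i a * r1' a s) * (r2 j b * r2' b t) * L i j (\<Phi> $$ (s, t)) / 2)
        = (\<Sum>i<n. \<Sum>j<n. \<Sum>a<n. \<Sum>b<n. (r1 i a * r1' a s) * (r2 j b * r2' b t) * L i j (\<Phi> $$ (s, t)) / 2)"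
      by (rule sum4_swap)
    also have "\<dots> = (\<Sum>i<n. \<Sum>j<n. (\<Sum>a<n. r1 i a * r1' a s) * (\<Sum>b<n. r2 j b * r2' b t) * L i j (\<Phi> $$ (s, t)) / 2)"
      unfolding prod_sums ..
    also have "\<dots> = (\<Sum>i<n. \<Sum>j<n. if j = t then (if i = s then L s t (\<Phi> $$ (s, t)) / 2 else 0) else 0)"
      using st r1(3) r2(3) by (intro sum.cong refl) auto
    also have "\<dots> = (\<Sum>i<n. if i = s then L s t (\<Phi> $$ (s, t)) / 2 else 0)"
      using st by (intro sum.cong refl) (simp add: sum.delta)
    also have "\<dots> = L s t (\<Phi> $$ (s, t)) / 2" using st by (simp add: sum.delta)
    finally show "(\<Sum>a<n. \<Sum>b<n. \<Sum>i<n. \<Sum>j<n. (r1 i a * r1' a s) * (r2 j b * r2' b t) * L i j (\<Phi> $$ (s, t)) / 2) = L s t (\<Phi> $$ (s, t)) / 2" .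
  qed
  finally have eq: "(\<Sum>p\<in>?J. \<Sum>q\<in>?J. ?u p * block_entries (\<lambda>f s t. (\<Phi> $$ (s, t)) f) F p q * ?w q) = ?S / 2"
    by (simp only: sum_divide_distrib)
  \<comment> \<open>The squared Hilbert--Schmidt norm of a Cholesky factor is the trace of the form,
    read off column by column at unit vectors.\<close>
  have norm_r: "(l2 ?J (\<lambda>(a, s). r' a s))\<^sup>2 = (\<Sum>i<n. Re (w i i)) + real n * e"
    if r: "\<And>u. qform n (W w) u = (\<Sum>s<n. (cmod (\<Sum>i<n. r' s i * u i))\<^sup>2)"
    for w and r' :: "nat \<Rightarrow> nat \<Rightarrow> complex"
  proof -
    have "(\<Sum>s<n. (cmod (r' s k))\<^sup>2) = Re (w k k) + e" if k: "k < n" for k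
    proof -
      let ?\<delta> = "\<lambda>i. if i = k then 1 else 0 :: complex"
      have "(\<Sum>i<n. r' s i * ?\<delta> i) = r' s k" for s
        using k by (simp add: if_distrib[of "\<lambda>x. _ * x"] sum.delta cong: if_cong)
      then have "(\<Sum>s<n. (cmod (r' s k))\<^sup>2) = qform n (W w) ?\<delta>" unfolding r by simp
      also have "\<dots> = Re (W w k k)"
      proof -
        have "(\<Sum>i<n. \<Sum>j<n. ?\<delta> i * W w i j * cnj (?\<delta> j)) = (\<Sum>i<n. \<Sum>j<n. if j = k then (if i = k then W w k k else 0) else 0)"
          by (intro sum.cong refl) auto
        also have "\<dots> = W w k k" using k by (simp add: sum.delta)
        finally show ?thesis by (simp only: qform_def)
      qed
      finally show ?thesis by (simp add: W_def)
    qed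
    then have "(\<Sum>k<n. \<Sum>s<n. (cmod (r' s k))\<^sup>2) = (\<Sum>k<n. Re (w k k) + e)" by (intro sum.cong refl) auto
    moreover have "(l2 ?J (\<lambda>(a, s). r' a s))\<^sup>2 = (\<Sum>k<n. \<Sum>s<n. (cmod (r' s k))\<^sup>2)"
      unfolding l2_sq sum.cartesian_product' by (subst sum.swap) simp
    ultimately show ?thesis by (simp add: sum.distrib)
  qed
  have "cmod (?S / 2) \<le> N * l2 ?J ?u * l2 ?J ?w"
    unfolding eq[symmetric] by (rule mboundedD[OF ND_mbounded[OF n \<Phi>HD _ n F NF]]) (simp add: N_def)
  \<comment> \<open>The inequality of the means replaces the product of the two norms by half the
    sum of their squares, which is the normalised total trace.\<close>
  also have "\<dots> \<le> N * (((l2 ?J ?u)\<^sup>2 + (l2 ?J ?w)\<^sup>2) / 2)"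
    using N sum_squares_bound[of "l2 ?J ?u" "l2 ?J ?w"] by (simp only: mult.assoc) (intro mult_left_mono, simp_all)
  also have "(l2 ?J ?u)\<^sup>2 + (l2 ?J ?w)\<^sup>2 = 1 + 2 * real n * e"
    using norm_r[OF r1(1)] norm_r[OF r2(1)] tr by simp
  also have "2 * real n * e = (1 - N) / 2" using n by (simp add: e_def)
  finally have "cmod ?S \<le> N * (1 + (1 - N) / 2)" by (simp add: norm_divide)
  also have "\<dots> < 1"
  proof -
    have "N * ((1 - N) / 2) \<le> 1 * ((1 - N) / 2)" using N by (intro mult_right_mono) auto
    moreover have "N * (1 + (1 - N) / 2) = N + N * ((1 - N) / 2)" by (simp only: distrib_left mult_1_right)
    moreover have "y \<le> 1 * ((1 - N) / 2) \<Longrightarrow> N + y < 1" for y using N by simp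
    ultimately show ?thesis by (simp only:)
  qed
  finally have "cmod ?S < 1" .
  moreover have "(\<Sum>i<n. \<Sum>j<n. L i j (if i < n \<and> j < n then \<Phi> $$ (i, j) else 0)) = ?S"
    by (intro sum.cong refl) auto
  ultimately show False using big by simp
qed

end

section \<open>The closed matrix unit ball as a closed hull\<close>

context operator_space
begin

text \<open>Scalar diagonal matrices realise multiplication by a number of modulus at most 1 as an
  operation under which absolutely matrix convex sets are stable.\<close>

abbreviation "sdiag k z \<equiv> mat k k (\<lambda>(i, j). if i = j then z else 0 :: complex)"

lemma opnorm_sdiag:
  assumes "cmod z \<le> 1"
  shows "opnorm (sdiag k z) \<le> 1"
proof (subst opnorm_le_iff)
  show "mbounded {..<k} {..<k} (\<lambda>i j. sdiag k z $$ (i, j)) 1"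
  proof (rule mbounded_of_apply)
    fix w :: "nat \<Rightarrow> complex"
    have "l2 {..<k} (\<lambda>i. \<Sum>j<k. sdiag k z $$ (i, j) * w j) = l2 {..<k} (\<lambda>i. z * w i)"
    proof (intro L2_set_cong refl arg_cong[of _ _ cmod])
      fix i assume i: "i \<in> {..<k}"
      have "(\<Sum>j<k. sdiag k z $$ (i, j) * w j) = (\<Sum>j<k. if i = j then z * w i else 0)"
        using i by (intro sum.cong refl) auto
      then show "(\<Sum>j<k. sdiag k z $$ (i, j) * w j) = z * w i" using i by simp
    qed
    also have "\<dots> = cmod z * l2 {..<k} w" by (rule l2_mult)
    finally show "l2 {..<k} (\<lambda>i. \<Sum>j<k. sdiag k z $$ (i, j) * w j) \<le> 1 * l2 {..<k} w"
      using mult_right_mono[OF assms l2_nonneg[of w "{..<k}"]] by simp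
  qed
qed auto

lemma bimult_sdiag:
  assumes X: "X \<in> carrier_mat k k"
  shows "bimult fun_scale (sdiag k z) X (sdiag k 1) = map_mat (fun_scale z) X"
proof (rule eq_matI)
  fix i j assume "i < dim_row (map_mat (fun_scale z) X)" "j < dim_col (map_mat (fun_scale z) X)"
  then have ij: "i < k" "j < k" using X by auto
  have "bimult fun_scale (sdiag k z) X (sdiag k 1) $$ (i, j)
      = (\<Sum>p<k. \<Sum>q<k. fun_scale (sdiag k z $$ (i, p) * sdiag k 1 $$ (q, j)) (X $$ (p, q)))"
    using X ij by (intro bimult_entry) auto
  also have "\<dots> = (\<Sum>p<k. \<Sum>q<k. if q = j then (if p = i then fun_scale z (X $$ (i, j)) else 0) else 0)"
    using ij by (intro sum.cong refl) (auto simp: fun_scale_def fun_eq_iff)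
  also have "\<dots> = (\<Sum>p<k. if p = i then fun_scale z (X $$ (i, j)) else 0)"
    using ij by (intro sum.cong refl) (simp only: sum.delta finite_lessThan lessThan_iff if_True)
  also have "\<dots> = fun_scale z (X $$ (i, j))"
    using ij by (simp only: sum.delta finite_lessThan lessThan_iff if_True)
  finally show "bimult fun_scale (sdiag k z) X (sdiag k 1) $$ (i, j) = map_mat (fun_scale z) X $$ (i, j)"
    using ij X by simp
qed (use X in \<open>auto simp: bimult_def\<close>)

lemma A_set_subset_closed_mball:
  assumes "0 < n"
  shows "A_set scaleC mnorm n \<subseteq> closed_mball G ND n"
proof
  fix Y assume "Y \<in> A_set scaleC mnorm n"
  then obtain X where X: "X \<in> ball_V n" and Y: "Y = map_mat dl X" by (auto simp: A_set_def)
  have "map_mat (fun_scale 1) (map_mat dl X) \<in> closed_mball G ND n"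
    using X by (intro ND_delta_scaled_le assms) (auto simp: open_mball_def)
  moreover have "map_mat (fun_scale 1) (map_mat dl X) = map_mat dl X"
    by (intro eq_matI) (auto simp: fun_scale_def)
  ultimately show "Y \<in> closed_mball G ND n" by (simp only: Y)
qed

lemma A_tilde_subset_closed_mball:
  assumes "0 < n"
  shows "A_tilde scaleC mnorm n \<subseteq> closed_mball G ND n"
proof
  fix Y assume "Y \<in> A_tilde scaleC mnorm n"
  then obtain X where X: "X \<in> ball_V n" and Y: "Y = map_mat (fun_scale (of_real (1 / mnorm X))) (map_mat dl X)"
    unfolding A_tilde_def by blast
  have "cmod (of_real (1 / mnorm X)) * mnorm X \<le> 1"
    unfolding norm_of_real using mnorm_nonneg[OF assms ball_V_carrier[OF X]] by (cases "mnorm X = 0") auto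
  then show "Y \<in> closed_mball G ND n" unfolding Y by (rule ND_delta_scaled_le[OF assms X])
qed

lemma abs_matrix_convexD:
  assumes "abs_matrix_convex scl E K" "0 < n"
  shows "K n \<noteq> {}" "K n \<subseteq> mats n E"
    "0 < m \<Longrightarrow> X \<in> K n \<Longrightarrow> \<alpha> \<in> carrier_mat m n \<Longrightarrow> \<beta> \<in> carrier_mat n m \<Longrightarrow> opnorm \<alpha> \<le> 1 \<Longrightarrow> opnorm \<beta> \<le> 1
      \<Longrightarrow> bimult scl \<alpha> X \<beta> \<in> K m"
proof -
  have "\<forall>n>0. K n \<subseteq> mats n E \<and> K n \<noteq> {}"
    using assms(1) unfolding abs_matrix_convex_def by (rule conjunct1)
  then show "K n \<noteq> {}" "K n \<subseteq> mats n E" using assms(2) by blast+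
  have "\<forall>m>0. \<forall>n>0. \<forall>X \<in> K n. \<forall>\<alpha> \<in> carrier_mat m n. \<forall>\<beta> \<in> carrier_mat n m.
        opnorm \<alpha> \<le> 1 \<and> opnorm \<beta> \<le> 1 \<longrightarrow> bimult scl \<alpha> X \<beta> \<in> K m"
    using assms(1)[unfolded abs_matrix_convex_def, THEN conjunct2, THEN conjunct2] .
  then show "0 < m \<Longrightarrow> X \<in> K n \<Longrightarrow> \<alpha> \<in> carrier_mat m n \<Longrightarrow> \<beta> \<in> carrier_mat n m \<Longrightarrow> opnorm \<alpha> \<le> 1 \<Longrightarrow> opnorm \<beta> \<le> 1
      \<Longrightarrow> bimult scl \<alpha> X \<beta> \<in> K m"
    using assms(2) by blast
qed

lemma A_set_subset_of_A_tilde: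
  assumes L: "abs_matrix_convex fun_scale G L" and A: "\<And>k. 0 < k \<Longrightarrow> A_tilde scaleC mnorm k \<subseteq> L k" and k: "0 < k"
  shows "A_set scaleC mnorm k \<subseteq> L k"
proof
  fix Y assume "Y \<in> A_set scaleC mnorm k"
  then obtain X where X: "X \<in> ball_V k" and Y: "Y = map_mat dl X" by (auto simp: A_set_def)
  have Xc: "X \<in> carrier_mat k k" using X by (rule ball_V_carrier)
  have scl: "map_mat (fun_scale z) Z \<in> L k" if "Z \<in> L k" "cmod z \<le> 1" for z Z
  proof -
    have Z: "Z \<in> carrier_mat k k" using abs_matrix_convexD(2)[OF L k] that(1) matsD(1) by blast
    have "bimult fun_scale (sdiag k z) Z (sdiag k 1) \<in> L k"
      by (intro abs_matrix_convexD(3)[OF L k k that(1)] opnorm_sdiag) (use that in auto)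
    then show ?thesis by (simp only: bimult_sdiag[OF Z])
  qed
  show "Y \<in> L k"
  proof (cases "X = 0\<^sub>m k k")
    case True
    \<comment> \<open>The zero matrix has no normalised counterpart in \<open>A_tilde\<close>. It is
      obtained as 0 times an arbitrary element, since level \<open>k\<close> of an absolutely matrix
      convex set is nonempty.\<close>
    obtain Z where Z: "Z \<in> L k" using abs_matrix_convexD(1)[OF L k] by blast
    have Zc: "Z \<in> carrier_mat k k" using abs_matrix_convexD(2)[OF L k] Z matsD(1) by blast
    have "map_mat (fun_scale 0) Z = Y"
      unfolding Y True using Zc by (intro eq_matI) (auto simp: fun_scale_def delta_0 fun_eq_iff)
    then show ?thesis using scl[OF Z, of 0] by simp
  next
    case False
    then have r: "0 < mnorm X" using mnorm_eq_0[OF k Xc] mnorm_nonneg[OF k Xc] by linarith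
    let ?Z = "map_mat (fun_scale (of_real (1 / mnorm X))) (map_mat dl X)"
    have Z: "?Z \<in> L k" using A[OF k] X False unfolding A_tilde_def by blast
    have "cmod (of_real (mnorm X)) \<le> 1" using X r by (simp add: open_mball_def)
    then have "map_mat (fun_scale (of_real (mnorm X))) ?Z \<in> L k" by (rule scl[OF Z])
    moreover have "map_mat (fun_scale (of_real (mnorm X))) ?Z = Y"
      unfolding Y using r by (intro eq_matI) (auto simp: fun_scale_def fun_eq_iff)
    ultimately show ?thesis by simp
  qed
qed

lemma hull_A_subset_hull_A_tilde:
  "abs_matrix_convex_hull fun_scale G (A_set scaleC mnorm) n \<subseteq> abs_matrix_convex_hull fun_scale G (A_tilde scaleC mnorm) n"
proof -
  have "abs_matrix_convex_hull fun_scale G (A_set scaleC mnorm) n \<subseteq> L n"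
    if "abs_matrix_convex fun_scale G L" "\<forall>k>0. A_tilde scaleC mnorm k \<subseteq> L k" for L
    using that A_set_subset_of_A_tilde[of L] by (intro abs_matrix_convex_hull_subset) auto
  then show ?thesis unfolding abs_matrix_convex_hull_def[of _ _ "A_tilde scaleC mnorm"] by blast
qed

text \<open>Shrinking \<open>X\<close> to \<open>\<Phi> = (1 - d) X\<close> makes the norm strictly
  less than 1, so \<open>\<Phi>\<close> factors through the cone up to an error. The difference
  \<open>X - Y\<close> is \<open>d X\<close> plus \<open>\<Phi> - Y\<close>; the factor
  \<open>K\<close> is the loss in passing from entries to \<open>ND\<close>, and each of the two
  terms is allotted \<open>e / 4\<close>.\<close>

lemma closed_mball_approx:
  assumes n: "0 < n" and X: "X \<in> closed_mball G ND n" and e: "0 < e"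
  shows "\<exists>Y\<in>abs_matrix_convex_hull fun_scale G (A_set scaleC mnorm) n. ND (X - Y) < e"
proof -
  have XG: "X \<in> mats n G" and NX: "ND X \<le> 1" using X by (auto simp: closed_mball_def)
  note XHD = mats_G_HD[OF XG] and Xc = matsD(1)[OF XG]
  have "\<exists>C\<ge>0. fbounded (X $$ (s, t)) C" if "s < n" "t < n" for s t
    using HD_D(3)[OF matsD(2)[OF XHD that]] .
  then obtain B where B: "\<And>s t. s < n \<Longrightarrow> t < n \<Longrightarrow> 0 \<le> B s t \<and> fbounded (X $$ (s, t)) (B s t)" by metis
  define M where "M = (\<Sum>i<n. \<Sum>j<n. B i j)"
  have M: "0 \<le> M" using B by (auto simp: M_def intro!: sum_nonneg)
  have BM: "B i j \<le> M" if "i < n" "j < n" for i j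
  proof -
    have "B i j \<le> (\<Sum>j<n. B i j)" using that B by (intro member_le_sum) auto
    also have "\<dots> \<le> M" unfolding M_def using that B by (intro member_le_sum[of i _ "\<lambda>i. \<Sum>j<n. B i j"]) (auto intro!: sum_nonneg)
    finally show ?thesis .
  qed
  define K where "K = real n * real n"
  have K: "0 < K" using n by (simp add: K_def)
  \<comment> \<open>The second entry makes the shrinking cost at most \<open>e / 4\<close> even
    after the loss \<open>K\<close>, with \<open>M + 1\<close> positive also for
    \<open>M = 0\<close>; the first keeps \<open>1 - d\<close> positive.\<close>
  define d where "d = min (1 / 2) (e / (4 * K * (M + 1)))"
  have d: "0 < d" "d \<le> 1 / 2" using e K M by (auto simp: d_def)
  have dM: "K * (d * M) \<le> e / 4"
  proof -
    have "d * M \<le> e / (4 * K * (M + 1)) * (M + 1)" using d M by (intro mult_mono) (auto simp: d_def)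
    also have "\<dots> = e / (4 * K)" using M by simp
    finally show ?thesis using mult_left_mono[of "d * M" "e / (4 * K)" K] K by simp
  qed
  \<comment> \<open>Chosen so that a factorisation error of \<open>1 / c\<close> costs exactly
    \<open>e / 4\<close> after the loss \<open>K\<close>.\<close>
  define c where "c = 4 * K / e"
  have c: "0 < c" "K * (1 / c) = e / 4" using e K by (simp_all add: c_def)
  define \<Phi> where "\<Phi> = map_mat (fun_scale (of_real (1 - d))) X"
  have \<Phi>G: "\<Phi> \<in> mats n G" unfolding \<Phi>_def by (rule mats_scale_G[OF XG])
  have "ND \<Phi> \<le> 1 - d"
  proof (rule ND_leI[OF n mats_G_HD[OF \<Phi>G]])
    fix m F assume F: "0 < m" "F \<in> mats m H" "NH F \<le> 1"
    have "mbounded (grid m n) (grid m n) (\<lambda>p q. of_real (1 - d) * block_entries (\<lambda>f s t. (X $$ (s, t)) f) F p q) (cmod (of_real (1 - d)) * 1)"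
      by (intro mbounded_scale ND_mbounded[OF n XHD NX F])
    also have "?this \<longleftrightarrow> block_bounded m n \<Phi> F (cmod (of_real (1 - d)) * 1)"
      by (rule mbounded_cong) (use Xc in \<open>auto simp: block_entries_def \<Phi>_def fun_scale_def\<close>)
    also have "cmod (of_real (1 - d)) * 1 = 1 - d" unfolding norm_of_real using d by simp
    finally show "block_bounded m n \<Phi> F (1 - d)" .
  qed (use d in auto)
  then have "ND \<Phi> < 1" using d by simp
  from factor_cone_of_ND_less[OF n c(1) \<Phi>G this] obtain m Z \<alpha> \<beta> M' where
    rep: "factorisation n c (\<lambda>i j. if i < n \<and> j < n then \<Phi> $$ (i, j) else 0) (id_n n) (id_n n) m Z \<alpha> \<beta> M'"
    unfolding factor_cone_def by blast
  note R = factorisationD[OF rep]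
  have id: "qform n (id_n n) v = (\<Sum>i<n. (cmod (v i))\<^sup>2)" for v
    using qform_id_n[of n 1 v] by simp
  have cM: "0 \<le> c * M' * (\<Sum>i<n. (cmod (v i))\<^sup>2)" for v using c(1) R(3) by (simp add: sum_nonneg)
  \<comment> \<open>Evaluating the form inequality for the identity at the first unit vector leaves
    at most 1 for \<open>c * M'\<close>.\<close>
  have M'c: "M' \<le> 1 / c"
  proof -
    let ?v = "\<lambda>i. if i = 0 then 1 else 0 :: complex"
    have "(\<Sum>i<n. (cmod (?v i))\<^sup>2) = (\<Sum>i<n. if i = 0 then 1 else 0)" by (intro sum.cong refl) auto
    then have "(\<Sum>i<n. (cmod (?v i))\<^sup>2) = 1" using n by simp
    moreover have "0 \<le> (\<Sum>a<m. (cmod (\<Sum>i<n. \<alpha> i a * ?v i))\<^sup>2)" by (simp add: sum_nonneg)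
    ultimately have "c * M' \<le> 1" using R(5)[where v = ?v] unfolding id by simp
    then show ?thesis using c(1) by (simp add: field_simps)
  qed
  \<comment> \<open>Since the error term is nonnegative, the form inequality for the identity says
    that the coefficient matrices are contractions.\<close>
  have contr: "l2 {..<m} (\<lambda>a. \<Sum>i<n. \<gamma> i a * v i) \<le> 1 * l2 {..<n} v"
    if "\<And>v. (\<Sum>a<m. (cmod (\<Sum>i<n. \<gamma> i a * v i))\<^sup>2) + c * M' * (\<Sum>i<n. (cmod (v i))\<^sup>2) \<le> qform n (id_n n) v" for \<gamma> v
    using that[of v] cM[of v] unfolding id by (intro l2_le_mono) (auto simp: l2_sq L2_set_nonneg)
  define \<alpha>' where "\<alpha>' = mat n m (\<lambda>(i, a). \<alpha> i a)"
  define \<beta>' where "\<beta>' = mat m n (\<lambda>(b, j). \<beta> j b)"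
  have a': "\<alpha>' \<in> carrier_mat n m" and b': "\<beta>' \<in> carrier_mat m n" by (auto simp: \<alpha>'_def \<beta>'_def)
  have "mbounded {..<m} {..<n} (\<lambda>a i. \<alpha> i a) 1" by (rule mbounded_of_apply, rule contr[OF R(5)])
  then have "mbounded {..<n} {..<m} \<alpha> 1" using mbounded_transpose by metis
  then have "mbounded {..<n} {..<m} (\<lambda>i a. \<alpha>' $$ (i, a)) 1"
    by (subst mbounded_cong[where M' = \<alpha>]) (auto simp: \<alpha>'_def)
  then have oa: "opnorm \<alpha>' \<le> 1" using opnorm_le_iff[OF a', of 1] by simp
  have "mbounded {..<m} {..<n} (\<lambda>b j. \<beta> j b) 1" by (rule mbounded_of_apply, rule contr[OF R(6)])
  then have "mbounded {..<m} {..<n} (\<lambda>b j. \<beta>' $$ (b, j)) 1"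
    by (subst mbounded_cong[where M' = "\<lambda>b j. \<beta> j b"]) (auto simp: \<beta>'_def)
  then have ob: "opnorm \<beta>' \<le> 1" using opnorm_le_iff[OF b', of 1] by simp
  define Y where "Y = bimult fun_scale \<alpha>' (map_mat dl Z) \<beta>'"
  have Zc: "Z \<in> carrier_mat m m" by (rule ball_V_carrier[OF R(2)])
  have Yent: "Y $$ (i, j) = (\<Sum>a<m. \<Sum>b<m. fun_scale (\<alpha> i a * \<beta> j b) (dl (Z $$ (a, b))))" if "i < n" "j < n" for i j
  proof -
    have "Y $$ (i, j) = (\<Sum>a<m. \<Sum>b<m. fun_scale (\<alpha>' $$ (i, a) * \<beta>' $$ (b, j)) (map_mat dl Z $$ (a, b)))"
      unfolding Y_def using Zc a' b' that by (intro bimult_entry) auto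
    also have "\<dots> = (\<Sum>a<m. \<Sum>b<m. fun_scale (\<alpha> i a * \<beta> j b) (dl (Z $$ (a, b))))"
      using that Zc by (intro sum.cong refl) (auto simp: \<alpha>'_def \<beta>'_def)
    finally show ?thesis .
  qed
  have Yhull: "Y \<in> abs_matrix_convex_hull fun_scale G (A_set scaleC mnorm) n"
    unfolding abs_matrix_convex_hull_def
  proof clarify
    fix L assume L: "abs_matrix_convex fun_scale G L" "\<forall>k>0. A_set scaleC mnorm k \<subseteq> L k"
    have "map_mat dl Z \<in> L m" using L(2) R(1,2) unfolding A_set_def by blast
    then show "Y \<in> L n" unfolding Y_def by (rule abs_matrix_convexD(3)[OF L(1) R(1) n _ a' b' oa ob])
  qed
  have YHD: "Y \<in> mats n HD"
  proof (rule matsI)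
    show "Y \<in> carrier_mat n n" by (auto simp: Y_def bimult_def \<alpha>'_def \<beta>'_def)
    show "Y $$ (i, j) \<in> HD" if "i < n" "j < n" for i j
      unfolding Yent[OF that]
      by (intro HD_sums HD_scale delta_in_HD)
  qed
  have "ND (X - Y) \<le> real n * real n * (d * M + 1 / c)"
  proof (rule ND_le_of_entries[OF n mats_HD_diff[OF XHD YHD]])
    show "0 \<le> d * M + 1 / c" using d M c by simp
    fix s t assume st: "s < n" "t < n"
    have 1: "fbounded (fun_scale (of_real d) (X $$ (s, t))) (cmod (of_real d) * M)"
      by (rule fbounded_scale, rule fbounded_mono[of _ "B s t"]) (use B[OF st] BM[OF st] in auto)
    have "fbounded (\<Phi> $$ (s, t) - Y $$ (s, t)) M'"
      using R(4)[OF st] st by (simp add: Yent[OF st])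
    then have 2: "fbounded (\<Phi> $$ (s, t) - Y $$ (s, t)) (1 / c)" by (rule fbounded_mono[OF _ M'c])
    have "(X - Y) $$ (s, t) = fun_scale (of_real d) (X $$ (s, t)) + (\<Phi> $$ (s, t) - Y $$ (s, t))"
      using st Xc matsD(1)[OF YHD] by (auto simp: \<Phi>_def fun_scale_def fun_eq_iff algebra_simps)
    then show "fbounded ((X - Y) $$ (s, t)) (d * M + 1 / c)"
      using fbounded_add[OF 1 2] d by (simp only: norm_of_real abs_of_pos)
  qed
  also have "\<dots> = K * (d * M) + K * (1 / c)" by (simp only: K_def distrib_left)
  also have "\<dots> < e" using dM c(2) e by linarith
  finally show ?thesis using Yhull by blast
qed

end

theorem proposition5p4:
  fixes scaleC :: "complex \<Rightarrow> 'v::banach \<Rightarrow> 'v"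
    and mnorm :: "'v mat \<Rightarrow> real"
  assumes "operator_space scaleC mnorm"
  shows "(\<forall>n>0. closed_mball (Ginf_cb scaleC mnorm) (Ginf_cb_mnorm scaleC mnorm) n =
            matrix_closure (Ginf_cb scaleC mnorm) (Ginf_cb_mnorm scaleC mnorm)
              (abs_matrix_convex_hull fun_scale (Ginf_cb scaleC mnorm) (A_set scaleC mnorm)) n)
       \<and> (\<forall>n>0. closed_mball (Ginf_cb scaleC mnorm) (Ginf_cb_mnorm scaleC mnorm) n =
            matrix_closure (Ginf_cb scaleC mnorm) (Ginf_cb_mnorm scaleC mnorm)
              (abs_matrix_convex_hull fun_scale (Ginf_cb scaleC mnorm) (A_tilde scaleC mnorm)) n)"
proof -
  interpret operator_space scaleC mnorm by fact
  let ?hA = "abs_matrix_convex_hull fun_scale G (A_set scaleC mnorm)"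
  let ?hT = "abs_matrix_convex_hull fun_scale G (A_tilde scaleC mnorm)"
  have upper: "closed_mball G ND n \<subseteq> matrix_closure G ND ?hA n" if "0 < n" for n
    using closed_mball_approx[OF that] by (auto simp: matrix_closure_def closed_mball_def)
  have mono: "matrix_closure G ND ?hA n \<subseteq> matrix_closure G ND ?hT n" for n
    using hull_A_subset_hull_A_tilde[of n] unfolding matrix_closure_def by blast
  have lower: "matrix_closure G ND ?hA n \<subseteq> closed_mball G ND n" "matrix_closure G ND ?hT n \<subseteq> closed_mball G ND n"
    if "0 < n" for n
    by (intro matrix_closure_closed_mball[OF that] abs_matrix_convex_hull_subset[OF closed_mball_abs_matrix_convex]
        A_set_subset_closed_mball A_tilde_subset_closed_mball; assumption)+
  show ?thesis
    using upper mono lower by blast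
qed

end
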